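(* Let $m\ge 1$ be an integer and let $\gamma=(\gamma_1,\gamma_2,\ldots)$ be a sequence of real numbers with finite support defining an order $m$ multicritical Schur measure $\mathbb{P}^m_\theta(\lambda)=e^{-\theta^2\sum_r r\gamma_r^2}s_\lambda[\theta\gamma]^2$ for each $\theta>0$, with right edge coefficient $b$ and fluctuation coefficient $d$. Let $\lambda$ be a random partition distributed according to $\mathbb{P}^m_\theta$. Then, for every $s\in\mathbb{R}$, $$\lim_{\theta\to\infty}\mathbb{P}^m_\theta\left[\frac{\lambda_1-b\theta}{(d\theta)^{\frac{1}{2m+1}}}\le s\right]=F_{2m+1}(s).$$
   Context: A partition is a finite non-increasing sequence $\lambda=(\lambda_1\ge\lambda_2\ge\cdots\ge\lambda_{\ell(\lambda)})$ of positive integers, with $\lambda_i:=0$ for $i>\ell(\lambda)$. For a sequence $t=(t_1,t_2,\ldots)$ (Miwa times), define $h_k[t]$ by $\sum_k h_k[t]z^k=\exp\left[\sum_{r\ge1}t_rz^r\right]$ (so $h_k[t]=0$ for $k<0$, $h_0[t]=1$), and the Schur function $s_\lambda[t]=\det_{1\le i,j\le\ell(\lambda)}h_{\lambda_i-i+j}[t]$. Order $m$ multicritical Schur measure: for $\theta>0$, it is the probability measure on all partitions $\mathbb{P}^m_\theta(\lambda)=e^{-\theta^2\sum_r r\gamma_r^2}s_\lambda[\theta\gamma]^2$, where $\theta\gamma=(\theta\gamma_1,\theta\gamma_2,\ldots)$ and $\gamma$ is a finitely supported real sequence satisfying $\sum_{r\ge1}r^{2p+1}\gamma_r=0$ for $p=1,\ldots,m-1$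 (no condition if $m=1$), $\sum_{r\ge1}r^{2m+1}\gamma_r\ne0$, and $\sum_{r\ge1}r^2\gamma_r\sin r\phi\ge0$ for all $\phi\in[0,\pi]$. The right edge coefficient and the fluctuation coefficient are the positive constants $$b=2\sum_{r\ge1}r\gamma_r,\qquad d=\frac{2(-1)^{m+1}}{(2m)!}\sum_{r\ge1}r^{2m+1}\gamma_r.$$ Higher-order Airy function and kernel: $$\mathrm{Ai}_{2m+1}(x)=\frac1{2\pi i}\int_{1+i\mathbb{R}}\exp\left[(-1)^{m-1}\frac{\zeta^{2m+1}}{2m+1}-x\zeta\right]d\zeta,\qquad \mathcal{A}_{2m+1}(x,y)=\int_0^\infty\mathrm{Ai}_{2m+1}(x+v)\,\mathrm{Ai}_{2m+1}(y+v)\,dv.$$ $F_{2m+1}$ is the Fredholm determinant $$F_{2m+1}(s)=\det(1-\mathcal{A}_{2m+1})_{L^2([s,\infty))}=\sum_{n=0}^\infty\frac{(-1)^n}{n!}\int_s^\infty\cdots\int_s^\infty\det_{1\le i,j\le n}\mathcal{A}_{2m+1}(x_i,x_j)\,dx_1\cdots dx_n.$$ *)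

theory Defs
  imports
    "HOL-Analysis.Analysis"
    "HOL-Computational_Algebra.Formal_Power_Series"
    "Jordan_Normal_Form.Determinant"
begin

definition is_partition :: "nat list \<Rightarrow> bool" where
  "is_partition \<mu> \<longleftrightarrow> sorted_wrt (\<ge>) \<mu> \<and> (\<forall>k\<in>set \<mu>. 0 < k)"

(* Parts are numbered from 1; missing parts are 0. *)
definition part :: "nat list \<Rightarrow> nat \<Rightarrow> nat" where
  "part \<mu> i = (if 1 \<le> i \<and> i \<le> length \<mu> then \<mu> ! (i - 1) else 0)"

(* Sequences (t_1, t_2, ...) are functions on nat. The value at index 0 is never used. *)
definition miwa_h :: "(nat \<Rightarrow> real) \<Rightarrow> int \<Rightarrow> real" where
  "miwa_h t k =
     (if k < 0 then 0
      else fps_nth (fps_compose (fps_exp 1) (Abs_fps (\<lambda>r. if r = 0 then 0 else t r))) (nat k))"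

(* Matrix indices start at 0 here; the shift does not affect j - i. *)
definition schur :: "(nat \<Rightarrow> real) \<Rightarrow> nat list \<Rightarrow> real" where
  "schur t \<mu> =
     Determinant.det (Matrix.mat (length \<mu>) (length \<mu>)
       (\<lambda>(i, j). miwa_h t (int (part \<mu> (i + 1)) - int i + int j)))"

definition supp :: "(nat \<Rightarrow> real) \<Rightarrow> nat set" where
  "supp \<gamma> = {r. 1 \<le> r \<and> \<gamma> r \<noteq> 0}"

definition multicritical :: "nat \<Rightarrow> (nat \<Rightarrow> real) \<Rightarrow> bool" where
  "multicritical m \<gamma> \<longleftrightarrow>
     finite (supp \<gamma>) \<and>
     (\<forall>p\<in>{1..<m}. (\<Sum>r\<in>supp \<gamma>. real r ^ (2 * p + 1) * \<gamma> r) = 0) \<and>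
     (\<Sum>r\<in>supp \<gamma>. real r ^ (2 * m + 1) * \<gamma> r) \<noteq> 0 \<and>
     (\<forall>\<phi>\<in>{0..pi}. (\<Sum>r\<in>supp \<gamma>. real r ^ 2 * \<gamma> r * sin (real r * \<phi>)) \<ge> 0)"

definition schur_measure :: "real \<Rightarrow> (nat \<Rightarrow> real) \<Rightarrow> nat list measure" where
  "schur_measure \<theta> \<gamma> =
     density (count_space {\<mu>. is_partition \<mu>})
       (\<lambda>\<mu>. ennreal (exp (- (\<theta>\<^sup>2 * (\<Sum>r\<in>supp \<gamma>. real r * (\<gamma> r)\<^sup>2)))
                       * (schur (\<lambda>r. \<theta> * \<gamma> r) \<mu>)\<^sup>2))"

definition edge_coeff :: "(nat \<Rightarrow> real) \<Rightarrow> real" where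
  "edge_coeff \<gamma> = 2 * (\<Sum>r\<in>supp \<gamma>. real r * \<gamma> r)"

definition fluct_coeff :: "nat \<Rightarrow> (nat \<Rightarrow> real) \<Rightarrow> real" where
  "fluct_coeff m \<gamma> =
     2 * (-1) ^ (m + 1) / fact (2 * m) * (\<Sum>r\<in>supp \<gamma>. real r ^ (2 * m + 1) * \<gamma> r)"

(* The contour is parametrised by zeta = 1 + i u; the factor i comes from d zeta = i du.
   For m at least 1 the integrand is absolutely integrable: its modulus has leading
   exponent - u^(2m). *)
definition airy_contour_integral :: "nat \<Rightarrow> real \<Rightarrow> complex" where
  "airy_contour_integral m x =
     1 / (2 * of_real pi * \<i>) *
     (LINT u|lborel. exp ((-1) ^ (m - 1) * (1 + \<i> * of_real u) ^ (2 * m + 1) / of_nat (2 * m + 1)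
                          - of_real x * (1 + \<i> * of_real u)) * \<i>)"

definition higher_airy :: "nat \<Rightarrow> real \<Rightarrow> real" where
  "higher_airy m x = Re (airy_contour_integral m x)"

(* Taking the real part loses nothing. *)
lemma of_real_higher_airy: "complex_of_real (higher_airy m x) = airy_contour_integral m x"
proof -
  define f where "f u = exp ((-1) ^ (m - 1) * (1 + \<i> * complex_of_real u) ^ (2 * m + 1)
      / of_nat (2 * m + 1) - of_real x * (1 + \<i> * of_real u))" for u :: real
  have cnj_f: "cnj (f u) = f (- u)" for u
    by (simp add: f_def exp_cnj)
  have "cnj (LINT u|lborel. f u) = (LINT u|lborel. f (- u))"
    by (simp add: Bochner_Integration.integral_cnj [symmetric] cnj_f del: Bochner_Integration.integral_cnj)
  also have "\<dots> = (LINT u|lborel. f u)"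
    using lborel_integral_real_affine [of "-1" f 0] by simp
  finally have "Im (LINT u|lborel. f u) = 0"
    by (simp add: complex_eq_iff)
  moreover have "airy_contour_integral m x = of_real (1 / (2 * pi)) * (LINT u|lborel. f u)"
    unfolding airy_contour_integral_def f_def by simp
  ultimately show ?thesis
    by (simp add: higher_airy_def complex_eq_iff)
qed

definition higher_airy_kernel :: "nat \<Rightarrow> real \<Rightarrow> real \<Rightarrow> real" where
  "higher_airy_kernel m x y =
     (LINT v:{0..}|lborel. higher_airy m (x + v) * higher_airy m (y + v))"

(* det(1 - K) on L^2(S). The term for n = 0 is 1. *)
definition fredholm_det :: "(real \<Rightarrow> real \<Rightarrow> real) \<Rightarrow> real set \<Rightarrow> real" where
  "fredholm_det K S =
     (\<Sum>n. (-1) ^ n / fact n *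
        (LINT x:(PiE {..<n} (\<lambda>_. S))|Pi\<^sub>M {..<n} (\<lambda>_. lborel).
           Determinant.det (Matrix.mat n n (\<lambda>(i, j). K (x i) (x j)))))"

definition F_higher :: "nat \<Rightarrow> real \<Rightarrow> real" where
  "F_higher m s = fredholm_det (higher_airy_kernel m) {s..}"

end

theory Submission
  imports
    Defs
    "HOL-Complex_Analysis.Laurent_Convergence"
    "HOL-Probability.Distributions"
begin

text \<open>
  Write \<open>t = \<theta> \<gamma>\<close>, and let \<open>u\<close>, \<open>v\<close> be the coefficient sequences of \<open>exp (- \<Sum> t_r z^r)\<close> and
  of its inverse. By Cauchy-Binet and Jacobi's complementary minor identity, the weights
  \<open>s_\<lambda>[t]\<^sup>2\<close> with \<open>\<lambda>_1 \<le> L\<close> sum to the Toeplitz determinant \<open>D_L\<close> with symbol \<open>u(z) u(1/z)\<close>.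
  A Wiener-Hopf factorisation gives \<open>D_L = lim_N D_N det(1 - K)\<close>, the last determinant being over the
  sites \<open>L, ..., N - 1\<close>, with \<open>K = J J\<close> for the Hankel matrix \<open>J\<close> of the Laurent coefficients of
  \<open>exp (\<Sum> t_r (z^r - z^(-r)))\<close>. A differential equation along the deformation
  \<open>exp (- s \<Sum> t_r z^(-r)) u(z)\<close>, \<open>0 \<le> s \<le> 1\<close>, shows \<open>D_N \<rightarrow> exp (\<Sum> r t_r\<^sup>2)\<close>, which is exactly the
  normalisation of the measure. So the probability of \<open>\<lambda>_1 \<le> L\<close> is a discrete Fredholm determinant, and
  hence the Fredholm determinant of a step kernel on the half line.

  With \<open>\<rho> = (d \<theta>)^(-1/(2m+1))\<close> and the contour \<open>|z| = exp \<rho>\<close>, the Laurent coefficients are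
  integrals that converge, after rescaling, to \<open>Ai_{2m+1}\<close>. The positivity condition bounds the real
  part of the phase by \<open>\<rho> (C \<rho>^(2m) - c \<phi>^(2m))\<close>, which gives uniform bounds of order \<open>exp (- x)\<close>. As the
  kernels are positive semidefinite, Hadamard's inequality and dominated convergence allow the limit to
  be taken inside the Fredholm series.
\<close>

section \<open>Determinants of function matrices\<close>

text \<open>No trace class operators occur: identities are proved for finite truncations of infinite
  matrices, controlled only through absolute row sums. Hence \<open>fdet\<close> takes a function on
  indices with the size apart, so that all truncations of a matrix share one function. The price is
  that an \<open>N\<close> by \<open>N\<close> determinant is only known to be at most exponentially
  large in \<open>N\<close>, so a truncation error must beat that exponential. It does: the times
  have finite support, so the generating series are entire, and their coefficients decay faster than
  any geometric sequence; the rate is picked once the exponential constant is known. The signs of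
  \<open>b\<close> and \<open>d\<close> are results. The sine condition says that, on the unit
  circle, the radial derivative of the real part of the phase decreases away from the critical
  point; this yields both signs and the decay off that point. The radius \<open>exp \<rho>\<close>
  is chosen because the circle rescales to the line of real part 1 on which the Airy integral is
  defined, and this real part is what produces the factor \<open>exp (- x)\<close>.\<close>

definition fdet :: "nat \<Rightarrow> (nat \<Rightarrow> nat \<Rightarrow> real) \<Rightarrow> real" where
  "fdet n A = Determinant.det (Matrix.mat n n (\<lambda>(i, j). A i j))"

lemma fdet_leibniz:
  "fdet n A = (\<Sum>p | p permutes {0..<n}. of_int (sign p) * (\<Prod>i = 0..<n. A i (p i)))"
proof -
  have "A i (p i) = Matrix.mat n n (\<lambda>(i, j). A i j) $$ (i, p i)"
    if "p permutes {0..<n}" "i < n" for p i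
    using that permutes_in_image[of p "{0..<n}" i] by simp
  then show ?thesis
    unfolding fdet_def by (subst det_def'[where n = n]) (auto intro!: sum.cong prod.cong)
qed

lemma fdet_cong:
  assumes "\<And>i j. i < n \<Longrightarrow> j < n \<Longrightarrow> A i j = B i j"
  shows "fdet n A = fdet n B"
  unfolding fdet_def by (rule arg_cong[of _ _ Determinant.det]) (auto simp: assms)

lemma fdet_transpose: "fdet n (\<lambda>i j. A j i) = fdet n A"
proof -
  have "transpose_mat (Matrix.mat n n (\<lambda>(i, j). A i j)) = Matrix.mat n n (\<lambda>(i, j). A j i)"
    by (rule eq_matI) auto
  then show ?thesis
    unfolding fdet_def by (metis det_transpose mat_carrier)
qed

lemma fdet_mult: "fdet n (\<lambda>i j. \<Sum>k<n. A i k * B k j) = fdet n A * fdet n B"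
proof -
  have "Matrix.mat n n (\<lambda>(i, j). \<Sum>k<n. A i k * B k j)
      = Matrix.mat n n (\<lambda>(i, j). A i j) * Matrix.mat n n (\<lambda>(i, j). B i j)"
    by (rule eq_matI) (auto simp: scalar_prod_def lessThan_atLeast0 intro!: sum.cong)
  then show ?thesis
    unfolding fdet_def by (simp add: det_mult[of _ n])
qed

lemma fdet_equal_rows:
  assumes "i \<noteq> j" "i < n" "j < n" "\<And>k. k < n \<Longrightarrow> A i k = A j k"
  shows "fdet n A = 0"
  unfolding fdet_def
  by (rule det_identical_rows[OF _ assms(1-3)]) (auto simp: assms Matrix.row_def)

lemma fdet_zero_row:
  assumes "i < n" "\<And>k. k < n \<Longrightarrow> A i k = 0"
  shows "fdet n A = 0"
proof -
  have "(\<Prod>k = 0..<n. A k (p k)) = 0" if "p permutes {0..<n}" for p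
    using that assms permutes_in_image[of p "{0..<n}" i] by (intro prod_zero bexI[of _ i]) auto
  then show ?thesis
    unfolding fdet_leibniz by (intro sum.neutral) simp
qed

lemma fdet_block_lower:
  assumes "\<And>i j. i < L \<Longrightarrow> L \<le> j \<Longrightarrow> j < L + m \<Longrightarrow> A i j = 0"
  shows "fdet (L + m) A = fdet L A * fdet m (\<lambda>i j. A (i + L) (j + L))"
proof -
  have "Matrix.mat (L + m) (L + m) (\<lambda>(i, j). A i j)
      = four_block_mat (Matrix.mat L L (\<lambda>(i, j). A i j)) (0\<^sub>m L m)
         (Matrix.mat m L (\<lambda>(i, j). A (i + L) j)) (Matrix.mat m m (\<lambda>(i, j). A (i + L) (j + L)))"
    by (rule eq_matI) (auto simp: assms)
  then show ?thesis
    unfolding fdet_def by (simp add: det_four_block_mat_upper_right_zero[of _ L _ m])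
qed

lemma fdet_block_upper:
  assumes "\<And>i j. L \<le> i \<Longrightarrow> i < L + m \<Longrightarrow> j < L \<Longrightarrow> A i j = 0"
  shows "fdet (L + m) A = fdet L A * fdet m (\<lambda>i j. A (i + L) (j + L))"
proof -
  have "fdet (L + m) (\<lambda>i j. A j i) = fdet L (\<lambda>i j. A j i) * fdet m (\<lambda>i j. A (j + L) (i + L))"
    by (rule fdet_block_lower) (use assms in auto)
  then show ?thesis
    using fdet_transpose[of "L + m" A] fdet_transpose[of L A]
      fdet_transpose[of m "\<lambda>i j. A (i + L) (j + L)"] by simp
qed

lemma fdet_lower_unitriangular:
  assumes "\<And>i j. i < j \<Longrightarrow> j < n \<Longrightarrow> A i j = 0" "\<And>i. i < n \<Longrightarrow> A i i = 1"
  shows "fdet n A = 1"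
proof -
  have "fdet n A = prod_list (diag_mat (Matrix.mat n n (\<lambda>(i, j). A i j)))"
    unfolding fdet_def by (rule det_lower_triangular[of n]) (auto simp: assms)
  also have "\<dots> = 1"
    by (simp add: diag_mat_def prod.list_conv_set_nth assms)
  finally show ?thesis .
qed

lemma fdet_upper_unitriangular:
  assumes "\<And>i j. j < i \<Longrightarrow> i < n \<Longrightarrow> A i j = 0" "\<And>i. i < n \<Longrightarrow> A i i = 1"
  shows "fdet n A = 1"
  using fdet_lower_unitriangular[of n "\<lambda>i j. A j i"] assms fdet_transpose[of n A] by simp

section \<open>Bounds by products of row sums\<close>

lemma permutes_of_prefix_subset_PiE:
  fixes F :: "(nat \<Rightarrow> nat) \<Rightarrow> real"
  assumes nonneg: "\<And>f. f \<in> PiE {0..<n} (\<lambda>_. {0..<n}) \<Longrightarrow> 0 \<le> F f"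
    and restr: "\<And>f. F (restrict f {0..<n}) = F f"
  shows "(\<Sum>p | p permutes {0..<n}. F p) \<le> (\<Sum>f\<in>PiE {0..<n} (\<lambda>_. {0..<n}). F f)"
proof -
  \<comment> \<open>Restriction embeds the permutations into all maps of \<open>{0..<n}\<close>. A
    sum over all maps factorises by \<open>prod_sum_PiE\<close>, which is how row sums
    enter.\<close>
  let ?r = "\<lambda>p. restrict p {0..<n}"
  have inj: "inj_on ?r {p. p permutes {0..<n}}"
  proof (rule inj_onI)
    fix p q assume p: "p \<in> {p. p permutes {0..<n}}" and q: "q \<in> {p. p permutes {0..<n}}" and eq: "?r p = ?r q"
    show "p = q"
    proof
      fix x show "p x = q x"
        using p q fun_cong[OF eq, of x] permutes_not_in[of p _ x] permutes_not_in[of q _ x]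
        by (cases "x \<in> {0..<n}") auto
    qed
  qed
  have "(\<Sum>p | p permutes {0..<n}. F p) = (\<Sum>p | p permutes {0..<n}. F (?r p))"
    by (simp add: restr)
  also have "\<dots> = (\<Sum>f\<in>?r ` {p. p permutes {0..<n}}. F f)"
    by (simp add: sum.reindex[OF inj])
  also have "\<dots> \<le> (\<Sum>f\<in>PiE {0..<n} (\<lambda>_. {0..<n}). F f)"
  proof (rule sum_mono2)
    show "finite (PiE {0..<n} (\<lambda>_. {0..<n::nat}))"
      by (rule finite_PiE) auto
    show "?r ` {p. p permutes {0..<n}} \<subseteq> PiE {0..<n} (\<lambda>_. {0..<n})"
      using permutes_in_image[of _ "{0..<n}"] by fastforce
  qed (use nonneg in auto)
  finally show ?thesis .
qed

lemma abs_fdet_le: "\<bar>fdet n A\<bar> \<le> (\<Prod>i<n. \<Sum>j<n. \<bar>A i j\<bar>)"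
proof -
  have "\<bar>fdet n A\<bar> \<le> (\<Sum>p | p permutes {0..<n}. \<bar>of_int (sign p) * (\<Prod>i = 0..<n. A i (p i))\<bar>)"
    unfolding fdet_leibniz by (rule sum_abs)
  also have "\<dots> = (\<Sum>p | p permutes {0..<n}. \<Prod>i = 0..<n. \<bar>A i (p i)\<bar>)"
    by (intro sum.cong refl) (simp add: abs_mult abs_prod sign_def)
  also have "\<dots> \<le> (\<Sum>f\<in>PiE {0..<n} (\<lambda>_. {0..<n}). \<Prod>i = 0..<n. \<bar>A i (f i)\<bar>)"
    by (rule permutes_of_prefix_subset_PiE) (auto simp: prod_nonneg intro!: prod.cong)
  also have "\<dots> = (\<Prod>i<n. \<Sum>j<n. \<bar>A i j\<bar>)"
    by (subst prod_sum_PiE) (auto simp: lessThan_atLeast0)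
  finally show ?thesis .
qed

text \<open>After expansion the difference consists of the terms with at least one factor
  \<open>b i\<close>; the same terms with absolute values add up to the right-hand side.\<close>

lemma prod_abs_diff_le:
  fixes a b :: "'i \<Rightarrow> real"
  assumes "finite I"
  shows "\<bar>(\<Prod>i\<in>I. a i + b i) - (\<Prod>i\<in>I. a i)\<bar> \<le> (\<Prod>i\<in>I. \<bar>a i\<bar> + \<bar>b i\<bar>) - (\<Prod>i\<in>I. \<bar>a i\<bar>)"
  using assms
proof (induction I rule: finite_induct)
  case (insert x I)
  let ?P = "\<Prod>i\<in>I. a i + b i" and ?Q = "\<Prod>i\<in>I. a i"
  let ?P' = "\<Prod>i\<in>I. \<bar>a i\<bar> + \<bar>b i\<bar>" and ?Q' = "\<Prod>i\<in>I. \<bar>a i\<bar>"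
  have "\<bar>(a x + b x) * ?P - a x * ?Q\<bar> = \<bar>a x * (?P - ?Q) + b x * ?P\<bar>"
    by (simp add: algebra_simps)
  also have "\<dots> \<le> \<bar>a x\<bar> * \<bar>?P - ?Q\<bar> + \<bar>b x\<bar> * \<bar>?P\<bar>"
    unfolding abs_mult[symmetric] by (rule abs_triangle_ineq)
  also have "\<dots> \<le> \<bar>a x\<bar> * (?P' - ?Q') + \<bar>b x\<bar> * ?P'"
  proof (intro add_mono mult_left_mono)
    show "\<bar>?P\<bar> \<le> ?P'"
      unfolding abs_prod by (rule prod_mono) (auto simp: abs_triangle_ineq)
  qed (use insert in auto)
  also have "\<dots> = (\<bar>a x\<bar> + \<bar>b x\<bar>) * ?P' - \<bar>a x\<bar> * ?Q'"
    by (simp add: algebra_simps)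
  finally show ?case
    using insert by simp
qed simp

text \<open>A perturbation is amplified only exponentially in \<open>n\<close>, so a
  superexponentially small \<open>e\<close> survives the limit.\<close>

lemma abs_fdet_diff_le:
  assumes A: "\<And>i. i < n \<Longrightarrow> (\<Sum>j<n. \<bar>A i j\<bar>) \<le> c"
    and E: "\<And>i. i < n \<Longrightarrow> (\<Sum>j<n. \<bar>E i j\<bar>) \<le> e" and "0 \<le> c" "0 \<le> e" "e \<le> 1"
  shows "\<bar>fdet n (\<lambda>i j. A i j + E i j) - fdet n A\<bar> \<le> real n * e * (c + 1) ^ n"
proof -
  let ?a = "\<lambda>i. \<Sum>j<n. \<bar>A i j\<bar>" and ?e = "\<lambda>i. \<Sum>j<n. \<bar>E i j\<bar>"
  let ?PE = "PiE {0..<n} (\<lambda>_. {0..<n})"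
  have "\<bar>fdet n (\<lambda>i j. A i j + E i j) - fdet n A\<bar>
      \<le> (\<Sum>p | p permutes {0..<n}. \<bar>of_int (sign p) *
           ((\<Prod>i = 0..<n. A i (p i) + E i (p i)) - (\<Prod>i = 0..<n. A i (p i)))\<bar>)"
    unfolding fdet_leibniz sum_subtractf[symmetric] right_diff_distrib[symmetric] by (rule sum_abs)
  also have "\<dots> \<le> (\<Sum>p | p permutes {0..<n}. (\<Prod>i = 0..<n. \<bar>A i (p i)\<bar> + \<bar>E i (p i)\<bar>) - (\<Prod>i = 0..<n. \<bar>A i (p i)\<bar>))"
  proof (rule sum_mono)
    fix p :: "nat \<Rightarrow> nat"
    have "\<bar>real_of_int (sign p)\<bar> = 1"
      by (simp add: sign_def)
    then show "\<bar>of_int (sign p) *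
           ((\<Prod>i = 0..<n. A i (p i) + E i (p i)) - (\<Prod>i = 0..<n. A i (p i)))\<bar>
       \<le> (\<Prod>i = 0..<n. \<bar>A i (p i)\<bar> + \<bar>E i (p i)\<bar>) - (\<Prod>i = 0..<n. \<bar>A i (p i)\<bar>)"
      using prod_abs_diff_le[of "{0..<n}" "\<lambda>i. A i (p i)" "\<lambda>i. E i (p i)"] by (simp add: abs_mult)
  qed
  also have "\<dots> \<le> (\<Sum>p\<in>?PE. (\<Prod>i = 0..<n. \<bar>A i (p i)\<bar> + \<bar>E i (p i)\<bar>) - (\<Prod>i = 0..<n. \<bar>A i (p i)\<bar>))"
  proof (rule permutes_of_prefix_subset_PiE)
    fix f
    show "(\<Prod>i = 0..<n. \<bar>A i (restrict f {0..<n} i)\<bar> + \<bar>E i (restrict f {0..<n} i)\<bar>) -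
         (\<Prod>i = 0..<n. \<bar>A i (restrict f {0..<n} i)\<bar>) =
         (\<Prod>i = 0..<n. \<bar>A i (f i)\<bar> + \<bar>E i (f i)\<bar>) - (\<Prod>i = 0..<n. \<bar>A i (f i)\<bar>)"
      by (intro arg_cong2[of _ _ _ _ "(-)"] prod.cong) auto
  qed (simp add: prod_mono)
  also have "\<dots> = (\<Prod>i = 0..<n. \<Sum>j\<in>{0..<n}. \<bar>A i j\<bar> + \<bar>E i j\<bar>) - (\<Prod>i = 0..<n. \<Sum>j\<in>{0..<n}. \<bar>A i j\<bar>)"
    by (simp add: sum_subtractf prod_sum_PiE)
  also have "\<dots> = (\<Prod>i<n. ?a i + ?e i) - (\<Prod>i<n. ?a i)"
    by (simp add: lessThan_atLeast0 sum.distrib)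
  also have "\<dots> \<le> real n * e * (c + 1) ^ n"
  proof -
    \<comment> \<open>Each further factor multiplies the old difference by at most
      \<open>c + 1\<close>, because \<open>e \<le> 1\<close>, and adds at most
      \<open>e * c ^ k\<close>.\<close>
    have "(\<Prod>i<k. ?a i + ?e i) - (\<Prod>i<k. ?a i) \<le> real k * e * (c + 1) ^ k" if "k \<le> n" for k
      using that
    proof (induction k)
      case (Suc k)
      let ?P = "\<Prod>i<k. ?a i + ?e i" and ?Q = "\<Prod>i<k. ?a i"
      have Q: "?Q \<le> c ^ k" "0 \<le> ?Q"
        using Suc.prems A prod_mono[of "{..<k}" ?a "\<lambda>_. c"] by (auto simp: sum_nonneg intro!: prod_nonneg)
      have PQ: "0 \<le> ?P - ?Q"
        by (simp add: prod_mono sum_nonneg)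
      have ck: "c ^ k \<le> (c + 1) ^ Suc k"
        using assms power_mono[of c "c + 1" k] power_increasing[of k "Suc k" "c + 1"] by linarith
      have "(\<Prod>i<Suc k. ?a i + ?e i) - (\<Prod>i<Suc k. ?a i) = (?P - ?Q) * (?a k + ?e k) + ?e k * ?Q"
        by (simp add: algebra_simps)
      also have "\<dots> \<le> (?P - ?Q) * (c + 1) + e * (c + 1) ^ Suc k"
        using Suc.prems A[of k] E[of k] order_trans[OF E[of k] \<open>e \<le> 1\<close>] PQ Q ck assms
        by (intro add_mono mult_left_mono mult_mono) (auto simp: sum_nonneg)
      also have "\<dots> \<le> (real k * e * (c + 1) ^ k) * (c + 1) + e * (c + 1) ^ Suc k"
        using Suc assms by (intro add_right_mono mult_right_mono) auto
      also have "\<dots> = real (Suc k) * e * (c + 1) ^ Suc k"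
        by (simp add: algebra_simps)
      finally show ?case .
    qed simp
    then show ?thesis by simp
  qed
  finally show ?thesis .
qed

section \<open>Linearity in a row, derivatives and limits\<close>

lemma fdet_upd_row:
  assumes "k < n"
  shows "fdet n (A(k := r)) =
    (\<Sum>p | p permutes {0..<n}. of_int (sign p) * (r (p k) * (\<Prod>i\<in>{0..<n} - {k}. A i (p i))))"
  unfolding fdet_leibniz using assms
  by (intro sum.cong refl arg_cong2[of _ _ _ _ "(*)"]) (auto simp: prod.remove[of _ k] intro!: prod.cong)

lemma fdet_upd_row_sum:
  assumes "k < n" "finite F" "\<And>j. j < n \<Longrightarrow> r j = (\<Sum>l\<in>F. c l * B l j)"
  shows "fdet n (A(k := r)) = (\<Sum>l\<in>F. c l * fdet n (A(k := B l)))"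
proof -
  have "fdet n (A(k := r)) = (\<Sum>p | p permutes {0..<n}. \<Sum>l\<in>F.
      of_int (sign p) * ((c l * B l (p k)) * (\<Prod>i\<in>{0..<n} - {k}. A i (p i))))"
    unfolding fdet_upd_row[OF assms(1)]
  proof (intro sum.cong refl)
    fix p assume "p \<in> {p. p permutes {0..<n}}"
    then have "r (p k) = (\<Sum>l\<in>F. c l * B l (p k))"
      using assms permutes_in_image[of p "{0..<n}" k] by simp
    then show "of_int (sign p) * (r (p k) * (\<Prod>i\<in>{0..<n} - {k}. A i (p i))) = (\<Sum>l\<in>F.
      of_int (sign p) * ((c l * B l (p k)) * (\<Prod>i\<in>{0..<n} - {k}. A i (p i))))"
      by (simp add: sum_distrib_left sum_distrib_right)
  qed
  also have "\<dots> = (\<Sum>l\<in>F. c l * fdet n (A(k := B l)))"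
    unfolding fdet_upd_row[OF assms(1)]
    by (subst sum.swap) (simp add: sum_distrib_left mult_ac)
  finally show ?thesis .
qed

lemma fdet_has_field_derivative:
  assumes "\<And>i j. i < n \<Longrightarrow> j < n \<Longrightarrow> ((\<lambda>s. A s i j) has_field_derivative A' i j) (at s)"
  shows "((\<lambda>s. fdet n (A s)) has_field_derivative (\<Sum>k<n. fdet n ((A s)(k := A' k)))) (at s)"
proof -
  have "((\<lambda>s. fdet n (A s)) has_field_derivative
     (\<Sum>p | p permutes {0..<n}. of_int (sign p) *
        (\<Sum>k\<in>{0..<n}. A' k (p k) * (\<Prod>i\<in>{0..<n} - {k}. A s i (p i))))) (at s)"
    unfolding fdet_leibniz
  proof (intro DERIV_sum DERIV_cmult has_field_derivative_prod)
    fix p i assume "p \<in> {p. p permutes {0..<n}}" "i \<in> {0..<n}"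
    then show "((\<lambda>x. A x i (p i)) has_field_derivative A' i (p i)) (at s)"
      using permutes_in_image[of p "{0..<n}" i] by (intro assms) auto
  qed
  moreover have "(\<Sum>p | p permutes {0..<n}. of_int (sign p) *
        (\<Sum>k\<in>{0..<n}. A' k (p k) * (\<Prod>i\<in>{0..<n} - {k}. A s i (p i))))
      = (\<Sum>k<n. fdet n ((A s)(k := A' k)))"
    by (simp add: fdet_upd_row sum_distrib_left lessThan_atLeast0 sum.swap[of _ "{0..<n}"])
  ultimately show ?thesis
    by simp
qed

lemma fdet_tendsto:
  assumes "\<And>i j. i < n \<Longrightarrow> j < n \<Longrightarrow> ((\<lambda>x. A x i j) \<longlongrightarrow> B i j) F"
  shows "((\<lambda>x. fdet n (A x)) \<longlongrightarrow> fdet n B) F"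
  unfolding fdet_leibniz
proof (intro tendsto_sum tendsto_mult tendsto_const tendsto_prod)
  fix p i assume "p \<in> {p. p permutes {0..<n}}" "i \<in> {0..<n}"
  then show "((\<lambda>x. A x i (p i)) \<longlongrightarrow> B i (p i)) F"
    using permutes_in_image[of p "{0..<n}" i] by (intro assms) auto
qed

section \<open>Cauchy-Binet and the expansion of det(1 - K)\<close>

lemma sum_PiE_inj_eq_sum_subsets:
  fixes G :: "(nat \<Rightarrow> 'a) \<Rightarrow> real"
  assumes fin: "finite X"
    and zero: "\<And>f. f \<in> PiE {..<n} (\<lambda>_. X) \<Longrightarrow> \<not> inj_on f {..<n} \<Longrightarrow> G f = 0"
    and eq: "\<And>f. f \<in> PiE {..<n} (\<lambda>_. X) \<Longrightarrow> inj_on f {..<n} \<Longrightarrow> G f = H (f ` {..<n})"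
  shows "(\<Sum>f\<in>PiE {..<n} (\<lambda>_. X). G f) = fact n * (\<Sum>S | S \<subseteq> X \<and> card S = n. H S)"
proof -
  let ?P = "PiE {..<n} (\<lambda>_. X)" and ?T = "{S. S \<subseteq> X \<and> card S = n}"
  let ?I = "{f \<in> ?P. inj_on f {..<n}}"
  have finP: "finite ?P"
    using fin by (simp add: finite_PiE)
  have finT: "finite ?T"
    using fin by simp
  have "(\<Sum>f\<in>?P. G f) = (\<Sum>f\<in>?I. H (f ` {..<n}))"
    by (rule sum.mono_neutral_cong_right) (use finP zero eq in auto)
  \<comment> \<open>The injections are grouped by image: a set of size \<open>n\<close> is the image
    of exactly \<open>fact n\<close> of them.\<close>
  also have "\<dots> = (\<Sum>S\<in>?T. \<Sum>f\<in>{f \<in> ?I. f ` {..<n} = S}. H (f ` {..<n}))"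
  proof (rule sum.group[symmetric])
    show "finite ?I"
      using finP by simp
    show "(\<lambda>f. f ` {..<n}) ` ?I \<subseteq> ?T"
      using card_image[of _ "{..<n}"] by fastforce
  qed (rule finT)
  also have "\<dots> = (\<Sum>S\<in>?T. fact n * H S)"
  proof (rule sum.cong[OF refl])
    fix S assume S: "S \<in> ?T"
    then have finS: "finite S"
      using fin finite_subset by auto
    have "{f \<in> ?I. f ` {..<n} = S} = {f \<in> PiE {..<n} (\<lambda>_. S). inj_on f {..<n}}"
      using S finS by (auto simp: PiE_iff subset_iff card_image intro!: card_subset_eq) (metis card_image card_lessThan card_subset_eq image_subset_iff lessThan_iff imageI)+
    then have "card {f \<in> ?I. f ` {..<n} = S} = prod ((-) n) {0..<n}"
      using S finS card_inj_on_subset_funcset[of "{..<n}" S "{..<n}"] by simp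
    also have "\<dots> = fact n"
      by (simp add: fact_prod_rev)
    finally show "(\<Sum>f\<in>{f \<in> ?I. f ` {..<n} = S}. H (f ` {..<n})) = fact n * H S"
      by simp
  qed
  finally show ?thesis
    by (simp add: sum_distrib_left)
qed

lemma fdet_comp_permutes_cols:
  assumes "q permutes {0..<n}"
  shows "fdet n (\<lambda>i j. A i (q j)) = of_int (sign q) * fdet n A"
proof -
  have "Determinant.det (Matrix.mat n n (\<lambda>(i, j). Matrix.mat n n (\<lambda>(i, j). A j i) $$ (q i, j)))
      = signof q * Determinant.det (Matrix.mat n n (\<lambda>(i, j). A j i))"
    by (rule det_permute_rows[OF _ assms]) auto
  moreover have "Matrix.mat n n (\<lambda>(i, j). Matrix.mat n n (\<lambda>(i, j). A j i) $$ (q i, j))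
      = Matrix.mat n n (\<lambda>(i, j). A j (q i))"
    by (rule eq_matI) (use assms permutes_in_image[of q "{0..<n}"] in auto)
  ultimately have "fdet n (\<lambda>i j. A j (q i)) = of_int (sign q) * fdet n (\<lambda>i j. A j i)"
    by (simp add: fdet_def)
  then show ?thesis
    using fdet_transpose[of n A] fdet_transpose[of n "\<lambda>i j. A i (q j)"] by simp
qed

lemma fdet_comp_permutes:
  assumes "q permutes {0..<n}"
  shows "fdet n (\<lambda>i j. A (q i) (q j)) = fdet n A"
proof -
  have "fdet n (\<lambda>i j. A (q i) (q j)) = of_int (sign q) * fdet n (\<lambda>i j. A (q i) j)"
    by (rule fdet_comp_permutes_cols[OF assms])
  also have "fdet n (\<lambda>i j. A (q i) j) = fdet n (\<lambda>i j. A (q j) i)"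
    by (rule fdet_transpose[symmetric])
  also have "\<dots> = of_int (sign q) * fdet n (\<lambda>i j. A j i)"
    by (rule fdet_comp_permutes_cols[OF assms])
  also have "fdet n (\<lambda>i j. A j i) = fdet n A"
    by (rule fdet_transpose)
  finally show ?thesis
    by (simp add: sign_def)
qed

text \<open>Cauchy-Binet with all maps in place of increasing ones: every minor is counted
  \<open>fact n\<close> times, and no ordering of \<open>X\<close> enters.\<close>

lemma fdet_sum_product:
  fixes A B :: "nat \<Rightarrow> 'a \<Rightarrow> real"
  assumes "finite X"
  shows "fact n * fdet n (\<lambda>i j. \<Sum>k\<in>X. A i k * B j k)
    = (\<Sum>f\<in>PiE {0..<n} (\<lambda>_. X). fdet n (\<lambda>i j. A i (f j)) * fdet n (\<lambda>i j. B i (f j)))"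
proof -
  let ?P = "PiE {0..<n} (\<lambda>_. X)"
  have *: "fdet n (\<lambda>i j. \<Sum>k\<in>X. A i k * B j k) = (\<Sum>f\<in>?P. (\<Prod>i = 0..<n. A i (f i)) * fdet n (\<lambda>i j. B i (f j)))"
  proof -
    have "fdet n (\<lambda>i j. \<Sum>k\<in>X. A i k * B j k) = (\<Sum>p | p permutes {0..<n}. \<Sum>f\<in>?P.
        of_int (sign p) * ((\<Prod>i = 0..<n. A i (f i)) * (\<Prod>i = 0..<n. B (p i) (f i))))"
      unfolding fdet_leibniz using assms by (simp add: prod_sum_PiE prod.distrib sum_distrib_left)
    also have "\<dots> = (\<Sum>f\<in>?P. (\<Prod>i = 0..<n. A i (f i)) * fdet n (\<lambda>i j. B j (f i)))"
      by (subst sum.swap) (simp add: fdet_leibniz sum_distrib_left mult_ac)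
    also have "\<dots> = (\<Sum>f\<in>?P. (\<Prod>i = 0..<n. A i (f i)) * fdet n (\<lambda>i j. B i (f j)))"
      by (simp add: fdet_transpose[of n "\<lambda>i j. B i (f j)" for f])
    finally show ?thesis .
  qed
  \<comment> \<open>Replacing \<open>f\<close> by \<open>f \<circ> q\<close> permutes the summation
    range, while the determinant of \<open>B\<close> only gains the sign of \<open>q\<close>.
    Summing these \<open>fact n\<close> forms of one number over \<open>q\<close> assembles the
    determinant of \<open>A\<close>.\<close>
  have perm: "fdet n (\<lambda>i j. \<Sum>k\<in>X. A i k * B j k) = (\<Sum>f\<in>?P. of_int (sign q) * (\<Prod>i = 0..<n. A i (f (q i))) * fdet n (\<lambda>i j. B i (f j)))"
    if q: "q permutes {0..<n}" for q
  proof -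
    have bij: "bij_betw (\<lambda>f. restrict (f \<circ> q) {0..<n}) ?P ?P"
    proof (rule bij_betw_byWitness[where f' = "\<lambda>f. restrict (f \<circ> inv_into UNIV q) {0..<n}"])
      show "\<forall>f\<in>?P. restrict (restrict (f \<circ> q) {0..<n} \<circ> inv_into UNIV q) {0..<n} = f"
      proof (intro ballI ext)
        fix f x assume f: "f \<in> ?P"
        show "restrict (restrict (f \<circ> q) {0..<n} \<circ> inv_into UNIV q) {0..<n} x = f x"
        proof (cases "x \<in> {0..<n}")
          case True
          then have "inv_into UNIV q x \<in> {0..<n}"
            by (simp only: permutes_in_image[OF permutes_inv[OF q]])
          then show ?thesis
            using True permutes_inverses(1)[OF q, of x] by simp
        qed (use PiE_arb[OF f] in \<open>simp add: restrict_def\<close>)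
      qed
      show "\<forall>f\<in>?P. restrict (restrict (f \<circ> inv_into UNIV q) {0..<n} \<circ> q) {0..<n} = f"
      proof (intro ballI ext)
        fix f x assume f: "f \<in> ?P"
        show "restrict (restrict (f \<circ> inv_into UNIV q) {0..<n} \<circ> q) {0..<n} x = f x"
        proof (cases "x \<in> {0..<n}")
          case True
          then have "q x \<in> {0..<n}"
            by (simp only: permutes_in_image[OF q])
          then show ?thesis
            using True permutes_inverses(2)[OF q, of x] by simp
        qed (use PiE_arb[OF f] in \<open>simp add: restrict_def\<close>)
      qed
      show "(\<lambda>f. restrict (f \<circ> q) {0..<n}) ` ?P \<subseteq> ?P"
      proof (rule image_subsetI)
        fix f assume f: "f \<in> ?P"
        show "restrict (f \<circ> q) {0..<n} \<in> ?P"
          unfolding restrict_PiE_iff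
        proof
          fix x assume "x \<in> {0..<n}"
          then have "q x \<in> {0..<n}"
            by (simp only: permutes_in_image[OF q])
          then show "(f \<circ> q) x \<in> X"
            using PiE_mem[OF f] by simp
        qed
      qed
      show "(\<lambda>f. restrict (f \<circ> inv_into UNIV q) {0..<n}) ` ?P \<subseteq> ?P"
      proof (rule image_subsetI)
        fix f assume f: "f \<in> ?P"
        show "restrict (f \<circ> inv_into UNIV q) {0..<n} \<in> ?P"
          unfolding restrict_PiE_iff
        proof
          fix x assume "x \<in> {0..<n}"
          then have "inv_into UNIV q x \<in> {0..<n}"
            by (simp only: permutes_in_image[OF permutes_inv[OF q]])
          then show "(f \<circ> inv_into UNIV q) x \<in> X"
            using PiE_mem[OF f] by simp
        qed
      qed
    qed
    have "fdet n (\<lambda>i j. \<Sum>k\<in>X. A i k * B j k)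
       = (\<Sum>f\<in>?P. (\<Prod>i = 0..<n. A i (restrict (f \<circ> q) {0..<n} i)) * fdet n (\<lambda>i j. B i (restrict (f \<circ> q) {0..<n} j)))"
      unfolding * by (rule sum.reindex_bij_betw[OF bij, symmetric])
    also have "\<dots> = (\<Sum>f\<in>?P. (\<Prod>i = 0..<n. A i (f (q i))) * fdet n (\<lambda>i j. B i (f (q j))))"
      by (intro sum.cong arg_cong2[of _ _ _ _ "(*)"] prod.cong fdet_cong) auto
    also have "\<dots> = (\<Sum>f\<in>?P. (\<Prod>i = 0..<n. A i (f (q i))) * (of_int (sign q) * fdet n (\<lambda>i j. B i (f j))))"
      by (intro sum.cong refl arg_cong2[of _ _ _ _ "(*)"] fdet_comp_permutes_cols[OF q, of "\<lambda>i j. B i (f j)" for f])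
    finally show ?thesis
      by (simp add: mult_ac)
  qed
  have "fact n * fdet n (\<lambda>i j. \<Sum>k\<in>X. A i k * B j k)
      = (\<Sum>q | q permutes {0..<n}. fdet n (\<lambda>i j. \<Sum>k\<in>X. A i k * B j k))"
    by (simp add: card_permutations)
  also have "\<dots> = (\<Sum>q | q permutes {0..<n}. \<Sum>f\<in>?P. of_int (sign q) * (\<Prod>i = 0..<n. A i (f (q i))) * fdet n (\<lambda>i j. B i (f j)))"
    by (intro sum.cong refl perm) auto
  also have "\<dots> = (\<Sum>f\<in>?P. fdet n (\<lambda>i j. A i (f j)) * fdet n (\<lambda>i j. B i (f j)))"
    by (subst sum.swap) (simp add: fdet_leibniz[of _ "\<lambda>i j. A i (f j)" for f] sum_distrib_right)
  finally show ?thesis .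
qed

text \<open>The right-hand side depends on \<open>f\<close> only through its image, which allows
  sums over maps to be regrouped over subsets.\<close>

lemma fdet_comp_bij:
  assumes f: "inj_on f {..<n}"
  shows "fdet n (\<lambda>i j. K (f i) (f j))
    = (\<Sum>p | p permutes (f ` {..<n}). of_int (sign p) * (\<Prod>x\<in>f ` {..<n}. K x (p x)))"
proof -
  have f': "inj_on f {0..<n}"
    using f by (simp add: lessThan_atLeast0)
  let ?S = "f ` {0..<n}" and ?m = "map_permutation {0..<n} f"
  have b: "bij_betw f {0..<n} ?S"
    using f' by (rule inj_on_imp_bij_betw)
  let ?g = "inv_into {0..<n} f"
  have b': "bij_betw ?g ?S {0..<n}"
    by (rule bij_betw_inv_into[OF b])
  have bij: "bij_betw ?m {p. p permutes {0..<n}} {p. p permutes ?S}"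
  proof (rule bij_betw_byWitness[where f' = "map_permutation ?S ?g"])
    show "\<forall>p\<in>{p. p permutes {0..<n}}. map_permutation ?S ?g (?m p) = p"
      using map_permutation_compose_inv[OF b] f' by simp
    show "\<forall>p\<in>{p. p permutes ?S}. ?m (map_permutation ?S ?g p) = p"
      using map_permutation_compose_inv[OF b'] by (simp add: f_inv_into_f)
  qed (use map_permutation_permutes[OF b] map_permutation_permutes[OF b'] in auto)
  have "(\<Sum>p | p permutes ?S. of_int (sign p) * (\<Prod>x\<in>?S. K x (p x)))
      = (\<Sum>p | p permutes {0..<n}. of_int (sign (?m p)) * (\<Prod>x\<in>?S. K x (?m p x)))"
    by (rule sum.reindex_bij_betw[OF bij, symmetric])
  also have "\<dots> = fdet n (\<lambda>i j. K (f i) (f j))"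
    unfolding fdet_leibniz
  proof (intro sum.cong refl arg_cong2[of _ _ _ _ "(*)"])
    fix p assume p: "p \<in> {p. p permutes {0..<n}}"
    show "real_of_int (sign (?m p)) = real_of_int (sign p)"
      using sign_map_permutation[OF f', of p] p by simp
    show "(\<Prod>x\<in>?S. K x (?m p x)) = (\<Prod>i = 0..<n. K (f i) (f (p i)))"
      by (simp add: prod.reindex[OF f'] map_permutation_apply[OF f'])
  qed
  finally show ?thesis
    by (simp add: lessThan_atLeast0)
qed

text \<open>\<open>S\<close> records the rows in which \<open>- K\<close> is chosen; in the other
  rows the identity matrix forces \<open>p i = i\<close>, so \<open>p\<close> permutes
  \<open>S\<close>.\<close>

lemma fdet_one_minus_subsets:
  "fdet n (\<lambda>i j. (if i = j then 1 else 0) - K i j)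
    = (\<Sum>S\<in>Pow {0..<n}. (-1) ^ card S * (\<Sum>p | p permutes S. of_int (sign p) * (\<Prod>x\<in>S. K x (p x))))"
proof -
  let ?N = "{0..<n}"
  have "fdet n (\<lambda>i j. (if i = j then 1 else 0) - K i j)
      = (\<Sum>p | p permutes ?N. of_int (sign p) * (\<Sum>S\<in>Pow ?N. (\<Prod>i\<in>S. - K i (p i)) * (\<Prod>i\<in>?N - S. if i = p i then 1 else 0)))"
    unfolding fdet_leibniz
    using prod_add[of ?N "\<lambda>i. - K i (p i)" "\<lambda>i. if i = p i then 1 else 0" for p]
    by (simp add: algebra_simps)
  also have "\<dots> = (\<Sum>S\<in>Pow ?N. \<Sum>p | p permutes ?N. of_int (sign p) * ((\<Prod>i\<in>S. - K i (p i)) * (\<Prod>i\<in>?N - S. if i = p i then 1 else 0)))"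
    by (simp add: sum_distrib_left sum.swap[of _ "Pow ?N"])
  also have "\<dots> = (\<Sum>S\<in>Pow ?N. \<Sum>p | p permutes S. of_int (sign p) * (\<Prod>i\<in>S. - K i (p i)))"
  proof (rule sum.cong[OF refl])
    fix S assume S: "S \<in> Pow ?N"
    show "(\<Sum>p | p permutes ?N. of_int (sign p) * ((\<Prod>i\<in>S. - K i (p i)) * (\<Prod>i\<in>?N - S. if i = p i then 1 else 0)))
       = (\<Sum>p | p permutes S. of_int (sign p) * (\<Prod>i\<in>S. - K i (p i)))"
    proof (rule sum.mono_neutral_cong_right)
      show "finite {p. p permutes ?N}"
        by (simp add: finite_permutations)
      show "{p. p permutes S} \<subseteq> {p. p permutes ?N}"
        using S permutes_subset by blast
      show "\<forall>p\<in>{p. p permutes ?N} - {p. p permutes S}.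
         real_of_int (sign p) * ((\<Prod>i\<in>S. - K i (p i)) * (\<Prod>i\<in>?N - S. if i = p i then 1 else 0)) = 0"
      proof
        fix p assume p: "p \<in> {p. p permutes ?N} - {p. p permutes S}"
        then obtain i where "i \<in> ?N - S" "p i \<noteq> i"
          by (metis DiffI Diff_iff mem_Collect_eq permutes_superset)
        then have "(\<Prod>i\<in>?N - S. if i = p i then 1 else 0 :: real) = 0"
          by (intro prod_zero bexI[of _ i]) auto
        then show "real_of_int (sign p) * ((\<Prod>i\<in>S. - K i (p i)) * (\<Prod>i\<in>?N - S. if i = p i then 1 else 0)) = 0"
          by simp
      qed
      fix p assume p: "p \<in> {p. p permutes S}"
      then have "(\<Prod>i\<in>?N - S. if i = p i then 1 else 0 :: real) = 1"
        by (intro prod.neutral) (auto simp: permutes_def)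
      then show "real_of_int (sign p) * ((\<Prod>i\<in>S. - K i (p i)) * (\<Prod>i\<in>?N - S. if i = p i then 1 else 0))
        = real_of_int (sign p) * (\<Prod>i\<in>S. - K i (p i))"
        by simp
    qed
  qed
  also have "\<dots> = (\<Sum>S\<in>Pow ?N. (-1) ^ card S * (\<Sum>p | p permutes S. of_int (sign p) * (\<Prod>x\<in>S. K x (p x))))"
    by (simp add: prod_uminus sum_distrib_left mult_ac)
  finally show ?thesis .
qed

text \<open>Terms with \<open>k > n\<close> vanish for want of injections, so \<open>m\<close> can
  be any bound from \<open>n\<close> on. This matches the Fredholm series against all of its long
  partial sums.\<close>

lemma fdet_one_minus_expansion:
  assumes "n \<le> m"
  shows "fdet n (\<lambda>i j. (if i = j then 1 else 0) - K i j)
    = (\<Sum>k\<le>m. (-1) ^ k / fact k * (\<Sum>f\<in>PiE {..<k} (\<lambda>_. {..<n}). fdet k (\<lambda>i j. K (f i) (f j))))"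
proof -
  define H where "H S = (\<Sum>p | p permutes S. of_int (sign p) * (\<Prod>x\<in>S. K x (p x)))" for S :: "nat set"
  have k: "(\<Sum>f\<in>PiE {..<k} (\<lambda>_. {..<n}). fdet k (\<lambda>i j. K (f i) (f j)))
      = fact k * (\<Sum>S | S \<subseteq> {..<n} \<and> card S = k. H S)" for k
  proof (rule sum_PiE_inj_eq_sum_subsets)
    fix f assume "f \<in> PiE {..<k} (\<lambda>_. {..<n})" "\<not> inj_on f {..<k}"
    then obtain i j where "i < k" "j < k" "i \<noteq> j" "f i = f j"
      unfolding inj_on_def by auto
    then show "fdet k (\<lambda>i j. K (f i) (f j)) = 0"
      by (intro fdet_equal_rows[of i j]) auto
  qed (simp_all add: H_def fdet_comp_bij)
  have "fdet n (\<lambda>i j. (if i = j then 1 else 0) - K i j) = (\<Sum>S\<in>Pow {..<n}. (-1) ^ card S * H S)"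
    by (simp add: fdet_one_minus_subsets H_def lessThan_atLeast0)
  also have "\<dots> = (\<Sum>k\<le>m. \<Sum>S\<in>{S \<in> Pow {..<n}. card S = k}. (-1) ^ card S * H S)"
  proof (rule sum.group[symmetric])
    have "card S \<le> m" if "S \<subseteq> {..<n}" for S
      using card_mono[OF _ that] assms by simp
    then show "card ` Pow {..<n} \<subseteq> {..m}"
      by auto
  qed auto
  also have "\<dots> = (\<Sum>k\<le>m. (-1) ^ k * (\<Sum>S | S \<subseteq> {..<n} \<and> card S = k. H S))"
    by (intro sum.cong refl) (auto simp: sum_distrib_left intro!: sum.cong)
  also have "\<dots> = (\<Sum>k\<le>m. (-1) ^ k / fact k * (\<Sum>f\<in>PiE {..<k} (\<lambda>_. {..<n}). fdet k (\<lambda>i j. K (f i) (f j))))"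
    by (simp add: k)
  finally show ?thesis .
qed

section \<open>Hadamard's inequality for positive semidefinite matrices\<close>

lemma psd_diag_nonneg:
  fixes K :: "nat \<Rightarrow> nat \<Rightarrow> real"
  assumes "\<And>c. 0 \<le> (\<Sum>i<n. \<Sum>j<n. c i * c j * K i j)" "i < n"
  shows "0 \<le> K i i"
proof -
  have "(\<Sum>k<n. \<Sum>l<n. (if k = i then 1 else 0) * (if l = i then 1 else 0) * K k l)
      = (\<Sum>k<n. if k = i then (\<Sum>l<n. if l = i then K k l else 0) else 0)"
    by (intro sum.cong refl) (auto intro!: sum.cong simp del: sum.delta sum.delta')
  also have "\<dots> = K i i"
    using assms(2) by (simp only: sum.delta finite_lessThan lessThan_iff if_True)
  finally show ?thesis
    using assms(1)[of "\<lambda>k. if k = i then 1 else 0"] by (simp only:)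
qed

text \<open>Induction through the Schur complement of the first entry: one elimination step leaves a
  positive semidefinite matrix with a diagonal no larger than before.\<close>

lemma fdet_psd_bounds:
  assumes sym: "\<And>i j. i < n \<Longrightarrow> j < n \<Longrightarrow> K i j = K j i"
    and psd: "\<And>c. 0 \<le> (\<Sum>i<n. \<Sum>j<n. c i * c j * K i j)"
  shows "0 \<le> fdet n K \<and> fdet n K \<le> (\<Prod>i<n. K i i)"
  using assms
proof (induction n arbitrary: K)
  case 0
  then show ?case by (simp add: fdet_leibniz)
next
  case (Suc n)
  note sym = Suc.prems(1) and psd = Suc.prems(2)
  have diag: "0 \<le> K i i" if "i < Suc n" for i
    using psd_diag_nonneg[OF psd that] .
  have split0: "(\<Sum>i<Suc n. \<Sum>j<Suc n. c i * c j * K i j)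
      = c 0 * c 0 * K 0 0 + 2 * c 0 * (\<Sum>j<n. c (Suc j) * K 0 (Suc j))
        + (\<Sum>i<n. \<Sum>j<n. c (Suc i) * c (Suc j) * K (Suc i) (Suc j))" for c
  proof -
    have "(\<Sum>i<n. c (Suc i) * c 0 * K (Suc i) 0) = c 0 * (\<Sum>j<n. c (Suc j) * K 0 (Suc j))"
      unfolding sum_distrib_left using sym by (intro sum.cong) auto
    moreover have "(\<Sum>j<n. c 0 * c (Suc j) * K 0 (Suc j)) = c 0 * (\<Sum>j<n. c (Suc j) * K 0 (Suc j))"
      by (simp add: sum_distrib_left mult_ac)
    ultimately show ?thesis
      by (simp add: sum.lessThan_Suc_shift sum.distrib del: sum.lessThan_Suc)
  qed
  show ?case
  proof (cases "K 0 0 = 0")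
    case True
    \<comment> \<open>With a zero corner the form at the vector with entries \<open>x\<close> at 0
      and 1 at \<open>j\<close> is affine in \<open>x\<close>. It stays nonnegative for every real
      \<open>x\<close>, so its slope \<open>2 * K 0 j\<close> must be zero.\<close>
    have "K 0 j = 0" if j: "j < Suc n" for j
    proof (cases j)
      case (Suc l)
      then have l: "l < n" using j by simp
      have "0 \<le> 2 * x * K 0 j + K j j" for x :: real
      proof -
        let ?c = "\<lambda>k. if k = 0 then x else if k = j then 1 else 0"
        have "(\<Sum>i<n. \<Sum>i'<n. ?c (Suc i) * ?c (Suc i') * K (Suc i) (Suc i'))
            = (\<Sum>i<n. if i = l then (\<Sum>i'<n. if i' = l then K (Suc i) (Suc i') else 0) else 0)"
          using Suc by (intro sum.cong refl) (auto intro!: sum.cong simp del: sum.delta sum.delta')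
        also have "\<dots> = K j j"
          using l Suc by (simp only: sum.delta finite_lessThan lessThan_iff if_True)
        finally have 1: "(\<Sum>i<n. \<Sum>i'<n. ?c (Suc i) * ?c (Suc i') * K (Suc i) (Suc i')) = K j j" .
        have "(\<Sum>i<n. ?c (Suc i) * K 0 (Suc i)) = (\<Sum>i<n. if i = l then K 0 (Suc i) else 0)"
          using Suc by (intro sum.cong) auto
        also have "\<dots> = K 0 j"
          using l Suc by simp
        finally have 2: "(\<Sum>i<n. ?c (Suc i) * K 0 (Suc i)) = K 0 j" .
        show ?thesis
          using psd[of ?c] unfolding split0 1 2 using True by simp
      qed
      note nonneg = this
      show ?thesis
      proof (rule ccontr)
        assume "K 0 j \<noteq> 0"
        then have "2 * (- (K j j + 1) / (2 * K 0 j)) * K 0 j = - (K j j + 1)"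
          by simp
        with nonneg[of "- (K j j + 1) / (2 * K 0 j)"] show False
          by linarith
      qed
    qed (use True in simp)
    then have "fdet (Suc n) K = 0"
      by (intro fdet_zero_row[of 0]) auto
    moreover have "(\<Prod>i<Suc n. K i i) = 0"
      using True by (intro prod_zero) auto
    ultimately show ?thesis
      by (simp only: order_refl simp_thms)
  next
    case False
    then have a: "0 < K 0 0"
      using diag[of 0] by simp
    \<comment> \<open>\<open>S\<close> is the Schur complement, and \<open>Lo\<close> times
      \<open>Up\<close> is one step of Gaussian elimination with pivot \<open>K 0 0\<close>.\<close>
    define S where "S i j = K (Suc i) (Suc j) - K (Suc i) 0 * K 0 (Suc j) / K 0 0" for i j
    define Lo where "Lo i j = (if i = j then 1 else if j = 0 then K i 0 / K 0 0 else 0)" for i j :: nat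
    define Up where "Up i j = (case i of 0 \<Rightarrow> K 0 j | Suc i' \<Rightarrow> (case j of 0 \<Rightarrow> 0 | Suc j' \<Rightarrow> S i' j'))" for i j
    have "fdet (Suc n) K = fdet (Suc n) (\<lambda>i j. \<Sum>k<Suc n. Lo i k * Up k j)"
    proof (rule fdet_cong)
      fix i j assume ij: "i < Suc n" "j < Suc n"
      show "K i j = (\<Sum>k<Suc n. Lo i k * Up k j)"
      proof (cases i)
        case 0
        then show ?thesis
          by (simp add: sum.lessThan_Suc_shift Lo_def Up_def del: sum.lessThan_Suc)
      next
        case (Suc i')
        then have i': "i' < n" using ij by simp
        have "(\<Sum>k<n. Lo i (Suc k) * Up (Suc k) j) = (\<Sum>k<n. if k = i' then Up (Suc k) j else 0)"
          using Suc by (intro sum.cong) (auto simp: Lo_def)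
        also have "\<dots> = Up i j"
          using i' Suc by simp
        finally show ?thesis
          using Suc a by (cases j) (simp_all add: sum.lessThan_Suc_shift Lo_def Up_def S_def field_simps del: sum.lessThan_Suc)
      qed
    qed
    also have "\<dots> = fdet (Suc n) Lo * fdet (Suc n) Up"
      by (rule fdet_mult)
    also have "fdet (Suc n) Lo = 1"
      by (rule fdet_lower_unitriangular) (auto simp: Lo_def)
    also have "fdet (Suc n) Up = fdet 1 Up * fdet n (\<lambda>i j. Up (i + 1) (j + 1))"
      using fdet_block_upper[of 1 n Up] by (auto simp: Up_def split: nat.split)
    also have "fdet 1 Up = K 0 0"
      by (simp add: fdet_leibniz Up_def)
    also have "(\<lambda>i j. Up (i + 1) (j + 1)) = S"
      by (simp add: Up_def fun_eq_iff)
    finally have dtK: "fdet (Suc n) K = K 0 0 * fdet n S"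
      by simp
    have psdS: "0 \<le> (\<Sum>i<n. \<Sum>j<n. c i * c j * S i j)" for c
    proof -       define w where "w = (\<Sum>j<n. c j * K 0 (Suc j))"
      have "(\<Sum>i<n. \<Sum>j<n. c i * c j * S i j)
          = (\<Sum>i<n. \<Sum>j<n. c i * c j * K (Suc i) (Suc j)) - (\<Sum>i<n. \<Sum>j<n. (c i * K 0 (Suc i)) * (c j * K 0 (Suc j))) / K 0 0"
        unfolding S_def sum_divide_distrib sum_subtractf[symmetric]
        using sym by (intro sum.cong refl) (simp add: algebra_simps)
      also have "(\<Sum>i<n. \<Sum>j<n. (c i * K 0 (Suc i)) * (c j * K 0 (Suc j))) = w * w"
        unfolding w_def sum_product ..
      finally have "(\<Sum>i<n. \<Sum>j<n. c i * c j * S i j) = (\<Sum>i<n. \<Sum>j<n. c i * c j * K (Suc i) (Suc j)) - w * w / K 0 0" .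
      \<comment> \<open>The first coordinate \<open>- w / K 0 0\<close> minimises the quadratic form
        over that coordinate; the minimum is the form of \<open>S\<close>.\<close>
      moreover have "0 \<le> (- w / K 0 0) * (- w / K 0 0) * K 0 0 + 2 * (- w / K 0 0) * w
          + (\<Sum>i<n. \<Sum>j<n. c i * c j * K (Suc i) (Suc j))"
        using psd[of "\<lambda>i. case i of 0 \<Rightarrow> - w / K 0 0 | Suc i' \<Rightarrow> c i'"] unfolding split0 by (simp add: w_def)
      moreover have "(- w / K 0 0) * (- w / K 0 0) * K 0 0 + 2 * (- w / K 0 0) * w = - (w * w / K 0 0)"
        using a by (simp add: field_simps)
      ultimately show ?thesis
        by linarith
    qed
    have "S i j = S j i" if "i < n" "j < n" for i j
      using that sym[of "Suc i" "Suc j"] sym[of 0 "Suc j"] sym[of "Suc i" 0] by (simp add: S_def mult.commute)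
    then have "0 \<le> fdet n S \<and> fdet n S \<le> (\<Prod>i<n. S i i)"
      using psdS by (rule Suc.IH)
    moreover have "(\<Prod>i<n. S i i) \<le> (\<Prod>i<n. K (Suc i) (Suc i))"
    proof (rule prod_mono)
      fix i assume "i \<in> {..<n}"
      then have i: "i < n" by simp
      have "0 \<le> S i i"
        using psd_diag_nonneg[OF psdS i] .
      moreover have "S i i \<le> K (Suc i) (Suc i)"
        using a sym[of "Suc i" 0] i by (simp add: S_def)
      ultimately show "0 \<le> S i i \<and> S i i \<le> K (Suc i) (Suc i)" by simp
    qed
    ultimately have "0 \<le> fdet n S" "fdet n S \<le> (\<Prod>i<n. K (Suc i) (Suc i))" by auto
    then show ?thesis
      unfolding dtK prod.lessThan_Suc_shift using a by (simp del: prod.lessThan_Suc)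
  qed
qed

section \<open>Infinite matrices with bounded rows\<close>

text \<open>A bound on the operator norm for bounded sequences, put through finite partial sums so
  that it covers summability as well.\<close>

definition row_bdd :: "real \<Rightarrow> (nat \<Rightarrow> nat \<Rightarrow> real) \<Rightarrow> bool" where
  "row_bdd c A \<longleftrightarrow> (\<forall>i F. finite F \<longrightarrow> (\<Sum>j\<in>F. \<bar>A i j\<bar>) \<le> c)"

definition mmul :: "(nat \<Rightarrow> nat \<Rightarrow> real) \<Rightarrow> (nat \<Rightarrow> nat \<Rightarrow> real) \<Rightarrow> nat \<Rightarrow> nat \<Rightarrow> real" where
  "mmul A B i j = (\<Sum>\<^sub>\<infinity>k. A i k * B k j)"

definition unit_mat :: "nat \<Rightarrow> nat \<Rightarrow> real" where
  "unit_mat i j = (if i = j then 1 else 0)"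

lemma row_bddD: "row_bdd c A \<Longrightarrow> finite F \<Longrightarrow> (\<Sum>j\<in>F. \<bar>A i j\<bar>) \<le> c"
  by (simp add: row_bdd_def)

lemma row_bdd_nonneg: "row_bdd c A \<Longrightarrow> 0 \<le> c"
  using row_bddD[of c A "{}"] by simp

lemma row_bdd_entry: "row_bdd c A \<Longrightarrow> \<bar>A i j\<bar> \<le> c"
  using row_bddD[of c A "{j}"] by simp

lemma row_bdd_abs_summable: "row_bdd c A \<Longrightarrow> (\<lambda>j. \<bar>A i j\<bar>) summable_on UNIV"
  by (rule nonneg_bdd_above_summable_on) (auto simp: row_bdd_def intro!: bdd_aboveI2)

lemma row_bdd_infsum: "row_bdd c A \<Longrightarrow> (\<Sum>\<^sub>\<infinity>j. \<bar>A i j\<bar>) \<le> c"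
  by (rule infsum_le_finite_sums) (auto simp: row_bdd_abs_summable row_bddD)

lemma abs_summable_mult_bounded:
  fixes f g :: "'a \<Rightarrow> real"
  assumes "(\<lambda>k. \<bar>f k\<bar>) summable_on X" "\<And>k. k \<in> X \<Longrightarrow> \<bar>g k\<bar> \<le> c"
  shows "(\<lambda>k. \<bar>f k * g k\<bar>) summable_on X" "(\<lambda>k. f k * g k) summable_on X"
proof -
  have "(\<lambda>k. norm (f k * g k)) summable_on X"
  proof (rule Infinite_Sum.abs_summable_on_comparison_test')
    show "(\<lambda>k. \<bar>f k\<bar> * c) summable_on X"
      using assms(1) by (rule summable_on_cmult_left)
  qed (use assms(2) in \<open>auto simp: abs_mult intro!: mult_left_mono\<close>)
  then show "(\<lambda>k. \<bar>f k * g k\<bar>) summable_on X" "(\<lambda>k. f k * g k) summable_on X"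
    using abs_summable_summable[of "\<lambda>k. f k * g k" X] by simp_all
qed

lemma row_bdd_mult_summable:
  assumes "row_bdd a A" "row_bdd b B"
  shows "(\<lambda>k. \<bar>A i k * B k j\<bar>) summable_on X" "(\<lambda>k. A i k * B k j) summable_on X"
  using abs_summable_mult_bounded[OF row_bdd_abs_summable[OF assms(1)], of "\<lambda>k. B k j" b]
    row_bdd_entry[OF assms(2)] summable_on_subset_banach by blast+

lemma abs_infsum_le:
  fixes f :: "'a \<Rightarrow> real"
  assumes "(\<lambda>k. \<bar>f k\<bar>) summable_on X"
  shows "\<bar>infsum f X\<bar> \<le> (\<Sum>\<^sub>\<infinity>k\<in>X. \<bar>f k\<bar>)"
  using norm_infsum_bound[of f X] assms by simp

lemma infsum_sum_swap:
  fixes f :: "'a \<Rightarrow> 'b \<Rightarrow> real"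
  assumes "finite F" "\<And>j. j \<in> F \<Longrightarrow> f j summable_on X"
  shows "(\<lambda>k. \<Sum>j\<in>F. f j k) summable_on X \<and> (\<Sum>\<^sub>\<infinity>k\<in>X. \<Sum>j\<in>F. f j k) = (\<Sum>j\<in>F. infsum (f j) X)"
  using assms by (induction F rule: finite_induct) (simp_all add: summable_on_add infsum_add)

text \<open>The actual row sum of \<open>A\<close> is kept instead of its bound \<open>a\<close>,
  because the rows of \<open>K\<close> must inherit the decay of the rows of
  \<open>hankel J\<close>.\<close>

lemma sum_abs_mmul_le:
  assumes A: "row_bdd a A" and B: "row_bdd b B" and F: "finite F"
  shows "(\<Sum>j\<in>F. \<bar>mmul A B i j\<bar>) \<le> (\<Sum>\<^sub>\<infinity>k. \<bar>A i k\<bar>) * b"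
proof -
  have "(\<Sum>j\<in>F. \<bar>mmul A B i j\<bar>) \<le> (\<Sum>j\<in>F. \<Sum>\<^sub>\<infinity>k. \<bar>A i k * B k j\<bar>)"
    unfolding mmul_def by (intro sum_mono abs_infsum_le row_bdd_mult_summable[OF A B])
  also have "\<dots> = (\<Sum>\<^sub>\<infinity>k. \<Sum>j\<in>F. \<bar>A i k * B k j\<bar>)"
    using infsum_sum_swap[OF F row_bdd_mult_summable(1)[OF A B]] by simp
  also have "\<dots> \<le> (\<Sum>\<^sub>\<infinity>k. \<bar>A i k\<bar> * b)"
  proof (rule infsum_mono)
    show "(\<lambda>k. \<Sum>j\<in>F. \<bar>A i k * B k j\<bar>) summable_on UNIV"
      using infsum_sum_swap[OF F row_bdd_mult_summable(1)[OF A B]] by simp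
    show "(\<lambda>k. \<bar>A i k\<bar> * b) summable_on UNIV"
      by (rule summable_on_cmult_left[OF row_bdd_abs_summable[OF A]])
    fix k
    have "(\<Sum>j\<in>F. \<bar>A i k * B k j\<bar>) = \<bar>A i k\<bar> * (\<Sum>j\<in>F. \<bar>B k j\<bar>)"
      by (simp add: abs_mult sum_distrib_left)
    also have "\<dots> \<le> \<bar>A i k\<bar> * b"
      by (intro mult_left_mono row_bddD[OF B F]) auto
    finally show "(\<Sum>j\<in>F. \<bar>A i k * B k j\<bar>) \<le> \<bar>A i k\<bar> * b" .
  qed
  also have "\<dots> = (\<Sum>\<^sub>\<infinity>k. \<bar>A i k\<bar>) * b"
    by (rule infsum_cmult_left')
  finally show ?thesis .
qed

lemma row_bdd_mmul:
  assumes "row_bdd a A" "row_bdd b B"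
  shows "row_bdd (a * b) (mmul A B)"
  unfolding row_bdd_def
proof (intro allI impI)
  fix i and F :: "nat set" assume F: "finite F"
  show "(\<Sum>j\<in>F. \<bar>mmul A B i j\<bar>) \<le> a * b"
    using sum_abs_mmul_le[OF assms F, of i]
      mult_right_mono[OF row_bdd_infsum[OF assms(1), of i] row_bdd_nonneg[OF assms(2)]] by linarith
qed

text \<open>Fubini: the double family is absolutely summable, since the inner sums are at most
  \<open>b * c\<close> times the entries of a row of \<open>A\<close>.\<close>

lemma mmul_assoc:
  assumes A: "row_bdd a A" and B: "row_bdd b B" and C: "row_bdd c C"
  shows "mmul (mmul A B) C = mmul A (mmul B C)"
proof (intro ext)
  fix i l
  let ?f = "\<lambda>k j. A i k * B k j * C j l"
  have inner: "(\<lambda>j. \<bar>?f k j\<bar>) summable_on UNIV" for k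
    using row_bdd_mult_summable(1)[OF B C, of k l UNIV, THEN summable_on_cmult_right, of "\<bar>A i k\<bar>"]
    by (simp add: abs_mult mult_ac)
  have le: "(\<Sum>\<^sub>\<infinity>j. \<bar>?f k j\<bar>) \<le> \<bar>A i k\<bar> * (b * c)" for k
  proof -
    have "(\<Sum>\<^sub>\<infinity>j. \<bar>?f k j\<bar>) = \<bar>A i k\<bar> * (\<Sum>\<^sub>\<infinity>j. \<bar>B k j\<bar> * \<bar>C j l\<bar>)"
      by (subst infsum_cmult_right'[symmetric]) (simp add: abs_mult mult_ac)
    also have "(\<Sum>\<^sub>\<infinity>j. \<bar>B k j\<bar> * \<bar>C j l\<bar>) \<le> (\<Sum>\<^sub>\<infinity>j. \<bar>B k j\<bar> * c)"
      using row_bdd_mult_summable(1)[OF B C] row_bdd_entry[OF C]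
      by (intro infsum_mono summable_on_cmult_left row_bdd_abs_summable[OF B] mult_left_mono)
         (auto simp: abs_mult)
    also have "\<dots> \<le> b * c"
      unfolding infsum_cmult_left' by (intro mult_right_mono row_bdd_infsum[OF B] row_bdd_nonneg[OF C])
    finally show ?thesis
      by (simp add: mult_left_mono)
  qed
  have "(\<lambda>x. norm (case x of (k, j) \<Rightarrow> ?f k j)) summable_on UNIV \<times> UNIV"
  proof (rule Infinite_Sum.abs_summable_on_Sigma_iff[THEN iffD2], intro conjI ballI)
    show "(\<lambda>k. norm (\<Sum>\<^sub>\<infinity>j. norm (case (k, j) of (k, j) \<Rightarrow> ?f k j))) summable_on UNIV"
    proof (rule Infinite_Sum.abs_summable_on_comparison_test')
      show "(\<lambda>k. \<bar>A i k\<bar> * (b * c)) summable_on UNIV"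
        by (rule summable_on_cmult_left[OF row_bdd_abs_summable[OF A]])
    qed (use le in \<open>simp add: infsum_nonneg\<close>)
  qed (use inner in simp)
  then have sw: "(\<lambda>(k, j). ?f k j) summable_on UNIV \<times> UNIV"
    by (rule abs_summable_summable)
  have "mmul (mmul A B) C i l = (\<Sum>\<^sub>\<infinity>j. \<Sum>\<^sub>\<infinity>k. ?f k j)"
    unfolding mmul_def infsum_cmult_left'[symmetric] ..
  also have "\<dots> = (\<Sum>\<^sub>\<infinity>k. \<Sum>\<^sub>\<infinity>j. ?f k j)"
    by (rule infsum_swap_banach[OF sw, symmetric])
  also have "\<dots> = mmul A (mmul B C) i l"
    unfolding mmul_def infsum_cmult_right'[symmetric] by (simp add: mult.assoc)
  finally show "mmul (mmul A B) C i l = mmul A (mmul B C) i l" .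
qed

lemma infsum_indicator_eq:
  fixes f :: "'a \<Rightarrow> real"
  assumes "\<And>k. k \<noteq> j \<Longrightarrow> f k = 0"
  shows "(\<Sum>\<^sub>\<infinity>k. f k) = f j"
  using infsum_cong_neutral[of "{j}" UNIV f f] assms by simp

lemma mmul_unit_left: "mmul unit_mat A = A"
  by (intro ext, subst mmul_def, subst infsum_indicator_eq) (auto simp: unit_mat_def)

lemma mmul_unit_right: "mmul A unit_mat = A"
  unfolding mmul_def fun_eq_iff
proof (intro allI)
  fix i j show "(\<Sum>\<^sub>\<infinity>k. A i k * unit_mat k j) = A i j"
    by (subst infsum_indicator_eq[of j]) (auto simp: unit_mat_def)
qed

lemma mmul_diff_right:
  assumes "row_bdd a A" "row_bdd b B" "row_bdd c C"
  shows "mmul A (\<lambda>i j. B i j - C i j) i j = mmul A B i j - mmul A C i j"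
proof -
  have "mmul A (\<lambda>i j. B i j - C i j) i j = (\<Sum>\<^sub>\<infinity>k. A i k * B k j + - (A i k * C k j))"
    unfolding mmul_def by (simp add: right_diff_distrib)
  also have "\<dots> = (\<Sum>\<^sub>\<infinity>k. A i k * B k j) + (\<Sum>\<^sub>\<infinity>k. - (A i k * C k j))"
    by (intro infsum_add summable_on_uminus[THEN iffD2] row_bdd_mult_summable[OF assms(1,2)] row_bdd_mult_summable[OF assms(1,3)])
  finally show ?thesis
    by (simp add: mmul_def infsum_uminus)
qed

lemma mmul_diff_left:
  assumes "row_bdd a A" "row_bdd b B" "row_bdd c C"
  shows "mmul (\<lambda>i j. B i j - C i j) A i j = mmul B A i j - mmul C A i j"
proof -
  have "mmul (\<lambda>i j. B i j - C i j) A i j = (\<Sum>\<^sub>\<infinity>k. B i k * A k j + - (C i k * A k j))"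
    unfolding mmul_def by (simp add: left_diff_distrib)
  also have "\<dots> = (\<Sum>\<^sub>\<infinity>k. B i k * A k j) + (\<Sum>\<^sub>\<infinity>k. - (C i k * A k j))"
    by (intro infsum_add summable_on_uminus[THEN iffD2] row_bdd_mult_summable[OF assms(2,1)] row_bdd_mult_summable[OF assms(3,1)])
  finally show ?thesis
    by (simp add: mmul_def infsum_uminus)
qed

section \<open>Toeplitz and Hankel matrices\<close>

definition toep_low :: "(nat \<Rightarrow> real) \<Rightarrow> nat \<Rightarrow> nat \<Rightarrow> real" where
  "toep_low u i j = (if j \<le> i then u (i - j) else 0)"

text \<open>\<open>toep_low u\<close> is the Toeplitz matrix with symbol \<open>u(z)\<close>, and
  \<open>toep_up u\<close> the one with symbol \<open>u(1/z)\<close>.\<close>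

definition toep_up :: "(nat \<Rightarrow> real) \<Rightarrow> nat \<Rightarrow> nat \<Rightarrow> real" where
  "toep_up u i j = (if i \<le> j then u (j - i) else 0)"

text \<open>The offset 1 selects the coefficients of strictly positive index; they account for what
  a product of Toeplitz matrices loses at the boundary.\<close>

definition hankel :: "(nat \<Rightarrow> real) \<Rightarrow> nat \<Rightarrow> nat \<Rightarrow> real" where
  "hankel u i j = u (i + j + 1)"

lemma sum_abs_reindex_le:
  fixes u :: "nat \<Rightarrow> real"
  assumes u: "\<And>F. finite F \<Longrightarrow> (\<Sum>k\<in>F. \<bar>u k\<bar>) \<le> c"
    and F: "finite F" and h: "inj_on h (F \<inter> X)"
    and A: "\<And>j. j \<in> F \<inter> X \<Longrightarrow> A j = u (h j)" "\<And>j. j \<in> F - X \<Longrightarrow> A j = 0"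
  shows "(\<Sum>j\<in>F. \<bar>A j\<bar>) \<le> c"
proof -
  have "(\<Sum>j\<in>F. \<bar>A j\<bar>) = (\<Sum>j\<in>F \<inter> X. \<bar>u (h j)\<bar>)"
    using F A by (intro sum.mono_neutral_cong_right) auto
  also have "\<dots> = (\<Sum>k\<in>h ` (F \<inter> X). \<bar>u k\<bar>)"
    by (simp add: sum.reindex[OF h])
  also have "\<dots> \<le> c"
    using F by (intro u) auto
  finally show ?thesis .
qed

lemma
  assumes u: "\<And>F. finite F \<Longrightarrow> (\<Sum>k\<in>F. \<bar>u k\<bar>) \<le> c"
  shows row_bdd_toep_low: "row_bdd c (toep_low u)"
    and row_bdd_toep_up: "row_bdd c (toep_up u)"
    and row_bdd_hankel: "row_bdd c (hankel u)"
proof -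
  show "row_bdd c (toep_low u)"
    unfolding row_bdd_def
  proof (intro allI impI)
    fix i and F :: "nat set" assume F: "finite F"
    show "(\<Sum>j\<in>F. \<bar>toep_low u i j\<bar>) \<le> c"
      by (rule sum_abs_reindex_le[of u c F "\<lambda>j. i - j" "{..i}" "toep_low u i", OF u F]) (auto simp: toep_low_def inj_on_def)
  qed
  show "row_bdd c (toep_up u)"
    unfolding row_bdd_def
  proof (intro allI impI)
    fix i and F :: "nat set" assume F: "finite F"
    show "(\<Sum>j\<in>F. \<bar>toep_up u i j\<bar>) \<le> c"
      by (rule sum_abs_reindex_le[of u c F "\<lambda>j. j - i" "{i..}" "toep_up u i", OF u F]) (auto simp: toep_up_def inj_on_def)
  qed
  show "row_bdd c (hankel u)"
    unfolding row_bdd_def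
  proof (intro allI impI)
    fix i and F :: "nat set" assume F: "finite F"
    show "(\<Sum>j\<in>F. \<bar>hankel u i j\<bar>) \<le> c"
      by (rule sum_abs_reindex_le[of u c F "\<lambda>j. i + j + 1" "UNIV" "hankel u i", OF u F]) (auto simp: hankel_def inj_on_def)
  qed
qed

lemma mmul_toep_low_inverse:
  assumes "\<And>n. (\<Sum>k\<le>n. u k * v (n - k)) = (if n = 0 then 1 else 0)"
  shows "mmul (toep_low u) (toep_low v) = unit_mat"
proof (intro ext)
  fix i j
  show "mmul (toep_low u) (toep_low v) i j = unit_mat i j"
  proof (cases "j \<le> i")
    case True
    have "mmul (toep_low u) (toep_low v) i j = (\<Sum>\<^sub>\<infinity>k\<in>{j..i}. u (i - k) * v (k - j))"
      unfolding mmul_def by (rule infsum_cong_neutral) (auto simp: toep_low_def)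
    also have "\<dots> = (\<Sum>k\<in>{j..i}. u (i - k) * v (k - j))"
      by simp
    also have "\<dots> = (\<Sum>k\<le>i - j. u k * v (i - j - k))"
      using True by (intro sum.reindex_bij_witness[of _ "\<lambda>k. i - k" "\<lambda>k. i - k"]) auto
    finally show ?thesis
      using True assms[of "i - j"] by (auto simp: unit_mat_def)
  next
    case False
    then have "mmul (toep_low u) (toep_low v) i j = (\<Sum>\<^sub>\<infinity>k::nat. 0)"
      unfolding mmul_def by (intro infsum_cong) (auto simp: toep_low_def)
    then show ?thesis
      using False by (simp add: unit_mat_def)
  qed
qed

lemma mmul_toep_up: "mmul (toep_up u) (toep_up v) i j = mmul (toep_low v) (toep_low u) j i"
  unfolding mmul_def by (rule infsum_cong) (auto simp: toep_up_def toep_low_def)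

text \<open>Widom's identity \<open>T(a b) = T(a) T(b) + H(a) H(b~)\<close> for \<open>a = v\<close> and \<open>b = v~\<close>.\<close>
lemma mmul_toep_low_up:
  assumes v: "\<And>F. finite F \<Longrightarrow> (\<Sum>k\<in>F. \<bar>v k\<bar>) \<le> c"
  shows "mmul (toep_low v) (toep_up v) i j = mmul (toep_up v) (toep_low v) i j - mmul (hankel v) (hankel v) i j"
proof -
  have main: "mmul (toep_up v) (toep_low v) i j = mmul (toep_low v) (toep_up v) i j + mmul (hankel v) (hankel v) i j"
    if ij: "i \<le> j" for i j
  proof -
    let ?g = "\<lambda>p. v p * v (p + (j - i))"
    have entry: "\<bar>v k\<bar> \<le> c" for k
      using v[of "{k}"] by simp
    have "(\<lambda>k. \<bar>v k\<bar>) summable_on UNIV"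
      by (rule nonneg_bdd_above_summable_on) (use v in \<open>auto intro!: bdd_aboveI2\<close>)
    then have sg: "?g summable_on UNIV"
      by (rule abs_summable_mult_bounded) (rule entry)
    have "mmul (toep_up v) (toep_low v) i j = (\<Sum>\<^sub>\<infinity>k\<in>{j..}. v (k - i) * v (k - j))"
      unfolding mmul_def using ij by (intro infsum_cong_neutral) (auto simp: toep_low_def toep_up_def)
    also have "\<dots> = (\<Sum>\<^sub>\<infinity>p. ?g p)"
      using ij by (intro infsum_reindex_bij_witness[of _ "\<lambda>p. p + j" "\<lambda>k. k - j"]) auto
    \<comment> \<open>The full sum is the entry of the upper-lower product. Its part up to
      \<open>i\<close> is the entry in the opposite order, and its tail is the Hankel
      square.\<close>
    also have "\<dots> = (\<Sum>\<^sub>\<infinity>p\<in>{..i}. ?g p) + (\<Sum>\<^sub>\<infinity>p\<in>{i<..}. ?g p)"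
    proof -
      have "{..i} \<union> {i<..} = (UNIV :: nat set)"
        by auto
      then show ?thesis
        using infsum_Un_disjoint[of ?g "{..i}" "{i<..}"] summable_on_subset_banach[OF sg] by fastforce
    qed
    also have "(\<Sum>\<^sub>\<infinity>p\<in>{..i}. ?g p) = (\<Sum>\<^sub>\<infinity>k\<in>{..i}. v (i - k) * v (j - k))"
    proof (rule infsum_reindex_bij_witness[of _ "\<lambda>p. i - p" "\<lambda>k. i - k"])
      fix p assume "p \<in> {..i}"
      then have "i - (i - p) = p" "j - (i - p) = p + (j - i)"
        using ij by auto
      then show "v (i - (i - p)) * v (j - (i - p)) = ?g p"
        by (simp only:)
    qed auto
    also have "\<dots> = mmul (toep_low v) (toep_up v) i j"
      unfolding mmul_def using ij by (intro infsum_cong_neutral) (auto simp: toep_low_def toep_up_def)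
    also have "(\<Sum>\<^sub>\<infinity>p\<in>{i<..}. ?g p) = mmul (hankel v) (hankel v) i j"
      unfolding mmul_def hankel_def
    proof (rule infsum_reindex_bij_witness[of _ "\<lambda>k. i + k + 1" "\<lambda>p. p - i - 1"])
      fix p assume "p \<in> {i<..}"
      then have "i + (p - i - 1) + 1 = p" "(p - i - 1) + j + 1 = p + (j - i)"
        using ij by auto
      then show "v (i + (p - i - 1) + 1) * v ((p - i - 1) + j + 1) = ?g p"
        by (simp only:)
    qed auto
    finally show ?thesis .
  qed
  have sym: "mmul (toep_up v) (toep_low v) i j = mmul (toep_up v) (toep_low v) j i"
    "mmul (toep_low v) (toep_up v) i j = mmul (toep_low v) (toep_up v) j i"
    "mmul (hankel v) (hankel v) i j = mmul (hankel v) (hankel v) j i"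
    unfolding mmul_def by (auto intro!: infsum_cong simp: toep_low_def toep_up_def hankel_def ac_simps)
  show ?thesis
  proof (cases "i \<le> j")
    case False
    then show ?thesis
      unfolding sym using main[of j i] by simp
  qed (use main in simp)
qed

text \<open>The coefficient of \<open>z ^ n\<close> in \<open>u(1/z) v(z)\<close>, for
  \<open>n\<close> at least 0.\<close>

definition correlation :: "(nat \<Rightarrow> real) \<Rightarrow> (nat \<Rightarrow> real) \<Rightarrow> nat \<Rightarrow> real" where
  "correlation u v n = (\<Sum>\<^sub>\<infinity>p. u p * v (p + n))"

lemma mmul_toep_up_hankel: "mmul (toep_up u) (hankel v) = hankel (correlation u v)"
proof (intro ext)
  fix i j
  have "mmul (toep_up u) (hankel v) i j = (\<Sum>\<^sub>\<infinity>k\<in>{i..}. u (k - i) * v (k + j + 1))"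
    unfolding mmul_def by (rule infsum_cong_neutral) (auto simp: toep_up_def hankel_def)
  also have "\<dots> = correlation u v (i + j + 1)"
    unfolding correlation_def by (rule infsum_reindex_bij_witness[of _ "\<lambda>p. p + i" "\<lambda>k. k - i"]) (auto simp: add_ac)
  finally show "mmul (toep_up u) (hankel v) i j = hankel (correlation u v) i j"
    by (simp add: hankel_def)
qed

lemma mmul_hankel_toep_low: "mmul (hankel v) (toep_low u) = hankel (correlation u v)"
proof -
  have "mmul (hankel v) (toep_low u) i j = mmul (toep_up u) (hankel v) j i" for i j
    unfolding mmul_def by (rule infsum_cong) (auto simp: toep_low_def toep_up_def hankel_def ac_simps)
  then show ?thesis
    by (auto simp: mmul_toep_up_hankel hankel_def fun_eq_iff add_ac)
qed

section \<open>The Borodin-Okounkov formula\<close>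

text \<open>Equivalently, the power series is entire. All rates are demanded at once because the
  exponential to be beaten depends on row bounds that are known only later.\<close>

definition fast_decay :: "(nat \<Rightarrow> real) \<Rightarrow> bool" where
  "fast_decay u \<longleftrightarrow> (\<forall>q. 0 < q \<longrightarrow> q < 1 \<longrightarrow> (\<exists>C\<ge>0. \<forall>n. \<bar>u n\<bar> \<le> C * q ^ n))"

lemma fast_decayE:
  assumes "fast_decay u" "0 < q" "q < 1"
  obtains C where "0 \<le> C" "\<And>n. \<bar>u n\<bar> \<le> C * q ^ n"
  using assms unfolding fast_decay_def by blast

lemma sum_geometric_le:
  fixes q :: real
  assumes "0 \<le> q" "q \<le> 1 / 2" "finite F"
  shows "(\<Sum>k\<in>F. q ^ k) \<le> 2"
proof -
  have "(\<Sum>k\<in>F. q ^ k) \<le> (\<Sum>k. q ^ k)"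
    using assms by (intro sum_le_suminf summable_geometric) auto
  also have "\<dots> = 1 / (1 - q)"
    using assms by (intro suminf_geometric) auto
  also have "\<dots> \<le> 2"
    using assms by (simp add: field_simps)
  finally show ?thesis .
qed

lemma fast_decay_sum_bound:
  assumes "fast_decay u"
  obtains c where "0 \<le> c" "\<And>F. finite F \<Longrightarrow> (\<Sum>k\<in>F. \<bar>u k\<bar>) \<le> c"
proof -
  obtain C where C: "0 \<le> C" "\<And>n. \<bar>u n\<bar> \<le> C * (1 / 2) ^ n"
    using fast_decayE[OF assms, of "1 / 2"] by auto
  show ?thesis
  proof (rule that[of "C * 2"])
    fix F :: "nat set" assume F: "finite F"
    have "(\<Sum>k\<in>F. \<bar>u k\<bar>) \<le> (\<Sum>k\<in>F. C * (1 / 2) ^ k)"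
      by (intro sum_mono C)
    also have "\<dots> = C * (\<Sum>k\<in>F. (1 / 2) ^ k)"
      by (simp add: sum_distrib_left)
    also have "\<dots> \<le> C * 2"
      using C(1) F sum_geometric_le[of "1 / 2" F] by (intro mult_left_mono) auto
    finally show "(\<Sum>k\<in>F. \<bar>u k\<bar>) \<le> C * 2" .
  qed (use C in simp)
qed

lemma fast_decay_summable:
  assumes "fast_decay u"
  shows "(\<lambda>k. \<bar>u k\<bar>) summable_on UNIV"
proof -
  obtain c where "\<And>F. finite F \<Longrightarrow> (\<Sum>k\<in>F. \<bar>u k\<bar>) \<le> c"
    using fast_decay_sum_bound[OF assms] by blast
  then show ?thesis
    by (intro nonneg_bdd_above_summable_on) (auto intro!: bdd_aboveI2)
qed

text \<open>Hiding the constant lets products be reassociated by rewriting, without tracking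
  bounds.\<close>

definition row_bounded :: "(nat \<Rightarrow> nat \<Rightarrow> real) \<Rightarrow> bool" where
  "row_bounded A \<longleftrightarrow> (\<exists>c. row_bdd c A)"

lemma row_bounded_mmul: "row_bounded A \<Longrightarrow> row_bounded B \<Longrightarrow> row_bounded (mmul A B)"
  unfolding row_bounded_def using row_bdd_mmul by blast

lemma row_bounded_assoc: "row_bounded A \<Longrightarrow> row_bounded B \<Longrightarrow> row_bounded C \<Longrightarrow> mmul (mmul A B) C = mmul A (mmul B C)"
  unfolding row_bounded_def using mmul_assoc by blast

lemma row_bounded_toep:
  assumes "fast_decay u"
  shows "row_bounded (toep_low u)" "row_bounded (toep_up u)" "row_bounded (hankel u)"
  using fast_decay_sum_bound[OF assms] row_bdd_toep_low row_bdd_toep_up row_bdd_hankel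
  unfolding row_bounded_def by metis+

text \<open>The symbol is \<open>u(z) u(1/z)\<close>: both factors come from one series, so a single
  pair of mutually inverse series carries the whole factorisation.\<close>

locale wiener_hopf =
  fixes u v :: "nat \<Rightarrow> real"
  assumes conv: "\<And>n. (\<Sum>k\<le>n. u k * v (n - k)) = (if n = 0 then 1 else 0)"
    and u_0: "u 0 = 1"
    and u_decay: "fast_decay u" and v_decay: "fast_decay v"
begin

lemma v_0: "v 0 = 1"
  using conv[of 0] u_0 by simp

lemma conv': "(\<Sum>k\<le>n. v k * u (n - k)) = (if n = 0 then 1 else 0)"
proof -
  have "(\<Sum>k\<le>n. v k * u (n - k)) = (\<Sum>k\<le>n. u k * v (n - k))"
    by (rule sum.reindex_bij_witness[of _ "\<lambda>k. n - k" "\<lambda>k. n - k"]) auto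
  then show ?thesis
    by (simp add: conv)
qed

abbreviation "Lu \<equiv> toep_low u"
abbreviation "Lv \<equiv> toep_low v"
abbreviation "Uu \<equiv> toep_up u"
abbreviation "Uv \<equiv> toep_up v"
abbreviation "Hv \<equiv> hankel v"

text \<open>Upper times lower is again Toeplitz, with symbol \<open>u(z) u(1/z)\<close>. Thus
  \<open>fdet L gram\<close> is the determinant \<open>D_L\<close>.\<close>

definition "gram = mmul Uu Lu"
definition "J = correlation u v"
definition "K = mmul (hankel J) (hankel J)"
text \<open>The four symbols multiply to 1, so \<open>B\<close> would be the identity if Toeplitz
  matrices multiplied like their symbols; the defect is \<open>K\<close>.\<close>

definition "B = mmul Uu (mmul Lv (mmul Uv Lu))"
definition "C = mmul gram Uv"

lemmas row_bounded_rules = row_bounded_toep[OF u_decay] row_bounded_toep[OF v_decay] row_bounded_mmul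

lemma LL: "mmul Lu Lv = unit_mat" "mmul Lv Lu = unit_mat"
  by (rule mmul_toep_low_inverse; rule conv conv')+

lemma UU: "mmul Uu Uv = unit_mat" "mmul Uv Uu = unit_mat"
  by (intro ext; simp add: mmul_toep_up LL unit_mat_def)+

lemma J_decay:
  assumes "0 < q" "q < 1"
  obtains c where "0 \<le> c" "\<And>n. \<bar>J n\<bar> \<le> c * q ^ n"
proof -
  obtain Cv where Cv: "0 \<le> Cv" "\<And>n. \<bar>v n\<bar> \<le> Cv * q ^ n"
    using fast_decayE[OF v_decay assms] by blast
  let ?s = "\<Sum>\<^sub>\<infinity>p. \<bar>u p\<bar>"
  have s: "0 \<le> ?s"
    by (rule infsum_nonneg) simp
  show ?thesis
  proof (rule that[of "?s * Cv"])
    fix n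
    have vle: "\<bar>v (p + n)\<bar> \<le> Cv * q ^ n" for p
    proof -
      have "\<bar>v (p + n)\<bar> \<le> Cv * (q ^ p * q ^ n)"
        using Cv(2)[of "p + n"] by (simp add: power_add)
      also have "\<dots> \<le> Cv * (1 * q ^ n)"
        using assms Cv(1) by (intro mult_left_mono mult_right_mono power_le_one) auto
      finally show ?thesis by simp
    qed
    have "\<bar>J n\<bar> \<le> (\<Sum>\<^sub>\<infinity>p. \<bar>u p * v (p + n)\<bar>)"
      unfolding J_def correlation_def
      by (intro abs_infsum_le abs_summable_mult_bounded(1)[OF fast_decay_summable[OF u_decay] vle])
    also have "\<dots> \<le> (\<Sum>\<^sub>\<infinity>p. \<bar>u p\<bar> * (Cv * q ^ n))"
      using vle
      by (intro infsum_mono abs_summable_mult_bounded(1)[OF fast_decay_summable[OF u_decay] vle]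
          summable_on_cmult_left[OF fast_decay_summable[OF u_decay]])
         (auto simp: abs_mult intro: mult_left_mono)
    also have "\<dots> = ?s * Cv * q ^ n"
      by (simp add: infsum_cmult_left' mult.assoc)
    finally show "\<bar>J n\<bar> \<le> ?s * Cv * q ^ n" .
  qed (use s Cv in simp)
qed

lemma fast_decay_J: "fast_decay J"
  unfolding fast_decay_def using J_decay by metis

lemma row_bounded_J: "row_bounded (hankel J)"
  by (rule row_bounded_toep[OF fast_decay_J])

lemma row_bounded_K: "row_bounded K"
  unfolding K_def by (intro row_bounded_mmul row_bounded_J)

text \<open>Widom's identity exchanges the two middle factors. The exchanged product cancels in
  pairs to the identity, and in the Hankel term the outer factors \<open>Uu\<close> and
  \<open>Lu\<close> turn both copies of \<open>Hv\<close> into \<open>hankel J\<close>.\<close>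

lemma B_eq: "B = (\<lambda>i j. unit_mat i j - K i j)"
proof (intro ext)
  fix i j
  obtain cv where cv: "\<And>F. finite F \<Longrightarrow> (\<Sum>k\<in>F. \<bar>v k\<bar>) \<le> cv"
    using fast_decay_sum_bound[OF v_decay] by blast
  have 1: "mmul Lv Uv = (\<lambda>i j. mmul Uv Lv i j - mmul Hv Hv i j)"
    using mmul_toep_low_up[OF cv] by (intro ext)
  obtain a b c d where rows: "row_bdd a Lu" "row_bdd b (mmul Uv Lv)" "row_bdd c (mmul Hv Hv)" "row_bdd d Uu"
    using row_bounded_rules unfolding row_bounded_def by metis
  have 2: "mmul (mmul Lv Uv) Lu = (\<lambda>i j. mmul (mmul Uv Lv) Lu i j - mmul (mmul Hv Hv) Lu i j)"
    unfolding 1 using mmul_diff_left[OF rows(1,2,3)] by (intro ext)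
  have "B i j = mmul Uu (mmul (mmul Lv Uv) Lu) i j"
    unfolding B_def by (simp add: row_bounded_assoc row_bounded_rules)
  also have "\<dots> = mmul Uu (mmul (mmul Uv Lv) Lu) i j - mmul Uu (mmul (mmul Hv Hv) Lu) i j"
    unfolding 2 by (rule mmul_diff_right[OF rows(4) row_bdd_mmul[OF rows(2,1)] row_bdd_mmul[OF rows(3,1)]])
  also have "mmul Uu (mmul (mmul Uv Lv) Lu) = mmul (mmul Uu Uv) (mmul Lv Lu)"
    by (simp add: row_bounded_assoc row_bounded_rules)
  also have "\<dots> = unit_mat"
    by (simp add: UU LL mmul_unit_left)
  also have "mmul Uu (mmul (mmul Hv Hv) Lu) = mmul (mmul Uu Hv) (mmul Hv Lu)"
    by (simp add: row_bounded_assoc row_bounded_rules)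
  also have "\<dots> = K"
    by (simp add: K_def J_def mmul_toep_up_hankel mmul_hankel_toep_low)
  finally show "B i j = unit_mat i j - K i j" .
qed

text \<open>Inverse neighbours of the same triangular type cancel: \<open>Uv Uu\<close> first, then
  \<open>Lu Lv\<close>, then \<open>Uu Uv\<close>.\<close>

lemma C_B: "mmul C B = Lu"
proof -
  have "mmul C B = mmul Uu (mmul Lu (mmul (mmul Uv Uu) (mmul Lv (mmul Uv Lu))))"
    unfolding C_def B_def gram_def by (simp add: row_bounded_assoc row_bounded_rules)
  also have "\<dots> = mmul Uu (mmul (mmul Lu Lv) (mmul Uv Lu))"
    by (simp add: UU mmul_unit_left row_bounded_assoc row_bounded_rules)
  also have "\<dots> = mmul (mmul Uu Uv) Lu"
    by (simp add: LL mmul_unit_left row_bounded_assoc row_bounded_rules)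
  finally show ?thesis
    by (simp add: UU mmul_unit_left)
qed

lemma K_row_decay:
  assumes "0 < q" "q \<le> 1 / 2"
  obtains c where "0 \<le> c" "\<And>k F. finite F \<Longrightarrow> (\<Sum>j\<in>F. \<bar>K k j\<bar>) \<le> c * q ^ k"
proof -
  obtain c where c: "0 \<le> c" "\<And>n. \<bar>J n\<bar> \<le> c * q ^ n"
    using J_decay[of q] assms by auto
  obtain a where a: "row_bdd a (hankel J)"
    using row_bounded_J unfolding row_bounded_def by blast
  show ?thesis
  proof (rule that[of "2 * c * a"])
    show "0 \<le> 2 * c * a"
      using c row_bdd_nonneg[OF a] by simp
    fix k and F :: "nat set" assume F: "finite F"
    have "(\<Sum>\<^sub>\<infinity>p. \<bar>hankel J k p\<bar>) \<le> 2 * c * q ^ k"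
    proof (rule infsum_le_finite_sums[OF row_bdd_abs_summable[OF a]])
      fix G :: "nat set" assume G: "finite G"
      have "(\<Sum>p\<in>G. \<bar>hankel J k p\<bar>) \<le> (\<Sum>p\<in>G. c * q ^ k * q ^ p)"
      proof (rule sum_mono)
        fix p
        have "\<bar>hankel J k p\<bar> \<le> c * q ^ (k + p + 1)"
          unfolding hankel_def by (rule c)
        also have "\<dots> \<le> c * q ^ (k + p)"
          using c assms by (intro mult_left_mono power_decreasing) auto
        finally show "\<bar>hankel J k p\<bar> \<le> c * q ^ k * q ^ p"
          by (simp add: power_add mult.assoc)
      qed
      also have "\<dots> = c * q ^ k * (\<Sum>p\<in>G. q ^ p)"
        by (simp add: sum_distrib_left)
      also have "\<dots> \<le> c * q ^ k * 2"
        using c assms G by (intro mult_left_mono sum_geometric_le) auto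
      finally show "(\<Sum>p\<in>G. \<bar>hankel J k p\<bar>) \<le> 2 * c * q ^ k"
        by simp
    qed
    then have "(\<Sum>\<^sub>\<infinity>p. \<bar>hankel J k p\<bar>) * a \<le> (2 * c * q ^ k) * a"
      by (intro mult_right_mono row_bdd_nonneg[OF a])
    then show "(\<Sum>j\<in>F. \<bar>K k j\<bar>) \<le> 2 * c * a * q ^ k"
      using sum_abs_mmul_le[OF a a F, of k] by (simp add: K_def mult_ac)
  qed
qed

text \<open>
  The Gram matrix is \<open>Uu Lu\<close>, and the identity \<open>C B = Lu\<close> says that it maps the columns of \<open>Uv B\<close> to
  those of \<open>Lu\<close>. Replacing the columns \<open>j \<ge> L\<close> of the identity matrix by truncated columns of \<open>Uv B\<close>
  makes both determinants visible in block form; \<open>E\<close> is the truncation error.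
\<close>
lemma fdet_gram_mult_eq:
  assumes "L \<le> N"
  defines "W \<equiv> \<lambda>i j. if j < L then gram i j else Lu i j"
  defines "E \<equiv> \<lambda>i j. if j < L then 0 else (\<Sum>\<^sub>\<infinity>k\<in>{N..}. C i k * K k j)"
  shows "fdet N gram * fdet (N - L) (\<lambda>i j. (if i = j then 1 else 0) - K (i + L) (j + L)) = fdet N (\<lambda>i j. W i j + E i j)"
    and "fdet N W = fdet L gram"
proof -
  obtain m where N: "N = L + m"
    using assms(1) le_Suc_ex by blast
  define Y where "Y i j = (if j < L then unit_mat i j else (\<Sum>k<N. Uv i k * B k j))" for i j
  have "fdet N Y = fdet L Y * fdet m (\<lambda>i j. Y (i + L) (j + L))"
    unfolding N by (rule fdet_block_upper) (simp add: Y_def unit_mat_def)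
  also have "fdet L Y = 1"
    by (rule fdet_lower_unitriangular) (auto simp: Y_def unit_mat_def)
  also have "fdet m (\<lambda>i j. Y (i + L) (j + L)) = fdet m (\<lambda>i j. \<Sum>k<m. Uv (i + L) (k + L) * B (k + L) (j + L))"
  proof (rule fdet_cong)
    fix i j assume "i < m" "j < m"
    have "(\<Sum>k<N. Uv (i + L) k * B k (j + L)) = (\<Sum>k\<in>{L..<N}. Uv (i + L) k * B k (j + L))"
      by (rule sum.mono_neutral_right) (auto simp: toep_up_def)
    also have "\<dots> = (\<Sum>k<m. Uv (i + L) (k + L) * B (k + L) (j + L))"
      by (rule sum.reindex_bij_witness[of _ "\<lambda>k. k + L" "\<lambda>k. k - L"]) (auto simp: N)
    finally show "Y (i + L) (j + L) = (\<Sum>k<m. Uv (i + L) (k + L) * B (k + L) (j + L))"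
      by (simp add: Y_def)
  qed
  also have "\<dots> = fdet m (\<lambda>i j. Uv (i + L) (j + L)) * fdet m (\<lambda>i j. B (i + L) (j + L))"
    by (rule fdet_mult)
  also have "fdet m (\<lambda>i j. Uv (i + L) (j + L)) = 1"
    by (rule fdet_upper_unitriangular) (auto simp: toep_up_def v_0)
  also have "(\<lambda>i j. B (i + L) (j + L)) = (\<lambda>i j. (if i = j then 1 else 0) - K (i + L) (j + L))"
    by (simp add: B_eq unit_mat_def)
  finally have Y: "fdet N Y = fdet (N - L) (\<lambda>i j. (if i = j then 1 else 0) - K (i + L) (j + L))"
    by (simp add: N)
  obtain a b where ab: "row_bdd a C" "row_bdd b B"
    using row_bounded_rules unfolding C_def B_def gram_def row_bounded_def by metis
  have "fdet N gram * fdet N Y = fdet N (\<lambda>i j. \<Sum>l<N. gram i l * Y l j)"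
    by (rule fdet_mult[symmetric])
  also have "\<dots> = fdet N (\<lambda>i j. W i j + E i j)"
  proof (rule fdet_cong)
    fix i j assume ij: "i < N" "j < N"
    show "(\<Sum>l<N. gram i l * Y l j) = W i j + E i j"
    proof (cases "j < L")
      case True
      then have "(\<Sum>l<N. gram i l * Y l j) = (\<Sum>l<N. if l = j then gram i l else 0)"
        by (intro sum.cong) (auto simp: Y_def unit_mat_def)
      then show ?thesis
        using ij True by (simp add: W_def E_def)
    next
      case False
      have Ck: "(\<Sum>l<N. gram i l * Uv l k) = C i k" if "k < N" for k
      proof -
        have "C i k = (\<Sum>\<^sub>\<infinity>l\<in>{..<N}. gram i l * Uv l k)"
          unfolding C_def mmul_def using that by (intro infsum_cong_neutral) (auto simp: toep_up_def)
        then show ?thesis by simp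
      qed
      have "(\<Sum>l<N. gram i l * Y l j) = (\<Sum>l<N. \<Sum>k<N. gram i l * Uv l k * B k j)"
        using False by (simp add: Y_def sum_distrib_left mult.assoc)
      also have "\<dots> = (\<Sum>k<N. (\<Sum>l<N. gram i l * Uv l k) * B k j)"
        by (subst sum.swap) (simp add: sum_distrib_right)
      also have "\<dots> = (\<Sum>k<N. C i k * B k j)"
        by (intro sum.cong refl) (simp add: Ck)
      finally have 1: "(\<Sum>l<N. gram i l * Y l j) = (\<Sum>k<N. C i k * B k j)" .
      have UN: "{..<N} \<union> {N..} = UNIV"
        by auto
      have "Lu i j = (\<Sum>\<^sub>\<infinity>k. C i k * B k j)"
        by (simp add: C_B[symmetric] mmul_def)
      also have "\<dots> = (\<Sum>\<^sub>\<infinity>k\<in>{..<N}. C i k * B k j) + (\<Sum>\<^sub>\<infinity>k\<in>{N..}. C i k * B k j)"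
        unfolding UN[symmetric]
        by (rule infsum_Un_disjoint) (use row_bdd_mult_summable(2)[OF ab] in auto)
      \<comment> \<open>Here \<open>j < N \<le> k\<close>, so the unit part of \<open>B\<close>
        drops out and only \<open>- K\<close> remains.\<close>
      also have "(\<Sum>\<^sub>\<infinity>k\<in>{N..}. C i k * B k j) = (\<Sum>\<^sub>\<infinity>k\<in>{N..}. - (C i k * K k j))"
        using ij by (intro infsum_cong) (auto simp: B_eq unit_mat_def)
      finally show ?thesis
        using 1 False by (simp add: W_def E_def infsum_uminus)
    qed
  qed
  finally show "fdet N gram * fdet (N - L) (\<lambda>i j. (if i = j then 1 else 0) - K (i + L) (j + L)) = fdet N (\<lambda>i j. W i j + E i j)"
    unfolding Y .
  have "fdet N W = fdet L W * fdet m (\<lambda>i j. W (i + L) (j + L))"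
    unfolding N by (rule fdet_block_lower) (simp add: W_def toep_low_def)
  also have "fdet m (\<lambda>i j. W (i + L) (j + L)) = 1"
    by (rule fdet_lower_unitriangular) (auto simp: W_def toep_low_def u_0)
  also have "fdet L W = fdet L gram"
    by (rule fdet_cong) (simp add: W_def)
  finally show "fdet N W = fdet L gram"
    by simp
qed

text \<open>The product on the left is an exact determinant of \<open>W + E\<close> with
  \<open>fdet N W = fdet L gram\<close>. Row sums of \<open>W\<close> are bounded independently of
  \<open>N\<close>, while those of \<open>E\<close> decay at any chosen geometric rate.\<close>

lemma fdet_gram_limit:
  "(\<lambda>N. fdet N gram * fdet (N - L) (\<lambda>i j. (if i = j then 1 else 0) - K (i + L) (j + L))) \<longlonglongrightarrow> fdet L gram"
proof -
  obtain a b c where abc: "row_bdd a C" "row_bdd b gram" "row_bdd c Lu"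
    using row_bounded_rules unfolding C_def gram_def row_bounded_def by metis
  define w where "w = b + c"
  have nonneg: "0 \<le> a" "0 \<le> b" "0 \<le> c"
    using abc row_bdd_nonneg by blast+
  \<comment> \<open>The rate is tuned to \<open>(w + 1) * q = 1 / 2\<close>, which leaves an error
    of order \<open>N * (1 / 2) ^ N\<close>.\<close>
  define q where "q = 1 / (2 * (w + 1))"
  have q: "0 < q" "q \<le> 1 / 2" "(w + 1) * q = 1 / 2"
    using nonneg by (auto simp: q_def w_def field_simps)
  obtain d where d: "0 \<le> d" "\<And>k F. finite F \<Longrightarrow> (\<Sum>j\<in>F. \<bar>K k j\<bar>) \<le> d * q ^ k"
    using K_row_decay[OF q(1,2)] by blast
  let ?x = "\<lambda>N. fdet N gram * fdet (N - L) (\<lambda>i j. (if i = j then 1 else 0) - K (i + L) (j + L))"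
  let ?e = "\<lambda>N. a * d * q ^ N"
  have e_lim: "?e \<longlonglongrightarrow> 0"
    using q by (intro tendsto_mult_right_zero LIMSEQ_realpow_zero) auto
  have bound: "\<bar>?x N - fdet L gram\<bar> \<le> real N * ?e N * (w + 1) ^ N" if N: "L \<le> N" "?e N \<le> 1" for N
  proof -
    define W where "W i j = (if j < L then gram i j else Lu i j)" for i j
    define E where "E i j = (if j < L then 0 else (\<Sum>\<^sub>\<infinity>k\<in>{N..}. C i k * K k j))" for i j
    have "\<bar>fdet N (\<lambda>i j. W i j + E i j) - fdet N W\<bar> \<le> real N * ?e N * (w + 1) ^ N"
    proof (rule abs_fdet_diff_le)
      fix i
      have "(\<Sum>j<N. \<bar>W i j\<bar>) \<le> (\<Sum>j<N. \<bar>gram i j\<bar> + \<bar>Lu i j\<bar>)"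
        by (intro sum_mono) (auto simp: W_def)
      also have "\<dots> \<le> w"
        unfolding sum.distrib w_def by (intro add_mono row_bddD abc) auto
      finally show "(\<Sum>j<N. \<bar>W i j\<bar>) \<le> w" .
      obtain k' where k': "row_bdd k' K"
        using row_bounded_K unfolding row_bounded_def by blast
      have sm: "(\<lambda>k. \<bar>C i k * K k j\<bar>) summable_on {N..}" for j
        by (rule row_bdd_mult_summable[OF abc(1) k'])
      have "(\<Sum>j<N. \<bar>E i j\<bar>) \<le> (\<Sum>j<N. \<Sum>\<^sub>\<infinity>k\<in>{N..}. \<bar>C i k * K k j\<bar>)"
      proof (rule sum_mono)
        fix j show "\<bar>E i j\<bar> \<le> (\<Sum>\<^sub>\<infinity>k\<in>{N..}. \<bar>C i k * K k j\<bar>)"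
          unfolding E_def using abs_infsum_le[OF sm] infsum_nonneg[of "{N..}" "\<lambda>k. \<bar>C i k * K k j\<bar>"] by simp
      qed
      also have "\<dots> = (\<Sum>\<^sub>\<infinity>k\<in>{N..}. \<Sum>j<N. \<bar>C i k * K k j\<bar>)"
        using infsum_sum_swap[of "{..<N}" "\<lambda>j k. \<bar>C i k * K k j\<bar>" "{N..}"] sm by simp
      also have "\<dots> \<le> (\<Sum>\<^sub>\<infinity>k\<in>{N..}. \<bar>C i k\<bar> * (d * q ^ N))"
      proof (rule infsum_mono)
        show "(\<lambda>k. \<Sum>j<N. \<bar>C i k * K k j\<bar>) summable_on {N..}"
          using infsum_sum_swap[of "{..<N}" "\<lambda>j k. \<bar>C i k * K k j\<bar>" "{N..}"] sm by simp
        show "(\<lambda>k. \<bar>C i k\<bar> * (d * q ^ N)) summable_on {N..}"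
          by (intro summable_on_cmult_left summable_on_subset_banach[OF row_bdd_abs_summable[OF abc(1)]]) auto
        fix k assume k: "k \<in> {N..}"
        have "(\<Sum>j<N. \<bar>K k j\<bar>) \<le> d * q ^ k"
          by (rule d) simp
        also have "\<dots> \<le> d * q ^ N"
          using d q k by (intro mult_left_mono power_decreasing) auto
        finally show "(\<Sum>j<N. \<bar>C i k * K k j\<bar>) \<le> \<bar>C i k\<bar> * (d * q ^ N)"
          by (simp add: abs_mult sum_distrib_left[symmetric] mult_left_mono)
      qed
      also have "\<dots> = (\<Sum>\<^sub>\<infinity>k\<in>{N..}. \<bar>C i k\<bar>) * (d * q ^ N)"
        by (rule infsum_cmult_left')
      also have "(\<Sum>\<^sub>\<infinity>k\<in>{N..}. \<bar>C i k\<bar>) \<le> a"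
        using row_bddD[OF abc(1)]
        by (intro infsum_le_finite_sums summable_on_subset_banach[OF row_bdd_abs_summable[OF abc(1)]]) auto
      finally show "(\<Sum>j<N. \<bar>E i j\<bar>) \<le> ?e N"
        using d q by (simp add: mult_right_mono mult.assoc)
    qed (use nonneg d q N in \<open>auto simp: w_def\<close>)
    then show ?thesis
      using fdet_gram_mult_eq[OF N(1)] by (simp add: W_def[abs_def] E_def[abs_def])
  qed
  have eq: "real N * ?e N * (w + 1) ^ N = a * d * (real N * (1 / 2) ^ N)" for N
  proof -
    have "(1 / 2) ^ N = (w + 1) ^ N * q ^ N"
      unfolding q(3)[symmetric] by (rule power_mult_distrib)
    then show ?thesis
      by (simp only: mult_ac)
  qed
  have lim: "(\<lambda>N. a * d * (real N * (1 / 2) ^ N)) \<longlonglongrightarrow> 0"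
    by (intro tendsto_mult_right_zero powser_times_n_limit_0) simp
  have e_ev: "\<forall>\<^sub>F N in sequentially. ?e N < 1"
    using e_lim by (rule order_tendstoD) simp
  have ev: "\<forall>\<^sub>F N in sequentially. norm (?x N - fdet L gram) \<le> a * d * (real N * (1 / 2) ^ N)"
    using eventually_ge_at_top[of L] e_ev
  proof (eventually_elim)
    case (elim N)
    then show ?case
      using bound[of N] eq[of N] by simp
  qed
  have "(\<lambda>N. ?x N - fdet L gram) \<longlonglongrightarrow> 0"
    by (rule Lim_null_comparison[OF ev lim])
  then show ?thesis
    by (simp add: LIM_zero_iff)
qed

end

section \<open>Coefficients of the exponential generating series\<close>

definition times_fps :: "(nat \<Rightarrow> real) \<Rightarrow> real fps" where
  "times_fps t = Abs_fps (\<lambda>r. if r = 0 then 0 else t r)"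

text \<open>The scale \<open>s\<close> is a real parameter because it is also the deformation
  variable of the Szego argument; \<open>s = -1\<close> and \<open>s = 1\<close> give
  \<open>u\<close> and \<open>v\<close>.\<close>

definition exp_coeff :: "(nat \<Rightarrow> real) \<Rightarrow> real \<Rightarrow> nat \<Rightarrow> real" where
  "exp_coeff t s n = fps_nth (fps_compose (fps_exp s) (times_fps t)) n"

lemma times_fps_nth_0 [simp]: "fps_nth (times_fps t) 0 = 0"
  by (simp add: times_fps_def)

lemma exp_coeff_eq_sum:
  "exp_coeff t s n = (\<Sum>i\<le>n. s ^ i / fact i * fps_nth (times_fps t ^ i) n)"
  by (simp add: exp_coeff_def fps_compose_nth atMost_atLeast0)

lemma exp_coeff_add:
  "(\<Sum>k\<le>n. exp_coeff t s k * exp_coeff t s' (n - k)) = exp_coeff t (s + s') n"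
proof -
  have "fps_compose (fps_exp (s + s')) (times_fps t)
      = fps_compose (fps_exp s) (times_fps t) * fps_compose (fps_exp s') (times_fps t)"
    by (simp add: fps_exp_add_mult fps_compose_mult_distrib)
  then show ?thesis
    by (simp add: exp_coeff_def fps_mult_nth atMost_atLeast0)
qed

lemma exp_coeff_zero: "exp_coeff t 0 n = (if n = 0 then 1 else 0)"
  by (simp add: exp_coeff_def)

lemma exp_coeff_nth_0 [simp]: "exp_coeff t s 0 = 1"
  by (simp add: exp_coeff_eq_sum)

section \<open>Growth and derivatives for finitely supported times\<close>

locale finite_times =
  fixes t :: "nat \<Rightarrow> real"
  assumes finite_supp: "finite (supp t)"
begin

abbreviation "a \<equiv> times_fps t"

lemma a_nth: "fps_nth a r = (if r \<in> supp t then t r else 0)"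
  by (auto simp: times_fps_def supp_def)

lemma supp_pos: "r \<in> supp t \<Longrightarrow> 1 \<le> r"
  by (simp add: supp_def)

definition "A x = (\<Sum>r\<in>supp t. \<bar>t r\<bar> * x ^ r)"

lemma A_nonneg: "0 \<le> x \<Longrightarrow> 0 \<le> A x"
  unfolding A_def by (intro sum_nonneg) auto

lemma a_mult_nth: "fps_nth (a * f) n = (\<Sum>r | r \<in> supp t \<and> r \<le> n. t r * fps_nth f (n - r))"
proof -
  have "fps_nth (a * f) n = (\<Sum>r\<in>{0..n}. fps_nth a r * fps_nth f (n - r))"
    by (simp add: fps_mult_nth)
  also have "\<dots> = (\<Sum>r | r \<in> supp t \<and> r \<le> n. t r * fps_nth f (n - r))"
    by (rule sum.mono_neutral_cong_right) (auto simp: a_nth)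
  finally show ?thesis .
qed

text \<open>Cauchy's estimate by majorants: the coefficients are dominated by those of the
  \<open>i\<close>-th power of the series with coefficients \<open>\<bar>t r\<bar>\<close>, whose
  value at \<open>x\<close> is \<open>A x ^ i\<close>.\<close>

lemma a_power_bound:
  assumes "0 \<le> x"
  shows "\<bar>fps_nth (a ^ i) n\<bar> * x ^ n \<le> A x ^ i"
proof (induction i arbitrary: n)
  case 0
  then show ?case by simp
next
  case (Suc i)
  have fin: "finite {r. r \<in> supp t \<and> r \<le> n}"
    by simp
  have "\<bar>fps_nth (a ^ Suc i) n\<bar> * x ^ n
      \<le> (\<Sum>r | r \<in> supp t \<and> r \<le> n. \<bar>t r * fps_nth (a ^ i) (n - r)\<bar>) * x ^ n"
    unfolding power_Suc a_mult_nth using assms by (intro mult_right_mono sum_abs) auto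
  also have "\<dots> = (\<Sum>r | r \<in> supp t \<and> r \<le> n. \<bar>t r\<bar> * x ^ r * (\<bar>fps_nth (a ^ i) (n - r)\<bar> * x ^ (n - r)))"
    unfolding sum_distrib_right
  proof (rule sum.cong[OF refl])
    fix r assume "r \<in> {r \<in> supp t. r \<le> n}"
    then have "x ^ n = x ^ r * x ^ (n - r)"
      by (simp add: power_add[symmetric])
    then show "\<bar>t r * fps_nth (a ^ i) (n - r)\<bar> * x ^ n = \<bar>t r\<bar> * x ^ r * (\<bar>fps_nth (a ^ i) (n - r)\<bar> * x ^ (n - r))"
      by (simp add: abs_mult)
  qed
  also have "\<dots> \<le> (\<Sum>r | r \<in> supp t \<and> r \<le> n. \<bar>t r\<bar> * x ^ r * A x ^ i)"
    using assms by (intro sum_mono mult_left_mono Suc.IH) auto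
  also have "\<dots> \<le> A x * A x ^ i"
    unfolding sum_distrib_right[symmetric] A_def
    using assms finite_supp by (intro mult_right_mono sum_mono2 zero_le_power sum_nonneg) auto
  finally show ?case by simp
qed

lemma exp_coeff_bound:
  assumes "0 < x"
  shows "\<bar>exp_coeff t s n\<bar> \<le> exp (\<bar>s\<bar> * A x) * (1 / x) ^ n"
proof -
  have "\<bar>exp_coeff t s n\<bar> * x ^ n \<le> (\<Sum>i\<le>n. \<bar>s ^ i / fact i * fps_nth (a ^ i) n\<bar>) * x ^ n"
    unfolding exp_coeff_eq_sum using assms by (intro mult_right_mono sum_abs) auto
  also have "\<dots> = (\<Sum>i\<le>n. \<bar>s\<bar> ^ i / fact i * (\<bar>fps_nth (a ^ i) n\<bar> * x ^ n))"
    unfolding sum_distrib_right by (intro sum.cong refl) (simp add: abs_mult power_abs)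
  also have "\<dots> \<le> (\<Sum>i\<le>n. \<bar>s\<bar> ^ i / fact i * A x ^ i)"
    using assms by (intro sum_mono mult_left_mono a_power_bound) auto
  also have "\<dots> = (\<Sum>i\<le>n. inverse (fact i) *\<^sub>R (\<bar>s\<bar> * A x) ^ i)"
    by (intro sum.cong) (simp_all add: power_mult_distrib field_simps)
  also have "\<dots> \<le> exp (\<bar>s\<bar> * A x)"
    unfolding exp_def using A_nonneg[of x] assms
    by (intro sum_le_suminf summable_exp_generic) auto
  finally show ?thesis
    using assms by (simp add: field_simps power_divide)
qed

lemma fast_decay_exp_coeff: "fast_decay (exp_coeff t s)"
  unfolding fast_decay_def
proof (intro allI impI)
  fix q :: real assume "0 < q" "q < 1"
  then show "\<exists>C\<ge>0. \<forall>n. \<bar>exp_coeff t s n\<bar> \<le> C * q ^ n"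
    using exp_coeff_bound[of "1 / q" s] by (intro exI[of _ "exp (\<bar>s\<bar> * A (1 / q))"]) auto
qed

sublocale wiener_hopf "exp_coeff t (-1)" "exp_coeff t 1"
  by unfold_locales (simp_all add: exp_coeff_add exp_coeff_zero fast_decay_exp_coeff)

text \<open>The derivative of \<open>exp (s a)\<close> in \<open>s\<close> is
  \<open>a exp (s a)\<close>. Since \<open>a\<close> has no constant term, a coefficient is a
  polynomial in \<open>s\<close> and no interchange of limits occurs.\<close>

lemma exp_coeff_has_derivative:
  "((\<lambda>s. exp_coeff t s n) has_field_derivative
     (\<Sum>r | r \<in> supp t \<and> r \<le> n. t r * exp_coeff t s (n - r))) (at s)"
proof -
  have zero: "fps_nth (a ^ i) k = 0" if "k < i" for i k
    using that by (simp add: startsby_zero_power_prefix)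
  have d: "((\<lambda>s. s ^ i / fact i) has_field_derivative (if i = 0 then 0 else s ^ (i - 1) / fact (i - 1))) (at s)" for i
  proof (cases i)
    case (Suc k)
    have "((\<lambda>s. s ^ Suc k / fact (Suc k)) has_field_derivative real (Suc k) * s ^ k / fact (Suc k)) (at s)"
      using DERIV_cdivide[OF DERIV_pow[of "Suc k" s UNIV], of "fact (Suc k)"] by simp
    moreover have "real (Suc k) * s ^ k / fact (Suc k) = s ^ k / fact k"
      by (simp del: of_nat_Suc)
    ultimately show ?thesis
      using Suc by simp
  qed simp
  have "((\<lambda>s. exp_coeff t s n) has_field_derivative
     (\<Sum>i\<le>n. (if i = 0 then 0 else s ^ (i - 1) / fact (i - 1)) * fps_nth (a ^ i) n)) (at s)"
    unfolding exp_coeff_eq_sum by (intro DERIV_sum DERIV_cmult_right d)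
  moreover have "(\<Sum>i\<le>n. (if i = 0 then 0 else s ^ (i - 1) / fact (i - 1)) * fps_nth (a ^ i) n)
      = (\<Sum>i<n. s ^ i / fact i * fps_nth (a ^ Suc i) n)"
  proof (cases n)
    case (Suc n')
    show ?thesis
      unfolding Suc atMost_Suc_eq_insert_0 lessThan_Suc_atMost
      by (subst sum.insert) (auto simp: sum.reindex)
  qed simp
  moreover have "(\<Sum>i<n. s ^ i / fact i * fps_nth (a ^ Suc i) n)
      = (\<Sum>r | r \<in> supp t \<and> r \<le> n. t r * (\<Sum>i<n. s ^ i / fact i * fps_nth (a ^ i) (n - r)))"
    unfolding power_Suc a_mult_nth sum_distrib_left by (subst sum.swap) (simp add: mult_ac)
  moreover have coeff: "(\<Sum>i<n. s ^ i / fact i * fps_nth (a ^ i) (n - r)) = exp_coeff t s (n - r)"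
    if "r \<in> supp t \<and> r \<le> n" for r
    unfolding exp_coeff_eq_sum
    by (rule sum.mono_neutral_right) (use that supp_pos[of r] in \<open>auto simp: zero\<close>)
  moreover have "(\<Sum>r | r \<in> supp t \<and> r \<le> n. t r * (\<Sum>i<n. s ^ i / fact i * fps_nth (a ^ i) (n - r)))
      = (\<Sum>r | r \<in> supp t \<and> r \<le> n. t r * exp_coeff t s (n - r))"
    by (intro sum.cong refl arg_cong2[of _ _ _ _ "(*)"] coeff) auto
  ultimately show ?thesis
    by (simp only:)
qed

text \<open>The logarithmic derivative: \<open>z u' v = - z a'\<close>, because
  \<open>u = exp (- a)\<close> and \<open>u v = 1\<close>. It evaluates the trace in
  \<open>corner_trace\<close>.\<close>

lemma sum_weighted_conv:
  "(\<Sum>d\<le>r. exp_coeff t 1 d * (real (r - d) * exp_coeff t (-1) (r - d))) = - (real r * (if r \<in> supp t then t r else 0))"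
proof -
  let ?v = "fps_compose (fps_exp 1) a" and ?u = "fps_compose (fps_exp (- 1)) a"
  have "fps_deriv ?u = - (fps_deriv a * ?u)"
    by (simp add: fps_compose_deriv fps_compose_uminus mult.commute fps_const_neg[symmetric] del: fps_const_neg)
  moreover have "?v * ?u = 1"
    by (simp add: fps_compose_mult_distrib[symmetric] fps_exp_add_mult[symmetric])
  ultimately have "?v * (fps_X * fps_deriv ?u) = - (fps_X * fps_deriv a)"
    by (metis (no_types, opaque_lifting) mult.commute mult.left_commute mult.right_neutral mult_minus_right)
  then have "fps_nth (?v * (fps_X * fps_deriv ?u)) r = - fps_nth (fps_X * fps_deriv a) r"
    by simp
  moreover have X: "fps_nth (fps_X * fps_deriv f) k = real k * fps_nth f k" for f :: "real fps" and k
    by (cases k) simp_all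
  moreover have "fps_nth (?v * (fps_X * fps_deriv ?u)) r
      = (\<Sum>d = 0..r. fps_nth ?v d * fps_nth (fps_X * fps_deriv ?u) (r - d))"
    by (rule fps_mult_nth)
  ultimately show ?thesis
    unfolding X a_nth exp_coeff_def atMost_atLeast0 by (simp only:)
qed

end

section \<open>The strong Szego limit\<close>

lemma infsum_mult_row_bdd_eq_suminf:
  assumes "row_bdd a A" "row_bdd b B"
  shows "(\<lambda>k. A i k * B k j) sums (mmul A B i j)"
  unfolding mmul_def
  by (rule has_sum_imp_sums[OF has_sum_infsum[OF row_bdd_mult_summable(2)[OF assms]]])

context finite_times
begin

abbreviation "u \<equiv> exp_coeff t (-1)"
abbreviation "v \<equiv> exp_coeff t 1"

text \<open>
  Differentiating \<open>deformed_gram s\<close> in \<open>s\<close> moves row \<open>j\<close> to row \<open>j - r\<close>. A row of nonnegative index is already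
  present, so it contributes nothing to the determinant. Row \<open>- k - 1\<close> is row \<open>k\<close> of \<open>edge s\<close>, and
  \<open>corner\<close> expands it in the rows of \<open>deformed_gram s\<close>.
\<close>
definition deformed_gram :: "real \<Rightarrow> nat \<Rightarrow> nat \<Rightarrow> real" where
  "deformed_gram s = mmul (toep_up u) (toep_low (exp_coeff t (-s)))"

definition edge :: "real \<Rightarrow> nat \<Rightarrow> nat \<Rightarrow> real" where
  "edge s = mmul (hankel u) (toep_low (exp_coeff t (-s)))"

definition corner :: "nat \<Rightarrow> nat \<Rightarrow> real" where
  "corner = mmul (hankel u) (toep_up v)"

definition \<kappa> :: real where
  "\<kappa> = (\<Sum>r\<in>supp t. real r * (t r)\<^sup>2)"

lemma deformed_gram_1: "deformed_gram 1 = gram"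
  by (simp add: deformed_gram_def gram_def)

lemma deformed_gram_0: "fdet n (deformed_gram 0) = 1"
proof -
  have "toep_low (exp_coeff t 0) = unit_mat"
    by (auto simp: toep_low_def unit_mat_def exp_coeff_zero fun_eq_iff)
  then have "deformed_gram 0 = toep_up u"
    by (simp add: deformed_gram_def mmul_unit_right)
  then show ?thesis
    by (simp add: fdet_upper_unitriangular toep_up_def)
qed

text \<open>\<open>Uv Uu = 1\<close> is inserted between the two factors. The coefficients in
  \<open>corner\<close> do not depend on \<open>s\<close>, and therefore the logarithmic derivative
  tends to a constant.\<close>

lemma edge_eq: "edge s = mmul corner (deformed_gram s)"
proof -
  have "mmul corner (deformed_gram s) = mmul (hankel u) (mmul (mmul Uv Uu) (toep_low (exp_coeff t (-s))))"
    unfolding corner_def deformed_gram_def by (simp add: row_bounded_assoc row_bounded_rules row_bounded_toep fast_decay_exp_coeff)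
  then show ?thesis
    by (simp add: UU mmul_unit_left edge_def)
qed

text \<open>The range up to 2 leaves an open neighbourhood of the deformation interval for
  differentiation. Evaluating the majorant at 2 gives the rate \<open>1 / 2\<close>, whose geometric
  sum is at most 2.\<close>

lemma uniform_bound:
  obtains c where "1 \<le> c" "\<And>s. \<bar>s\<bar> \<le> 2 \<Longrightarrow> row_bdd c (toep_low (exp_coeff t s))"
    "\<And>s. \<bar>s\<bar> \<le> 2 \<Longrightarrow> row_bdd c (toep_up (exp_coeff t s))"
proof -
  define c where "c = exp (2 * A 2) * 2"
  have A2: "0 \<le> A 2"
    by (rule A_nonneg) simp
  have b: "(\<Sum>k\<in>F. \<bar>exp_coeff t s k\<bar>) \<le> c" if "\<bar>s\<bar> \<le> 2" "finite F" for s F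
  proof -
    have "(\<Sum>k\<in>F. \<bar>exp_coeff t s k\<bar>) \<le> (\<Sum>k\<in>F. exp (2 * A 2) * (1 / 2) ^ k)"
    proof (rule sum_mono)
      fix k
      have "\<bar>exp_coeff t s k\<bar> \<le> exp (\<bar>s\<bar> * A 2) * (1 / 2) ^ k"
        using exp_coeff_bound[of 2 s k] by simp
      also have "\<dots> \<le> exp (2 * A 2) * (1 / 2) ^ k"
        using that A2 by (intro mult_right_mono) (auto intro: mult_right_mono)
      finally show "\<bar>exp_coeff t s k\<bar> \<le> exp (2 * A 2) * (1 / 2) ^ k" .
    qed
    also have "\<dots> \<le> c"
      unfolding sum_distrib_left[symmetric] c_def
      using that sum_geometric_le[of "1 / 2" F] by (intro mult_left_mono) auto
    finally show ?thesis .
  qed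
  show ?thesis
  proof (rule that[of c])
    have "1 \<le> exp (2 * A 2)"
      using A2 by simp
    then show "1 \<le> c"
      unfolding c_def by linarith
  qed (use row_bdd_toep_low row_bdd_toep_up b in auto)
qed

text \<open>Toeplitz structure: moving the column by \<open>r\<close> is moving the row by
  \<open>- r\<close>. Past row 0 the Toeplitz row of \<open>u\<close> continues as a row of the
  Hankel matrix.\<close>

lemma deformed_gram_shift:
  assumes "1 \<le> r"
  shows "deformed_gram s j (i + r) = (if r \<le> j then deformed_gram s (j - r) i else edge s (r - j - 1) i)"
proof -
  let ?w = "exp_coeff t (-s)"
  have *: "deformed_gram s j (i + r) = (\<Sum>\<^sub>\<infinity>l. if j \<le> l + r \<and> i \<le> l then u (l + r - j) * ?w (l - i) else 0)"
  proof -
    have "deformed_gram s j (i + r) = (\<Sum>\<^sub>\<infinity>k\<in>{r..}. toep_up u j k * toep_low ?w k (i + r))"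
      unfolding deformed_gram_def mmul_def by (rule infsum_cong_neutral) (auto simp: toep_low_def)
    also have "\<dots> = (\<Sum>\<^sub>\<infinity>l. toep_up u j (l + r) * toep_low ?w (l + r) (i + r))"
      by (rule infsum_reindex_bij_witness[of _ "\<lambda>l. l + r" "\<lambda>k. k - r"]) auto
    also have "\<dots> = (\<Sum>\<^sub>\<infinity>l. if j \<le> l + r \<and> i \<le> l then u (l + r - j) * ?w (l - i) else 0)"
      by (rule infsum_cong) (auto simp: toep_up_def toep_low_def)
    finally show ?thesis .
  qed
  show ?thesis
  proof (cases "r \<le> j")
    case True
    have "deformed_gram s (j - r) i = (\<Sum>\<^sub>\<infinity>l. if j \<le> l + r \<and> i \<le> l then u (l + r - j) * ?w (l - i) else 0)"
      unfolding deformed_gram_def mmul_def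
    proof (rule infsum_cong)
      fix l
      have "j - r \<le> l \<longleftrightarrow> j \<le> l + r" "l - (j - r) = l + r - j"
        using True by auto
      then show "toep_up u (j - r) l * toep_low ?w l i = (if j \<le> l + r \<and> i \<le> l then u (l + r - j) * ?w (l - i) else 0)"
        by (auto simp: toep_up_def toep_low_def)
    qed
    then show ?thesis
      using True * by simp
  next
    case False
    have "edge s (r - j - 1) i = (\<Sum>\<^sub>\<infinity>l. if j \<le> l + r \<and> i \<le> l then u (l + r - j) * ?w (l - i) else 0)"
      unfolding edge_def mmul_def
    proof (rule infsum_cong)
      fix l
      have e: "r - j - 1 + l + 1 = l + r - j" "j \<le> l + r"
        using False by auto
      show "hankel u (r - j - 1) l * toep_low ?w l i = (if j \<le> l + r \<and> i \<le> l then u (l + r - j) * ?w (l - i) else 0)"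
        unfolding hankel_def toep_low_def e(1) using e(2) by simp
    qed
    then show ?thesis
      using False * by simp
  qed
qed

text \<open>Differentiating \<open>exp (- s a)\<close> multiplies by \<open>- a\<close>, a
  combination of column shifts. The M-test justifies this termwise on \<open>{-2..2}\<close>, whose
  interior contains every admissible \<open>s\<close>.\<close>

lemma deformed_gram_has_derivative:
  assumes "\<bar>s\<bar> \<le> 1"
  shows "((\<lambda>s. deformed_gram s j i) has_field_derivative (\<Sum>r\<in>supp t. - t r * deformed_gram s j (i + r))) (at s)"
proof -
  let ?W = "\<lambda>s. toep_low (exp_coeff t (-s))"
  let ?f = "\<lambda>k s. Uu j k * ?W s k i"
  let ?f' = "\<lambda>k s. Uu j k * (\<Sum>r\<in>supp t. - t r * ?W s k (i + r))"
  let ?S = "{-2..2::real}"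
  obtain c where c: "1 \<le> c" "\<And>s. \<bar>s\<bar> \<le> 2 \<Longrightarrow> row_bdd c (toep_low (exp_coeff t s))"
    "\<And>s. \<bar>s\<bar> \<le> 2 \<Longrightarrow> row_bdd c (toep_up (exp_coeff t s))"
    using uniform_bound by blast
  have Uu: "row_bdd c Uu"
    using c(3)[of "-1"] by simp
  have W: "row_bdd c (?W s)" if "s \<in> ?S" for s
    using c(2)[of "-s"] that by auto
  define T where "T = (\<Sum>r\<in>supp t. \<bar>t r\<bar>)"
  have der: "(?f k has_field_derivative ?f' k s) (at s within ?S)" for k s
  proof -
    have "((\<lambda>s. ?W s k i) has_field_derivative (\<Sum>r\<in>supp t. - t r * ?W s k (i + r))) (at s)"
    proof (cases "i \<le> k")
      case True
      have "((\<lambda>s. exp_coeff t (- s) (k - i)) has_field_derivative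
          - (\<Sum>r | r \<in> supp t \<and> r \<le> k - i. t r * exp_coeff t (-s) (k - i - r))) (at s)"
        by (rule DERIV_mirror[THEN iffD1, OF exp_coeff_has_derivative])
      moreover have "- (\<Sum>r | r \<in> supp t \<and> r \<le> k - i. t r * exp_coeff t (-s) (k - i - r))
          = (\<Sum>r\<in>supp t. - t r * ?W s k (i + r))"
        unfolding sum_negf[symmetric]
        using True finite_supp by (intro sum.mono_neutral_cong_left) (auto simp: toep_low_def)
      ultimately show ?thesis
        using True by (simp add: toep_low_def)
    qed (auto simp: toep_low_def intro!: sum.neutral)
    then show ?thesis
      by (intro DERIV_cmult) (rule has_field_derivative_at_within)
  qed
  have unif: "uniformly_convergent_on ?S (\<lambda>n s. \<Sum>k<n. ?f' k s)"
  proof (rule Weierstrass_m_test')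
    show "summable (\<lambda>k. \<bar>Uu j k\<bar> * (T * c))"
      by (intro summable_mult2 summable_on_imp_summable row_bdd_abs_summable[OF Uu])
    fix k s assume s: "s \<in> ?S"
    have "\<bar>\<Sum>r\<in>supp t. - t r * ?W s k (i + r)\<bar> \<le> (\<Sum>r\<in>supp t. \<bar>t r\<bar> * c)"
      using row_bdd_entry[OF W[OF s]]
      by (intro order_trans[OF sum_abs] sum_mono) (auto simp: abs_mult intro!: mult_left_mono)
    then show "norm (?f' k s) \<le> \<bar>Uu j k\<bar> * (T * c)"
      by (simp add: abs_mult T_def sum_distrib_right mult_left_mono)
  qed
  have "((\<lambda>s. \<Sum>k. ?f k s) has_field_derivative (\<Sum>k. ?f' k s)) (at s)"
  proof (rule has_field_derivative_series'(2)[OF _ der unif])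
    show "(0::real) \<in> ?S" by simp
    show "summable (\<lambda>k. ?f k 0)"
      using infsum_mult_row_bdd_eq_suminf[OF Uu W[of 0], of j i] by (simp add: sums_iff)
    show "s \<in> interior ?S"
      using assms by (simp add: abs_le_iff)
  qed auto
  moreover have "\<forall>\<^sub>F s in nhds s. (\<Sum>k. ?f k s) = deformed_gram s j i"
  proof -
    have "\<forall>\<^sub>F s in nhds s. s \<in> {-2<..<2}"
      using assms by (intro eventually_nhds_in_open) auto
    then show ?thesis
    proof eventually_elim
      case (elim s)
      then show ?case
        using infsum_mult_row_bdd_eq_suminf[OF Uu W[of s], of j i] by (simp add: sums_iff deformed_gram_def)
    qed
  qed
  moreover have "(\<Sum>k. ?f' k s) = (\<Sum>r\<in>supp t. - t r * deformed_gram s j (i + r))"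
  proof -
    have "(\<lambda>k. \<Sum>r\<in>supp t. - t r * (Uu j k * ?W s k (i + r))) sums (\<Sum>r\<in>supp t. - t r * deformed_gram s j (i + r))"
      unfolding deformed_gram_def
      by (intro sums_sum sums_mult infsum_mult_row_bdd_eq_suminf[OF Uu W]) (use assms in auto)
    then show ?thesis
      by (simp add: sums_iff sum_distrib_left mult_ac)
  qed
  ultimately show ?thesis
    by (simp add: DERIV_cong_ev)
qed

lemma corner_tail_small:
  assumes q: "0 < q" "q \<le> 1 / 2"
  obtains d where "0 \<le> d" "\<And>k n F. finite F \<Longrightarrow> F \<subseteq> {n..} \<Longrightarrow> (\<Sum>l\<in>F. \<bar>corner k l\<bar>) \<le> d * q ^ n"
proof -
  \<comment> \<open>The faster rate \<open>q / 2\<close> for \<open>u\<close> leaves a factor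
    \<open>(1 / 2) ^ m\<close> in the convolution with \<open>v\<close>, so that no factor growing
    with \<open>l\<close> appears.\<close>
  obtain Cu where Cu: "0 \<le> Cu" "\<And>n. \<bar>u n\<bar> \<le> Cu * (q / 2) ^ n"
    using fast_decayE[OF fast_decay_exp_coeff, of "q / 2"] q by auto
  obtain Cv where Cv: "0 \<le> Cv" "\<And>n. \<bar>v n\<bar> \<le> Cv * q ^ n"
    using fast_decayE[OF fast_decay_exp_coeff, of q] q by auto
  have entry: "\<bar>corner k l\<bar> \<le> 2 * Cu * Cv * q ^ l" for k l
  proof -
    have "corner k l = (\<Sum>\<^sub>\<infinity>m\<in>{..l}. u (k + m + 1) * v (l - m))"
      unfolding corner_def mmul_def by (rule infsum_cong_neutral) (auto simp: toep_up_def hankel_def)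
    then have "\<bar>corner k l\<bar> \<le> (\<Sum>m\<le>l. \<bar>u (k + m + 1)\<bar> * \<bar>v (l - m)\<bar>)"
      by (simp add: abs_mult[symmetric])
    also have "\<dots> \<le> (\<Sum>m\<le>l. (Cu * (q / 2) ^ m) * (Cv * q ^ (l - m)))"
    proof (intro sum_mono mult_mono Cv)
      fix m
      have "\<bar>u (k + m + 1)\<bar> \<le> Cu * (q / 2) ^ (k + m + 1)"
        by (rule Cu)
      also have "\<dots> \<le> Cu * (q / 2) ^ m"
        using Cu q by (intro mult_left_mono power_decreasing) auto
      finally show "\<bar>u (k + m + 1)\<bar> \<le> Cu * (q / 2) ^ m" .
    qed (use Cu q in auto)
    also have "\<dots> = (\<Sum>m\<le>l. Cu * Cv * q ^ l * (1 / 2) ^ m)"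
    proof (rule sum.cong[OF refl])
      fix m assume "m \<in> {..l}"
      then have "q ^ l = q ^ m * q ^ (l - m)"
        by (simp add: power_add[symmetric])
      then show "(Cu * (q / 2) ^ m) * (Cv * q ^ (l - m)) = Cu * Cv * q ^ l * (1 / 2) ^ m"
        by (simp add: power_divide field_simps)
    qed
    also have "\<dots> = Cu * Cv * q ^ l * (\<Sum>m\<le>l. (1 / 2) ^ m)"
      by (simp add: sum_distrib_left)
    also have "\<dots> \<le> Cu * Cv * q ^ l * 2"
      using Cu Cv q sum_geometric_le[of "1 / 2" "{..l}"] by (intro mult_left_mono) auto
    finally show ?thesis by simp
  qed
  show ?thesis
  proof (rule that[of "2 * Cu * Cv * 2"])
    fix k n and F :: "nat set" assume F: "finite F" "F \<subseteq> {n..}"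
    have "(\<Sum>l\<in>F. \<bar>corner k l\<bar>) \<le> (\<Sum>l\<in>F. 2 * Cu * Cv * q ^ n * q ^ (l - n))"
    proof (rule sum_mono)
      fix l assume "l \<in> F"
      then have "q ^ l = q ^ n * q ^ (l - n)"
        using F by (auto simp: power_add[symmetric])
      then show "\<bar>corner k l\<bar> \<le> 2 * Cu * Cv * q ^ n * q ^ (l - n)"
        using entry[of k l] by simp
    qed
    also have "\<dots> = 2 * Cu * Cv * q ^ n * (\<Sum>l\<in>F. q ^ (l - n))"
      by (simp add: sum_distrib_left)
    also have "(\<Sum>l\<in>F. q ^ (l - n)) = (\<Sum>l\<in>(\<lambda>l. l - n) ` F. q ^ l)"
    proof -
      have "inj_on (\<lambda>l. l - n) F"
        using F by (intro inj_onI) (metis atLeast_iff eq_diff_iff subsetD)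
      then show ?thesis
        by (simp add: sum.reindex)
    qed
    also have "2 * Cu * Cv * q ^ n * (\<Sum>l\<in>(\<lambda>l. l - n) ` F. q ^ l) \<le> 2 * Cu * Cv * q ^ n * 2"
      using F Cu Cv q by (intro mult_left_mono sum_geometric_le) auto
    finally show "(\<Sum>l\<in>F. \<bar>corner k l\<bar>) \<le> 2 * Cu * Cv * 2 * q ^ n"
      by simp
  qed (use Cu Cv in auto)
qed

lemma corner_eq_sum: "corner k l = (\<Sum>d\<le>l. u (k + 1 + (l - d)) * v d)"
proof -
  have "corner k l = (\<Sum>\<^sub>\<infinity>m\<in>{..l}. u (k + m + 1) * v (l - m))"
    unfolding corner_def mmul_def by (rule infsum_cong_neutral) (auto simp: toep_up_def hankel_def)
  also have "\<dots> = (\<Sum>m\<le>l. u (k + m + 1) * v (l - m))"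
    by simp
  also have "\<dots> = (\<Sum>d\<le>l. u (k + 1 + (l - d)) * v d)"
    by (rule sum.reindex_bij_witness[of _ "\<lambda>m. l - m" "\<lambda>m. l - m"]) (auto simp: add_ac)
  finally show ?thesis .
qed

lemma sum_triangle: "(\<Sum>j<n. \<Sum>d\<le>j. g d) = (\<Sum>d\<le>n. real (n - d) * g d)"
proof (induction n)
  case (Suc n)
  have "(\<Sum>d\<le>Suc n. real (Suc n - d) * g d) = (\<Sum>d\<le>n. real (n - d) * g d + g d)"
    by (simp add: Suc_diff_le algebra_simps)
  then show ?case
    using Suc by (simp add: sum.distrib)
qed simp

text \<open>On this antidiagonal the argument of \<open>u\<close> collapses to \<open>r - d\<close>,
  and each \<open>d\<close> occurs for \<open>r - d\<close> values of \<open>j\<close>. These are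
  the weights of \<open>sum_weighted_conv\<close>.\<close>

lemma corner_trace:
  assumes "r \<in> supp t"
  shows "(\<Sum>j<r. corner (r - j - 1) j) = - (real r * t r)"
proof -
  have "(\<Sum>j<r. corner (r - j - 1) j) = (\<Sum>j<r. \<Sum>d\<le>j. u (r - d) * v d)"
    unfolding corner_eq_sum
  proof (intro sum.cong refl)
    fix j d assume "j \<in> {..<r}" "d \<in> {..j}"
    then have "r - j - 1 + 1 + (j - d) = r - d"
      by auto
    then show "u (r - j - 1 + 1 + (j - d)) * v d = u (r - d) * v d"
      by (simp only:)
  qed
  also have "\<dots> = (\<Sum>d\<le>r. real (r - d) * (u (r - d) * v d))"
    by (rule sum_triangle)
  also have "\<dots> = (\<Sum>d\<le>r. v d * (real (r - d) * u (r - d)))"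
    by (simp add: mult_ac)
  finally show ?thesis
    using sum_weighted_conv[of r] assms by simp
qed

lemma abs_infsum_row_le:
  fixes A :: "nat \<Rightarrow> nat \<Rightarrow> real"
  assumes A: "row_bdd c A" and F: "finite F"
    and q: "\<And>G. finite G \<Longrightarrow> G \<subseteq> X \<Longrightarrow> (\<Sum>l\<in>G. \<bar>q l\<bar>) \<le> e" and X: "(\<lambda>l. \<bar>q l\<bar>) summable_on X"
  shows "(\<Sum>i\<in>F. \<bar>\<Sum>\<^sub>\<infinity>l\<in>X. q l * A l i\<bar>) \<le> e * c"
proof -
  have sm: "(\<lambda>l. \<bar>q l * A l i\<bar>) summable_on X" for i
    using X row_bdd_entry[OF A] by (rule abs_summable_mult_bounded(1))
  have "(\<Sum>i\<in>F. \<bar>\<Sum>\<^sub>\<infinity>l\<in>X. q l * A l i\<bar>) \<le> (\<Sum>i\<in>F. \<Sum>\<^sub>\<infinity>l\<in>X. \<bar>q l * A l i\<bar>)"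
    by (intro sum_mono abs_infsum_le sm)
  also have "\<dots> = (\<Sum>\<^sub>\<infinity>l\<in>X. \<Sum>i\<in>F. \<bar>q l * A l i\<bar>)"
    using infsum_sum_swap[OF F sm] by simp
  also have "\<dots> \<le> e * c"
  proof (rule infsum_le_finite_sums)
    show "(\<lambda>l. \<Sum>i\<in>F. \<bar>q l * A l i\<bar>) summable_on X"
      using infsum_sum_swap[OF F sm] by simp
    fix G assume G: "finite G" "G \<subseteq> X"
    have "(\<Sum>l\<in>G. \<Sum>i\<in>F. \<bar>q l * A l i\<bar>) = (\<Sum>l\<in>G. \<bar>q l\<bar> * (\<Sum>i\<in>F. \<bar>A l i\<bar>))"
      by (simp add: abs_mult sum_distrib_left)
    also have "\<dots> \<le> (\<Sum>l\<in>G. \<bar>q l\<bar> * c)"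
      by (intro sum_mono mult_left_mono row_bddD[OF A F]) auto
    also have "\<dots> \<le> e * c"
      unfolding sum_distrib_right[symmetric] by (intro mult_right_mono q G row_bdd_nonneg[OF A])
    finally show "(\<Sum>l\<in>G. \<Sum>i\<in>F. \<bar>q l * A l i\<bar>) \<le> e * c" .
  qed
  finally show ?thesis .
qed

lemma \<kappa>_nonneg: "0 \<le> \<kappa>"
  unfolding \<kappa>_def by (intro sum_nonneg) auto

text \<open>The determinants satisfy \<open>D' = \<kappa> D\<close> up to an error that vanishes
  uniformly in \<open>s\<close>, and \<open>D = 1\<close> at \<open>s = 0\<close>.\<close>

lemma fdet_gram_tendsto_exp: "(\<lambda>n. fdet n gram) \<longlonglongrightarrow> exp \<kappa>"
proof -
  obtain c where c: "1 \<le> c" "\<And>s. \<bar>s\<bar> \<le> 2 \<Longrightarrow> row_bdd c (toep_low (exp_coeff t s))"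
    "\<And>s. \<bar>s\<bar> \<le> 2 \<Longrightarrow> row_bdd c (toep_up (exp_coeff t s))"
    using uniform_bound by blast
  define c2 where "c2 = c * c"
  have c2: "1 \<le> c2"
    using c(1) mult_mono[of 1 c 1 c] by (simp add: c2_def)
  have rows: "row_bdd c2 (deformed_gram s)" if "\<bar>s\<bar> \<le> 1" for s
    unfolding c2_def deformed_gram_def using c(2)[of "-s"] c(3)[of "-1"] that by (intro row_bdd_mmul) auto
  obtain b where corner_rows: "row_bdd b corner"
    using row_bounded_rules unfolding corner_def row_bounded_def by (metis row_bounded_def row_bounded_toep fast_decay_exp_coeff)
  \<comment> \<open>\<open>c2 * q = 1 / 2\<close> lets the tail of \<open>corner\<close> beat the
    bound \<open>c2 ^ n\<close> on the remaining rows.\<close>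
  define q where "q = 1 / (2 * c2)"
  have q: "0 < q" "q \<le> 1 / 2" "c2 * q = 1 / 2"
    using c2 by (auto simp: q_def field_simps)
  obtain d where d: "0 \<le> d" "\<And>k n F. finite F \<Longrightarrow> F \<subseteq> {n..} \<Longrightarrow> (\<Sum>l\<in>F. \<bar>corner k l\<bar>) \<le> d * q ^ n"
    using corner_tail_small[OF q(1,2)] by blast
  define T where "T = (\<Sum>r\<in>supp t. \<bar>t r\<bar>)"
  define e where "e n = real n * T * (c2 ^ n * (d * q ^ n * c2))" for n
  define D' where "D' n s = (\<Sum>j<n. fdet n ((deformed_gram s)(j := \<lambda>i. \<Sum>r\<in>supp t. - t r * deformed_gram s j (i + r))))" for n s
  have der: "((\<lambda>s. fdet n (deformed_gram s)) has_field_derivative D' n s) (at s)" if "\<bar>s\<bar> \<le> 1" for n s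
    unfolding D'_def by (intro fdet_has_field_derivative deformed_gram_has_derivative that)
  \<comment> \<open>A shifted row is either a duplicate or a combination of rows. In a combination
    every row except row \<open>j\<close> itself is a duplicate, so only the diagonal coefficient
    and the tail beyond \<open>n\<close> survive.\<close>
  have row_split: "\<exists>x. \<bar>x\<bar> \<le> c2 ^ n * (d * q ^ n * c2) \<and>
      fdet n ((deformed_gram s)(j := \<lambda>i. deformed_gram s j (i + r))) = (if r \<le> j then 0 else corner (r - j - 1) j * fdet n (deformed_gram s)) + x"
    if s: "\<bar>s\<bar> \<le> 1" and r: "r \<in> supp t" and j: "j < n" for n s r j
  proof (cases "r \<le> j")
    case True
    have "fdet n ((deformed_gram s)(j := \<lambda>i. deformed_gram s j (i + r))) = 0"
      using True j supp_pos[OF r] deformed_gram_shift[OF supp_pos[OF r], of s j]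
      by (intro fdet_equal_rows[of j "j - r"]) auto
    then show ?thesis
      using True c2 d q by (intro exI[of _ 0]) auto
  next
    case False
    let ?k = "r - j - 1"
    define err where "err i = (\<Sum>\<^sub>\<infinity>l\<in>{n..}. corner ?k l * deformed_gram s l i)" for i
    \<comment> \<open>The tail is packed into one extra row of index \<open>n\<close> and
      coefficient 1, so that linearity over a finite index set applies.\<close>
    have row: "deformed_gram s j (i + r) = (\<Sum>l\<in>{..n}. (if l < n then corner ?k l else 1) * (if l < n then deformed_gram s l else err) i)" for i
    proof -
      have UN: "{..<n} \<union> {n..} = UNIV"
        by auto
      have "deformed_gram s j (i + r) = (\<Sum>\<^sub>\<infinity>l. corner ?k l * deformed_gram s l i)"
        using False by (simp add: deformed_gram_shift[OF supp_pos[OF r]] edge_eq mmul_def)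
      also have "\<dots> = (\<Sum>\<^sub>\<infinity>l\<in>{..<n}. corner ?k l * deformed_gram s l i) + err i"
        unfolding UN[symmetric] err_def
        by (rule infsum_Un_disjoint) (use row_bdd_mult_summable(2)[OF corner_rows rows[OF s]] in auto)
      finally show ?thesis
        by (simp add: lessThan_Suc_atMost[symmetric])
    qed
    have "fdet n ((deformed_gram s)(j := \<lambda>i. deformed_gram s j (i + r)))
        = (\<Sum>l\<in>{..n}. (if l < n then corner ?k l else 1) * fdet n ((deformed_gram s)(j := (if l < n then deformed_gram s l else err))))"
      by (rule fdet_upd_row_sum[OF j]) (use row in auto)
    also have "\<dots> = (\<Sum>l<n. corner ?k l * fdet n ((deformed_gram s)(j := deformed_gram s l))) + fdet n ((deformed_gram s)(j := err))"
      by (simp add: lessThan_Suc_atMost[symmetric])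
    also have "(\<Sum>l<n. corner ?k l * fdet n ((deformed_gram s)(j := deformed_gram s l))) = (\<Sum>l<n. if l = j then corner ?k l * fdet n (deformed_gram s) else 0)"
    proof (intro sum.cong refl)
      fix l assume "l \<in> {..<n}"
      then show "corner ?k l * fdet n ((deformed_gram s)(j := deformed_gram s l)) = (if l = j then corner ?k l * fdet n (deformed_gram s) else 0)"
        using j fdet_equal_rows[of l j n "(deformed_gram s)(j := deformed_gram s l)"] by (cases "l = j") auto
    qed
    also have "\<dots> = corner ?k j * fdet n (deformed_gram s)"
      using j by simp
    finally have eq: "fdet n ((deformed_gram s)(j := \<lambda>i. deformed_gram s j (i + r))) = corner ?k j * fdet n (deformed_gram s) + fdet n ((deformed_gram s)(j := err))" .
    have err: "(\<Sum>i<n. \<bar>err i\<bar>) \<le> d * q ^ n * c2"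
      unfolding err_def
      by (rule abs_infsum_row_le[OF rows[OF s] _ d(2)])
        (auto intro: summable_on_subset_banach[OF row_bdd_abs_summable[OF corner_rows]])
    have "\<bar>fdet n ((deformed_gram s)(j := err))\<bar> \<le> (\<Prod>i<n. \<Sum>l<n. \<bar>((deformed_gram s)(j := err)) i l\<bar>)"
      by (rule abs_fdet_le)
    also have "\<dots> = (\<Sum>l<n. \<bar>err l\<bar>) * (\<Prod>i\<in>{..<n} - {j}. \<Sum>l<n. \<bar>deformed_gram s i l\<bar>)"
      using j by (subst prod.remove[of _ j]) (auto intro!: prod.cong)
    also have "\<dots> \<le> (d * q ^ n * c2) * (\<Prod>i\<in>{..<n} - {j}. c2)"
      using c2 d q
      by (intro mult_mono err prod_mono conjI sum_nonneg prod_nonneg row_bddD[OF rows[OF s]]) auto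
    also have "\<dots> \<le> (d * q ^ n * c2) * c2 ^ n"
    proof (rule mult_left_mono)
      show "(\<Prod>i\<in>{..<n} - {j}. c2) \<le> c2 ^ n"
        using c2 j by (auto intro!: power_increasing simp: card_Diff_singleton)
    qed (use c2 d q in auto)
    finally have "\<bar>fdet n ((deformed_gram s)(j := err))\<bar> \<le> c2 ^ n * (d * q ^ n * c2)"
      by (simp only: mult.commute)
    then show ?thesis
      using eq False by auto
  qed
  \<comment> \<open>With \<open>n\<close> at least every \<open>r\<close> in the support, the sums
    over \<open>j < r\<close> are complete and \<open>corner_trace\<close> applies to each of
    them.\<close>
  have close: "\<bar>D' n s - \<kappa> * fdet n (deformed_gram s)\<bar> \<le> e n"
    if s: "\<bar>s\<bar> \<le> 1" and n: "\<And>r. r \<in> supp t \<Longrightarrow> r \<le> n" for n s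
  proof -
    let ?D = "fdet n (deformed_gram s)" and ?m = "c2 ^ n * (d * q ^ n * c2)"
    define x where "x r j = fdet n ((deformed_gram s)(j := \<lambda>i. deformed_gram s j (i + r)))
        - (if r \<le> j then 0 else corner (r - j - 1) j * ?D)" for r j
    have x: "fdet n ((deformed_gram s)(j := \<lambda>i. deformed_gram s j (i + r)))
        = (if r \<le> j then 0 else corner (r - j - 1) j * ?D) + x r j" for r j
      by (simp add: x_def)
    have x_le: "\<bar>x r j\<bar> \<le> ?m" if rj: "r \<in> supp t" "j < n" for r j
    proof -
      obtain y where "\<bar>y\<bar> \<le> ?m" "fdet n ((deformed_gram s)(j := \<lambda>i. deformed_gram s j (i + r)))
          = (if r \<le> j then 0 else corner (r - j - 1) j * ?D) + y"
        using row_split[OF s rj] by blast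
      then show ?thesis
        by (simp add: x_def)
    qed
    have "D' n s = (\<Sum>j<n. \<Sum>r\<in>supp t. - t r * fdet n ((deformed_gram s)(j := \<lambda>i. deformed_gram s j (i + r))))"
      unfolding D'_def by (intro sum.cong refl fdet_upd_row_sum finite_supp) auto
    also have "\<dots> = (\<Sum>j<n. \<Sum>r\<in>supp t. - t r * (if r \<le> j then 0 else corner (r - j - 1) j * ?D) + - t r * x r j)"
      by (intro sum.cong refl) (simp only: x distrib_left)
    also have "\<dots> = (\<Sum>r\<in>supp t. \<Sum>j<n. - t r * (if r \<le> j then 0 else corner (r - j - 1) j * ?D)) + (\<Sum>j<n. \<Sum>r\<in>supp t. - t r * x r j)"
      by (simp only: sum.distrib sum.swap[of _ "{..<n}" "supp t"])
    also have "(\<Sum>r\<in>supp t. \<Sum>j<n. - t r * (if r \<le> j then 0 else corner (r - j - 1) j * ?D)) = \<kappa> * ?D"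
    proof -
      have "(\<Sum>j<n. - t r * (if r \<le> j then 0 else corner (r - j - 1) j * ?D)) = real r * (t r)\<^sup>2 * ?D"
        if r: "r \<in> supp t" for r
      proof -
        have "(\<Sum>j<n. - t r * (if r \<le> j then 0 else corner (r - j - 1) j * ?D)) = (\<Sum>j<r. - t r * ?D * corner (r - j - 1) j)"
          using n[OF r] by (intro sum.mono_neutral_cong_right) auto
        also have "\<dots> = - t r * ?D * - (real r * t r)"
          unfolding sum_distrib_left[symmetric] corner_trace[OF r] ..
        finally show ?thesis
          by (simp add: power2_eq_square)
      qed
      then show ?thesis
        by (simp add: \<kappa>_def sum_distrib_right)
    qed
    finally have "\<bar>D' n s - \<kappa> * ?D\<bar> = \<bar>\<Sum>j<n. \<Sum>r\<in>supp t. - t r * x r j\<bar>"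
      by simp
    also have "\<dots> \<le> (\<Sum>j<n. \<Sum>r\<in>supp t. \<bar>t r\<bar> * ?m)"
      by (intro order_trans[OF sum_abs] sum_mono) (auto simp: abs_mult intro!: mult_left_mono x_le)
    also have "\<dots> = e n"
      by (simp add: e_def T_def sum_distrib_right[symmetric])
    finally show ?thesis .
  qed
  have bound: "\<bar>exp (- \<kappa>) * fdet n gram - 1\<bar> \<le> e n" if n: "\<And>r. r \<in> supp t \<Longrightarrow> r \<le> n" for n
  proof -
    \<comment> \<open>\<open>exp (- \<kappa> * s)\<close> is the integrating factor of the
      approximate equation. It is at most 1 on the interval, since \<open>\<kappa>\<close> is
      nonnegative.\<close>
    let ?f = "\<lambda>s. exp (- \<kappa> * s) * fdet n (deformed_gram s)"
    have "\<exists>z::real. 0 < z \<and> z < 1 \<and> ?f 1 - ?f 0 = (1 - 0) * (exp (- \<kappa> * z) * (D' n z - \<kappa> * fdet n (deformed_gram z)))"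
    proof (rule MVT2)
      fix s :: real assume "0 \<le> s" "s \<le> 1"
      then show "DERIV ?f s :> exp (- \<kappa> * s) * (D' n s - \<kappa> * fdet n (deformed_gram s))"
        by (auto intro!: derivative_eq_intros der simp: algebra_simps)
    qed simp
    then obtain z where z: "0 < z" "z < 1" "?f 1 - ?f 0 = exp (- \<kappa> * z) * (D' n z - \<kappa> * fdet n (deformed_gram z))"
      by auto
    have "\<bar>?f 1 - ?f 0\<bar> \<le> 1 * e n"
      unfolding z(3) abs_mult using z \<kappa>_nonneg n by (intro mult_mono close) auto
    then show ?thesis
      by (simp add: deformed_gram_1 deformed_gram_0)
  qed
  have e_eq: "e n = T * d * c2 * (real n * (1 / 2) ^ n)" for n
  proof -
    have "(1 / 2) ^ n = c2 ^ n * q ^ n"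
      unfolding q(3)[symmetric] by (rule power_mult_distrib)
    then show ?thesis
      by (simp only: e_def mult_ac)
  qed
  have lim: "e \<longlonglongrightarrow> 0"
    unfolding e_eq by (intro tendsto_mult_right_zero powser_times_n_limit_0) simp
  have ev: "\<forall>\<^sub>F n in sequentially. norm (exp (- \<kappa>) * fdet n gram - 1) \<le> e n"
    using eventually_ge_at_top[of "Max (insert 0 (supp t))"]
  proof eventually_elim
    case (elim n)
    then show ?case
      using finite_supp by (auto intro!: bound)
  qed
  have "(\<lambda>n. exp (- \<kappa>) * fdet n gram - 1) \<longlonglongrightarrow> 0"
    by (rule Lim_null_comparison[OF ev lim])
  then have "(\<lambda>n. exp \<kappa> * (exp (- \<kappa>) * fdet n gram)) \<longlonglongrightarrow> exp \<kappa> * 1"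
    by (intro tendsto_mult tendsto_const) (simp add: LIM_zero_iff)
  then show ?thesis
    by (simp add: mult.assoc[symmetric] exp_add[symmetric])
qed

end

section \<open>Schur functions of partitions in a box\<close>

lemma part_pos_iff:
  assumes "is_partition \<mu>"
  shows "0 < part \<mu> i \<longleftrightarrow> 1 \<le> i \<and> i \<le> length \<mu>"
proof -
  have "0 < \<mu> ! (i - 1)" if "1 \<le> i" "i \<le> length \<mu>"
    using assms that nth_mem[of "i - 1" \<mu>] unfolding is_partition_def by auto
  then show ?thesis
    by (auto simp: part_def)
qed

lemma part_mono:
  assumes "is_partition \<mu>" "1 \<le> i" "i \<le> j"
  shows "part \<mu> j \<le> part \<mu> i"
proof (cases "i = j \<or> length \<mu> < j")
  case False
  then have "\<mu> ! (i - 1) \<ge> \<mu> ! (j - 1)"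
    using assms unfolding is_partition_def by (intro sorted_wrt_nth_less[of "(\<ge>)"]) auto
  then show ?thesis
    using assms False by (simp add: part_def)
qed (auto simp: part_def)

lemma partition_eqI:
  assumes "is_partition \<mu>" "is_partition \<nu>" "\<And>i. part \<mu> i = part \<nu> i"
  shows "\<mu> = \<nu>"
proof -
  have "length \<mu> = length \<nu>"
  proof (rule antisym)
    show "length \<mu> \<le> length \<nu>"
      using part_pos_iff[OF assms(1), of "length \<mu>"] part_pos_iff[OF assms(2), of "length \<mu>"] assms(3) by fastforce
    show "length \<nu> \<le> length \<mu>"
      using part_pos_iff[OF assms(1), of "length \<nu>"] part_pos_iff[OF assms(2), of "length \<nu>"] assms(3) by fastforce
  qed
  then show ?thesis
  proof (rule nth_equalityI)
    fix i assume "i < length \<mu>"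
    then show "\<mu> ! i = \<nu> ! i"
      using assms(3)[of "Suc i"] \<open>length \<mu> = length \<nu>\<close> by (simp add: part_def)
  qed
qed

lemma part_filter_pos:
  assumes "sorted_wrt (\<ge>) ys"
  shows "part (filter (\<lambda>x. 0 < x) ys) i = part ys i"
  using assms
proof (induction ys arbitrary: i)
  case (Cons y ys)
  show ?case
  proof (cases "y = 0")
    case True
    then have z: "\<And>x. x \<in> set (y # ys) \<Longrightarrow> x = 0"
      using Cons.prems by auto
    then have "filter (\<lambda>x. 0 < x) (y # ys) = []"
      by (auto simp: filter_empty_conv)
    moreover have "part (y # ys) i = 0"
      using z[OF nth_mem, of "i - 1"] by (auto simp: part_def simp del: nth_Cons')
    ultimately show ?thesis
      by (simp add: part_def)
  next
    case False
    show ?thesis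
      using Cons.IH[of "i - 1"] Cons.prems False
      by (cases "i = 0 \<or> i = 1") (auto simp: part_def nth_Cons' split: if_splits)
  qed
qed simp

lemma is_partition_filter_pos: "sorted_wrt (\<ge>) ys \<Longrightarrow> is_partition (filter (\<lambda>x. 0 < x) ys)"
  by (auto simp: is_partition_def sorted_wrt_filter)

definition box :: "nat \<Rightarrow> nat \<Rightarrow> nat list set" where
  "box n L = {\<mu>. is_partition \<mu> \<and> length \<mu> \<le> n \<and> part \<mu> 1 \<le> L}"

text \<open>Beta numbers in increasing order: \<open>i = 0\<close> reads the part of index
  \<open>n\<close>. Adding \<open>i\<close> makes weakly increasing parts strictly increasing, hence
  a set of sites.\<close>

definition beta :: "nat \<Rightarrow> nat list \<Rightarrow> nat \<Rightarrow> nat" where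
  "beta n \<mu> i = part \<mu> (n - i) + i"

lemma beta_less:
  assumes "is_partition \<mu>" "i < j" "j < n"
  shows "beta n \<mu> i < beta n \<mu> j"
  using part_mono[OF assms(1), of "n - j" "n - i"] assms(2,3) unfolding beta_def by linarith

lemma inj_on_beta: "is_partition \<mu> \<Longrightarrow> inj_on (beta n \<mu>) {..<n}"
  by (rule inj_onI) (metis beta_less lessThan_iff less_irrefl linorder_neqE_nat)

lemma beta_image_inj:
  assumes "is_partition \<mu>" "is_partition \<nu>" "beta n \<mu> ` {..<n} = beta n \<nu> ` {..<n}" "i < n"
  shows "beta n \<mu> i = beta n \<nu> i"
proof -
  have s: "sorted (map (beta n \<mu>) [0..<n])" "distinct (map (beta n \<mu>) [0..<n])" if "is_partition \<mu>" for \<mu>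
    using beta_less[OF that] inj_on_beta[OF that, of n]
    by (auto simp: sorted_iff_nth_mono_less distinct_map lessThan_atLeast0 intro!: less_imp_le)
  have "map (beta n \<mu>) [0..<n] = map (beta n \<nu>) [0..<n]"
    by (rule sorted_distinct_set_unique) (use assms s in \<open>auto simp: lessThan_atLeast0\<close>)
  then show ?thesis
    using assms(4) by simp
qed

lemma bij_betw_box:
  "bij_betw (\<lambda>\<mu>. beta n \<mu> ` {..<n}) (box n L) {S. S \<subseteq> {..<n + L} \<and> card S = n}"
  unfolding bij_betw_def
proof (intro conjI equalityI subsetI)
  show "inj_on (\<lambda>\<mu>. beta n \<mu> ` {..<n}) (box n L)"
  proof (rule inj_onI)
    fix \<mu> \<nu> assume m: "\<mu> \<in> box n L" and n: "\<nu> \<in> box n L" and eq: "beta n \<mu> ` {..<n} = beta n \<nu> ` {..<n}"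
    have "part \<mu> k = part \<nu> k" for k
    proof (cases "1 \<le> k \<and> k \<le> n")
      case True
      then have "beta n \<mu> (n - k) = beta n \<nu> (n - k)"
        using m n eq by (intro beta_image_inj) (auto simp: box_def)
      moreover have "n - (n - k) = k"
        using True by simp
      ultimately show ?thesis
        unfolding beta_def by simp
    next
      case False
      then show ?thesis
        using m n by (auto simp: box_def part_def)
    qed
    then show "\<mu> = \<nu>"
      using m n by (intro partition_eqI) (auto simp: box_def)
  qed
  fix S assume "S \<in> (\<lambda>\<mu>. beta n \<mu> ` {..<n}) ` box n L"
  then obtain \<mu> where m: "\<mu> \<in> box n L" "S = beta n \<mu> ` {..<n}"
    by blast
  have "beta n \<mu> i < n + L" if "i < n" for i
  proof -
    have "part \<mu> (n - i) \<le> part \<mu> 1"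
      using m that by (intro part_mono) (auto simp: box_def)
    then show ?thesis
      using m that by (simp add: beta_def box_def)
  qed
  moreover have "card S = n"
    using m inj_on_beta[of \<mu> n] by (simp add: card_image box_def)
  ultimately show "S \<in> {S. S \<subseteq> {..<n + L} \<and> card S = n}"
    using m by auto
next
  fix S assume "S \<in> {S. S \<subseteq> {..<n + L} \<and> card S = n}"
  then have S: "S \<subseteq> {..<n + L}" "card S = n" "finite S"
    using finite_subset[of S "{..<n + L}"] by auto
  define xs where "xs = sorted_list_of_set S"
  have xs: "length xs = n" "set xs = S" "sorted_wrt (<) xs"
    using S by (simp_all add: xs_def strict_sorted_iff)
  have less: "xs ! i < xs ! j" if "i < j" "j < n" for i j
    using xs that by (simp add: sorted_wrt_nth_less)
  \<comment> \<open>Consecutive sites differ by at least 1, which makes \<open>xs ! i - i\<close>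
    weakly increasing. The second conjunct guards against truncated subtraction.\<close>
  have ge: "j - i \<le> xs ! j - xs ! i \<and> xs ! i \<le> xs ! j" if "i \<le> j" "j < n" for i j
    using that
  proof (induction j)
    case (Suc j)
    then show ?case
      using less[of j "Suc j"] by (cases "i = Suc j") auto
  qed simp
  have idx: "i \<le> xs ! i" if "i < n" for i
    using ge[of 0 i] that by auto
  define g where "g i = xs ! i - i" for i
  have g_mono: "g i \<le> g j" if "i \<le> j" "j < n" for i j
    using ge[OF that] idx[of i] that by (auto simp: g_def)
  define ys where "ys = map (\<lambda>k. g (n - 1 - k)) [0..<n]"
  have sorted: "sorted_wrt (\<ge>) ys"
    by (auto simp: ys_def sorted_wrt_iff_nth_less intro!: g_mono)
  define \<mu> where "\<mu> = filter (\<lambda>x. 0 < x) ys"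
  have part: "part \<mu> k = (if 1 \<le> k \<and> k \<le> n then g (n - k) else 0)" for k
    unfolding \<mu>_def part_filter_pos[OF sorted] by (auto simp: part_def ys_def)
  have beta: "beta n \<mu> i = xs ! i" if "i < n" for i
  proof -
    have "1 \<le> n - i" "n - i \<le> n" "n - (n - i) = i"
      using that by auto
    then show ?thesis
      using idx[OF that] by (simp add: beta_def part g_def)
  qed
  have "length \<mu> \<le> n"
    unfolding \<mu>_def using length_filter_le[of _ ys] by (simp add: ys_def)
  moreover have "part \<mu> 1 \<le> L"
  proof (cases "n = 0")
    case False
    then have "xs ! (n - 1) < n + L"
      using xs S nth_mem[of "n - 1" xs] by auto
    then show ?thesis
      using False by (simp add: part g_def)
  qed (simp add: part)
  ultimately have "\<mu> \<in> box n L"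
    using is_partition_filter_pos[OF sorted] by (simp add: box_def \<mu>_def)
  moreover have "S = beta n \<mu> ` {..<n}"
    using xs beta by (auto simp: in_set_conv_nth image_iff)
  ultimately show "S \<in> (\<lambda>\<mu>. beta n \<mu> ` {..<n}) ` box n L"
    by blast
qed

lemma finite_box: "finite (box n L)"
  using bij_betw_finite[OF bij_betw_box[of n L]] by (simp add: finite_subset[of _ "Pow {..<n + L}"])

text \<open>Two enumerations of one set differ by a permutation, so the minors agree up to sign and
  their squares agree.\<close>

lemma fdet_cols_image_eq:
  assumes f: "inj_on f {..<n}" and g: "inj_on g {..<n}" and eq: "f ` {..<n} = g ` {..<n}"
  shows "(fdet n (\<lambda>i j. A i (f j)))\<^sup>2 = (fdet n (\<lambda>i j. A i (g j)))\<^sup>2"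
proof -
  define q where "q i = (if i < n then inv_into {..<n} g (f i) else i)" for i
  have q: "q i < n" "g (q i) = f i" if "i < n" for i
  proof -
    have "f i \<in> g ` {..<n}"
      using that eq by auto
    then show "q i < n" "g (q i) = f i"
      using that inv_into_into[of "f i" g "{..<n}"] f_inv_into_f[of "f i" g "{..<n}"] by (auto simp: q_def)
  qed
  have "inj_on q {0..<n}"
    using f q by (intro inj_onI) (metis atLeastLessThan_iff inj_on_eq_iff lessThan_iff)
  moreover have "q ` {0..<n} \<subseteq> {0..<n}"
    using q by auto
  ultimately have "bij_betw q {0..<n} {0..<n}"
    by (simp add: bij_betw_def endo_inj_surj)
  then have "q permutes {0..<n}"
    by (rule bij_imp_permutes) (simp add: q_def)
  then have "fdet n (\<lambda>i j. A i (g (q j))) = of_int (sign q) * fdet n (\<lambda>i j. A i (g j))"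
    by (rule fdet_comp_permutes_cols)
  moreover have "fdet n (\<lambda>i j. A i (g (q j))) = fdet n (\<lambda>i j. A i (f j))"
    by (rule fdet_cong) (simp add: q)
  ultimately show ?thesis
    by (simp add: power_mult_distrib sign_def)
qed

section \<open>Sums of squared Schur functions over a box\<close>

context finite_times
begin

lemma miwa_h_eq: "miwa_h t k = (if k < 0 then 0 else v (nat k))"
  by (simp add: miwa_h_def exp_coeff_def times_fps_def)

text \<open>A common size \<open>n\<close> is needed to sum over partitions. Zero parts only add a
  unitriangular block, and reversing rows and columns together turns the decreasing order of the
  parts into the increasing order of \<open>beta\<close>.\<close>

lemma schur_eq_fdet:
  assumes "is_partition \<mu>" "length \<mu> \<le> n"
  shows "schur t \<mu> = fdet n (\<lambda>i j. Uv i (beta n \<mu> j))"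
proof -
  let ?A = "\<lambda>i j. miwa_h t (int (part \<mu> (i + 1)) - int i + int j)"
  define q where "q i = (if i < n then n - 1 - i else i)" for i
  have q: "q permutes {0..<n}"
    by (rule bij_imp_permutes[OF bij_betw_byWitness[where f' = q]]) (auto simp: q_def)
  obtain m where n: "n = length \<mu> + m"
    using assms(2) le_Suc_ex by blast
  have "fdet n ?A = fdet (length \<mu>) ?A * fdet m (\<lambda>i j. ?A (i + length \<mu>) (j + length \<mu>))"
    unfolding n by (rule fdet_block_upper) (auto simp: part_def miwa_h_eq)
  also have "fdet m (\<lambda>i j. ?A (i + length \<mu>) (j + length \<mu>)) = 1"
    by (rule fdet_upper_unitriangular) (auto simp: part_def miwa_h_eq)
  also have "fdet (length \<mu>) ?A = schur t \<mu>"
    by (simp add: schur_def fdet_def)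
  finally have "schur t \<mu> = fdet n ?A"
    by simp
  also have "\<dots> = fdet n (\<lambda>i j. ?A (q i) (q j))"
    by (rule fdet_comp_permutes[OF q, symmetric])
  also have "\<dots> = fdet n (\<lambda>i j. Uv j (beta n \<mu> i))"
  proof (rule fdet_cong)
    fix i j assume ij: "i < n" "j < n"
    have "int (part \<mu> (q i + 1)) - int (q i) + int (q j) = int (beta n \<mu> i) - int j"
      using ij by (auto simp: q_def beta_def Suc_diff_Suc)
    then show "?A (q i) (q j) = Uv j (beta n \<mu> i)"
      by (auto simp: miwa_h_eq toep_up_def nat_diff_distrib)
  qed
  also have "\<dots> = fdet n (\<lambda>i j. Uv i (beta n \<mu> j))"
    by (rule fdet_transpose)
  finally show ?thesis .
qed

lemma sum_box_schur_sq:
  "(\<Sum>\<mu>\<in>box n L. (schur t \<mu>)\<^sup>2) = fdet n (\<lambda>i j. \<Sum>k<n + L. Uv i k * Uv j k)"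
proof -
  \<comment> \<open>Any enumeration of \<open>S\<close> would do, because only the square of the
    minor is used.\<close>
  define enum where "enum S = beta n (SOME \<mu>. \<mu> \<in> box n L \<and> beta n \<mu> ` {..<n} = S)" for S
  define H where "H S = (fdet n (\<lambda>i j. Uv i (enum S j)))\<^sup>2" for S
  have enum: "inj_on (enum S) {..<n}" "enum S ` {..<n} = S" if "S \<subseteq> {..<n + L}" "card S = n" for S
  proof -
    have "S \<in> (\<lambda>\<mu>. beta n \<mu> ` {..<n}) ` box n L"
      unfolding bij_betw_imp_surj_on[OF bij_betw_box] using that by simp
    then have "\<exists>\<mu>. \<mu> \<in> box n L \<and> beta n \<mu> ` {..<n} = S"
      by auto
    from someI_ex[OF this] show "inj_on (enum S) {..<n}" "enum S ` {..<n} = S"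
      unfolding enum_def using inj_on_beta by (auto simp: box_def)
  qed
  have "fact n * fdet n (\<lambda>i j. \<Sum>k\<in>{..<n + L}. Uv i k * Uv j k)
      = (\<Sum>f\<in>PiE {..<n} (\<lambda>_. {..<n + L}). (fdet n (\<lambda>i j. Uv i (f j)))\<^sup>2)"
    by (subst fdet_sum_product) (simp_all add: power2_eq_square lessThan_atLeast0)
  also have "\<dots> = fact n * (\<Sum>S | S \<subseteq> {..<n + L} \<and> card S = n. H S)"
  proof (rule sum_PiE_inj_eq_sum_subsets)
    fix f assume f: "f \<in> PiE {..<n} (\<lambda>_. {..<n + L})" "\<not> inj_on f {..<n}"
    then obtain i j where "i < n" "j < n" "i \<noteq> j" "f i = f j"
      unfolding inj_on_def by auto
    then have "fdet n (\<lambda>i j. Uv j (f i)) = 0"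
      by (intro fdet_equal_rows[of i j]) auto
    then show "(fdet n (\<lambda>i j. Uv i (f j)))\<^sup>2 = 0"
      using fdet_transpose[of n "\<lambda>i j. Uv i (f j)"] by simp
  next
    fix f assume f: "f \<in> PiE {..<n} (\<lambda>_. {..<n + L})" "inj_on f {..<n}"
    then have "f ` {..<n} \<subseteq> {..<n + L}" "card (f ` {..<n}) = n"
      by (auto simp: card_image)
    then show "(fdet n (\<lambda>i j. Uv i (f j)))\<^sup>2 = H (f ` {..<n})"
      unfolding H_def using f enum by (intro fdet_cols_image_eq) auto
  qed simp
  also have "(\<Sum>S | S \<subseteq> {..<n + L} \<and> card S = n. H S) = (\<Sum>\<mu>\<in>box n L. H (beta n \<mu> ` {..<n}))"
    by (rule sum.reindex_bij_betw[OF bij_betw_box, symmetric])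
  also have "\<dots> = (\<Sum>\<mu>\<in>box n L. (schur t \<mu>)\<^sup>2)"
  proof (rule sum.cong[OF refl])
    fix \<mu> assume m: "\<mu> \<in> box n L"
    then have "beta n \<mu> ` {..<n} \<subseteq> {..<n + L}" "card (beta n \<mu> ` {..<n}) = n"
      using bij_betw_apply[OF bij_betw_box m] by auto
    then have "H (beta n \<mu> ` {..<n}) = (fdet n (\<lambda>i j. Uv i (beta n \<mu> j)))\<^sup>2"
      unfolding H_def using m enum inj_on_beta by (intro fdet_cols_image_eq) (auto simp: box_def)
    then show "H (beta n \<mu> ` {..<n}) = (schur t \<mu>)\<^sup>2"
      using m schur_eq_fdet[of \<mu> n] by (simp add: box_def)
  qed
  finally show ?thesis
    by simp
qed

text \<open>Triangularity cuts the sum off at \<open>k\<close>, so the truncated product is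
  exact.\<close>

lemma sum_lessThan_LL:
  assumes "k < N" shows "(\<Sum>l<N. Lv k l * Lu l p) = unit_mat k p"
proof -
  have "unit_mat k p = (\<Sum>\<^sub>\<infinity>l\<in>{..<N}. Lv k l * Lu l p)"
    unfolding LL(2)[symmetric] mmul_def using assms by (intro infsum_cong_neutral) (auto simp: toep_low_def)
  then show ?thesis by simp
qed

lemma sum_lessThan_UU:
  assumes "j < N" shows "(\<Sum>k<N. Uv i k * Uu k j) = unit_mat i j"
proof -
  have "unit_mat i j = (\<Sum>\<^sub>\<infinity>l\<in>{..<N}. Uv i l * Uu l j)"
    unfolding UU(2)[symmetric] mmul_def using assms by (intro infsum_cong_neutral) (auto simp: toep_up_def)
  then show ?thesis by simp
qed

text \<open>Jacobi's complementary minor identity for the unimodular matrix \<open>Uv Lv\<close>.\<close>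
lemma fdet_complementary:
  "fdet n (\<lambda>i j. \<Sum>k<n + L. Uv i k * Uv j k) = fdet L (\<lambda>i j. \<Sum>l<n + i + j + 1. Uu i l * Lu l j)"
proof -
  let ?N = "n + L"
  define M where "M i j = (\<Sum>k<?N. Uv i k * Lv k j)" for i j
  define X where "X i j = (\<Sum>k<?N. Lu i k * Uu k j)" for i j
  define Y where "Y i j = (if j < n then unit_mat i j else X i j)" for i j
  have MX: "(\<Sum>l<?N. M i l * X l j) = unit_mat i j" if "j < ?N" for i j
  proof -
    have "(\<Sum>l<?N. M i l * X l j) = (\<Sum>l<?N. \<Sum>k<?N. \<Sum>p<?N. Uv i k * (Lv k l * Lu l p) * Uu p j)"
      unfolding M_def X_def sum_product by (simp add: mult_ac)
    also have "\<dots> = (\<Sum>k<?N. \<Sum>p<?N. \<Sum>l<?N. Uv i k * (Lv k l * Lu l p) * Uu p j)"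
      by (subst sum.swap) (intro sum.cong refl sum.swap)
    also have "\<dots> = (\<Sum>k<?N. \<Sum>p<?N. Uv i k * (\<Sum>l<?N. Lv k l * Lu l p) * Uu p j)"
      by (simp add: sum_distrib_left sum_distrib_right)
    also have "\<dots> = (\<Sum>k<?N. \<Sum>p<?N. if p = k then Uv i k * Uu p j else 0)"
      by (intro sum.cong refl) (simp add: sum_lessThan_LL unit_mat_def)
    also have "\<dots> = (\<Sum>k<?N. Uv i k * Uu k j)"
      by (intro sum.cong refl) simp
    also have "\<dots> = unit_mat i j"
      using that by (rule sum_lessThan_UU)
    finally show ?thesis .
  qed
  have "fdet ?N M = fdet ?N Uv * fdet ?N Lv"
    unfolding M_def by (rule fdet_mult)
  also have "\<dots> = 1"
    by (simp add: fdet_upper_unitriangular fdet_lower_unitriangular toep_up_def toep_low_def)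
  finally have M1: "fdet ?N M = 1" .
  have "fdet ?N Y = fdet n Y * fdet L (\<lambda>i j. Y (i + n) (j + n))"
    by (rule fdet_block_upper) (simp add: Y_def unit_mat_def)
  also have "fdet n Y = 1"
    by (rule fdet_lower_unitriangular) (auto simp: Y_def unit_mat_def)
  finally have Y: "fdet ?N Y = fdet L (\<lambda>i j. X (i + n) (j + n))"
    by (simp add: Y_def[abs_def])
  define Z where "Z i j = (if j < n then M i j else unit_mat i j)" for i j
  have "fdet ?N M * fdet ?N Y = fdet ?N (\<lambda>i j. \<Sum>l<?N. M i l * Y l j)"
    by (rule fdet_mult[symmetric])
  also have "\<dots> = fdet ?N Z"
  proof (rule fdet_cong)
    fix i j assume ij: "i < ?N" "j < ?N"
    show "(\<Sum>l<?N. M i l * Y l j) = Z i j"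
    proof (cases "j < n")
      case True
      then have "(\<Sum>l<?N. M i l * Y l j) = (\<Sum>l<?N. if l = j then M i l else 0)"
        by (intro sum.cong) (auto simp: Y_def unit_mat_def)
      then show ?thesis
        using True ij by (simp add: Z_def)
    qed (use MX ij in \<open>simp add: Y_def Z_def\<close>)
  qed
  also have "\<dots> = fdet n Z * fdet L (\<lambda>i j. Z (i + n) (j + n))"
    by (rule fdet_block_lower) (simp add: Z_def unit_mat_def)
  also have "fdet L (\<lambda>i j. Z (i + n) (j + n)) = 1"
    by (rule fdet_lower_unitriangular) (auto simp: Z_def unit_mat_def)
  also have "fdet n Z = fdet n (\<lambda>i j. \<Sum>k<?N. Uv i k * Uv j k)"
    by (rule fdet_cong) (auto simp: Z_def M_def toep_up_def toep_low_def intro!: sum.cong)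
  finally have "fdet n (\<lambda>i j. \<Sum>k<?N. Uv i k * Uv j k) = fdet L (\<lambda>i j. X (i + n) (j + n))"
    by (simp add: M1 Y)
  also have "\<dots> = fdet L (\<lambda>i j. \<Sum>l<n + i + j + 1. Uu i l * Lu l j)"
  proof (rule fdet_cong)
    fix i j assume ij: "i < L" "j < L"
    have "X (i + n) (j + n) = (\<Sum>k\<in>{..n + min i j}. u (i + n - k) * u (j + n - k))"
      unfolding X_def using ij
      by (intro sum.mono_neutral_cong_right) (auto simp: toep_low_def toep_up_def)
    \<comment> \<open>Reflecting \<open>k\<close> to \<open>n + i + j - k\<close> replaces indices
      counted from the far corner by those of the Gram matrix, now with a cut-off that grows with
      \<open>n\<close>.\<close>
    also have "\<dots> = (\<Sum>l\<in>{max i j..n + i + j}. u (l - i) * u (l - j))"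
    proof (rule sum.reindex_bij_witness[of _ "\<lambda>l. n + i + j - l" "\<lambda>k. n + i + j - k"])
      fix k assume "k \<in> {..n + min i j}"
      then have "n + i + j - k - i = j + n - k" "n + i + j - k - j = i + n - k"
        by auto
      then show "u (n + i + j - k - i) * u (n + i + j - k - j) = u (i + n - k) * u (j + n - k)"
        by (simp only: mult.commute)
    qed auto
    also have "\<dots> = (\<Sum>l<n + i + j + 1. Uu i l * Lu l j)"
      by (intro sum.mono_neutral_cong_left) (auto simp: toep_low_def toep_up_def)
    finally show "X (i + n) (j + n) = (\<Sum>l<n + i + j + 1. Uu i l * Lu l j)" .
  qed
  finally show ?thesis .
qed

text \<open>As the number of rows grows with \<open>L\<close> fixed,
  \<open>fdet_complementary\<close> keeps the size \<open>L\<close>, and only the cut-off of the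
  inner sums moves.\<close>

lemma sum_box_schur_sq_tendsto: "(\<lambda>n. \<Sum>\<mu>\<in>box n L. (schur t \<mu>)\<^sup>2) \<longlonglongrightarrow> fdet L gram"
  unfolding sum_box_schur_sq fdet_complementary
proof (rule fdet_tendsto)
  fix i j
  obtain a b where "row_bdd a Uu" "row_bdd b Lu"
    using row_bounded_rules unfolding row_bounded_def by metis
  then have "(\<lambda>l. Uu i l * Lu l j) sums gram i j"
    unfolding gram_def by (rule infsum_mult_row_bdd_eq_suminf)
  then have "(\<lambda>n. \<Sum>l<n. Uu i l * Lu l j) \<longlonglongrightarrow> gram i j"
    by (simp add: sums_def)
  from LIMSEQ_ignore_initial_segment[OF this, of "i + j + 1"]
  show "(\<lambda>n. \<Sum>l<n + i + j + 1. Uu i l * Lu l j) \<longlonglongrightarrow> gram i j"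
    by (simp add: add.assoc)
qed

end

lemma supp_scale: "\<theta> \<noteq> 0 \<Longrightarrow> supp (\<lambda>r. \<theta> * \<gamma> r) = supp \<gamma>"
  by (simp add: supp_def)

text \<open>Continuity from below along the boxes. The limit is taken in \<open>ennreal\<close>, so
  finiteness of the event's mass is a result.\<close>

lemma measure_schur_measure_le:
  fixes \<gamma> :: "nat \<Rightarrow> real" and L :: nat
  assumes "finite (supp \<gamma>)" "\<theta> \<noteq> 0"
  shows "measure (schur_measure \<theta> \<gamma>) {\<mu> \<in> space (schur_measure \<theta> \<gamma>). part \<mu> 1 \<le> L}
    = exp (- (\<theta>\<^sup>2 * (\<Sum>r\<in>supp \<gamma>. real r * (\<gamma> r)\<^sup>2)))
      * fdet L (mmul (toep_up (exp_coeff (\<lambda>r. \<theta> * \<gamma> r) (-1))) (toep_low (exp_coeff (\<lambda>r. \<theta> * \<gamma> r) (-1))))"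
proof -
  let ?t = "\<lambda>r. \<theta> * \<gamma> r"
  interpret finite_times ?t
    by unfold_locales (simp add: supp_scale assms)
  let ?c = "exp (- (\<theta>\<^sup>2 * (\<Sum>r\<in>supp \<gamma>. real r * (\<gamma> r)\<^sup>2)))"
  let ?M = "schur_measure \<theta> \<gamma>" and ?P = "{\<mu>. is_partition \<mu>}"
  have sets: "sets ?M = Pow ?P" and space: "space ?M = ?P"
    by (simp_all add: schur_measure_def)
  have em: "emeasure ?M (box n L) = ennreal (?c * (\<Sum>\<mu>\<in>box n L. (schur ?t \<mu>)\<^sup>2))" for n
  proof -
    have sub: "box n L \<subseteq> ?P"
      by (auto simp: box_def)
    have "emeasure ?M (box n L) = (\<integral>\<^sup>+\<mu>. ennreal (?c * (schur ?t \<mu>)\<^sup>2) * indicator (box n L) \<mu> \<partial>count_space ?P)"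
      unfolding schur_measure_def using sub by (intro emeasure_density) auto
    also have "\<dots> = (\<Sum>\<mu>\<in>box n L. ennreal (?c * (schur ?t \<mu>)\<^sup>2))"
      using sub finite_box by (subst nn_integral_count_space'[of "box n L"]) (auto simp: indicator_def)
    also have "\<dots> = ennreal (?c * (\<Sum>\<mu>\<in>box n L. (schur ?t \<mu>)\<^sup>2))"
      by (subst sum_ennreal) (auto simp: sum_distrib_left)
    finally show ?thesis .
  qed
  have un: "(\<Union>n. box n L) = {\<mu> \<in> space ?M. part \<mu> 1 \<le> L}"
    by (auto simp: box_def space)
  have "(\<lambda>n. emeasure ?M (box n L)) \<longlonglongrightarrow> emeasure ?M (\<Union>n. box n L)"
    by (rule Lim_emeasure_incseq) (auto simp: sets box_def incseq_def)
  moreover have "(\<lambda>n. emeasure ?M (box n L)) \<longlonglongrightarrow> ennreal (?c * fdet L gram)"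
    unfolding em by (intro tendsto_ennrealI tendsto_mult tendsto_const sum_box_schur_sq_tendsto)
  ultimately have e: "emeasure ?M (\<Union>n. box n L) = ennreal (?c * fdet L gram)"
    by (rule LIMSEQ_unique)
  have "0 \<le> fdet L gram"
    by (rule LIMSEQ_le_const[OF sum_box_schur_sq_tendsto]) (auto intro!: exI[of _ 0] sum_nonneg)
  then show ?thesis
    using e unfolding un measure_def by (simp add: gram_def)
qed

section \<open>Bounds on the phase function\<close>

lemma norm_exp_taylor_le:
  fixes z :: complex
  assumes "norm z \<le> B"
  shows "norm (exp z - (\<Sum>k<N. z ^ k / fact k)) \<le> (exp B + 1) * norm z ^ N"
proof (cases N)
  case 0
  have "norm (exp z) \<le> exp (norm z)"
    by (rule norm_exp)
  also have "\<dots> \<le> exp B"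
    using assms by simp
  finally show ?thesis
    using 0 by (simp del: norm_exp_eq_Re)
next
  case (Suc n)
  have "norm (exp z - (\<Sum>k\<le>n. z ^ k / fact k)) \<le> exp \<bar>Re z\<bar> * norm z ^ Suc n / fact n"
    by (rule Taylor_exp)
  also have "\<dots> \<le> exp \<bar>Re z\<bar> * norm z ^ Suc n"
    using divide_left_mono[of 1 "fact n :: real" "exp \<bar>Re z\<bar> * norm z ^ Suc n"] by (simp del: power_Suc)
  also have "\<dots> \<le> exp B * norm z ^ Suc n"
    using assms abs_Re_le_cmod[of z] by (intro mult_right_mono) auto
  also have "\<dots> \<le> (exp B + 1) * norm z ^ Suc n"
    by (intro mult_right_mono) auto
  finally show ?thesis
    by (simp only: Suc lessThan_Suc_atMost)
qed

locale multicritical_times =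
  fixes m :: nat and \<gamma> :: "nat \<Rightarrow> real"
  assumes m_pos: "1 \<le> m" and crit: "multicritical m \<gamma>"
begin

abbreviation "S \<equiv> supp \<gamma>"
abbreviation "b \<equiv> edge_coeff \<gamma>"
abbreviation "d \<equiv> fluct_coeff m \<gamma>"

definition moment :: "nat \<Rightarrow> real" where
  "moment j = (\<Sum>r\<in>S. \<gamma> r * real r ^ j)"

lemma finite_S: "finite S"
  and moment_zero: "\<And>p. 1 \<le> p \<Longrightarrow> p < m \<Longrightarrow> moment (2 * p + 1) = 0"
  and moment_top: "moment (2 * m + 1) \<noteq> 0"
  and sine_nonneg: "\<And>\<phi>. 0 \<le> \<phi> \<Longrightarrow> \<phi> \<le> pi \<Longrightarrow> 0 \<le> (\<Sum>r\<in>S. real r ^ 2 * \<gamma> r * sin (real r * \<phi>))"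
  using crit unfolding multicritical_def moment_def by (auto simp: mult.commute)

lemma b_eq: "b = 2 * moment 1"
  by (simp add: edge_coeff_def moment_def mult.commute)

lemma d_eq: "d = 2 * (-1) ^ (m + 1) / fact (2 * m) * moment (2 * m + 1)"
  by (simp add: fluct_coeff_def moment_def mult.commute)

lemma d_nonzero: "d \<noteq> 0"
  using moment_top by (simp add: d_eq)

text \<open>With \<open>\<sigma> = -1\<close> and \<open>e = 0\<close> this is the phase function, and raising \<open>e\<close> while
  flipping \<open>\<sigma>\<close> is differentiation.\<close>
definition H :: "real \<Rightarrow> nat \<Rightarrow> complex \<Rightarrow> complex" where
  "H \<sigma> e w = (\<Sum>r\<in>S. of_real (\<gamma> r * real r ^ e) * (exp (of_nat r * w) + of_real \<sigma> * exp (- (of_nat r * w))))"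

text \<open>The Taylor coefficients are moments filtered by parity: \<open>\<sigma> = -1\<close>
  keeps odd powers of \<open>w\<close> and \<open>\<sigma> = 1\<close> even ones.\<close>

lemma H_taylor:
  assumes "0 \<le> B" "\<bar>\<sigma>\<bar> = 1"
  obtains C where "0 \<le> C" "\<And>w. norm w \<le> B \<Longrightarrow>
    norm (H \<sigma> e w - (\<Sum>k<N. of_real ((1 + \<sigma> * (-1) ^ k) * moment (e + k)) * w ^ k / fact k)) \<le> C * norm w ^ N"
proof (rule that)
  let ?C = "\<Sum>r\<in>S. \<bar>\<gamma> r * real r ^ e\<bar> * (2 * ((exp (real r * B) + 1) * real r ^ N))"
  show "0 \<le> ?C"
    by (intro sum_nonneg mult_nonneg_nonneg add_nonneg_nonneg) auto
  fix w :: complex assume w: "norm w \<le> B"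
  let ?T = "\<lambda>z::complex. \<Sum>k<N. z ^ k / fact k"
  let ?err = "\<lambda>z::complex. exp z - ?T z"
  have err: "norm (?err (of_nat r * w)) \<le> (exp (real r * B) + 1) * real r ^ N * norm w ^ N"
    "norm (?err (- (of_nat r * w))) \<le> (exp (real r * B) + 1) * real r ^ N * norm w ^ N" for r
    using w norm_exp_taylor_le[of "of_nat r * w" "real r * B" N] norm_exp_taylor_le[of "- (of_nat r * w)" "real r * B" N]
    by (simp_all add: norm_mult mult_left_mono power_mult_distrib mult.assoc)
  have "(\<Sum>k<N. of_real ((1 + \<sigma> * (-1) ^ k) * moment (e + k)) * w ^ k / fact k)
      = (\<Sum>k<N. \<Sum>r\<in>S. of_real (\<gamma> r * real r ^ e) * ((of_nat r * w) ^ k / fact k + of_real \<sigma> * ((- (of_nat r * w)) ^ k / fact k)))"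
  proof (rule sum.cong[OF refl])
    fix k
    have "of_real ((1 + \<sigma> * (-1) ^ k) * moment (e + k)) * w ^ k / fact k
       = (\<Sum>r\<in>S. of_real ((1 + \<sigma> * (-1) ^ k) * (\<gamma> r * real r ^ (e + k))) * w ^ k / fact k)"
      by (simp add: moment_def sum_distrib_left sum_distrib_right sum_divide_distrib)
    also have "\<dots> = (\<Sum>r\<in>S. of_real (\<gamma> r * real r ^ e) * ((of_nat r * w) ^ k / fact k + of_real \<sigma> * ((- (of_nat r * w)) ^ k / fact k)))"
    proof (rule sum.cong[OF refl])
      fix r
      have "(- (of_nat r * w)) ^ k = (- 1) ^ k * (of_nat r * w) ^ k"
        by (rule power_minus)
      then show "of_real ((1 + \<sigma> * (-1) ^ k) * (\<gamma> r * real r ^ (e + k))) * w ^ k / fact k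
        = of_real (\<gamma> r * real r ^ e) * ((of_nat r * w) ^ k / fact k + of_real \<sigma> * ((- (of_nat r * w)) ^ k / fact k))"
        by (simp add: power_mult_distrib power_add field_simps)
    qed
    finally show "of_real ((1 + \<sigma> * (-1) ^ k) * moment (e + k)) * w ^ k / fact k
       = (\<Sum>r\<in>S. of_real (\<gamma> r * real r ^ e) * ((of_nat r * w) ^ k / fact k + of_real \<sigma> * ((- (of_nat r * w)) ^ k / fact k)))" .
  qed
  also have "\<dots> = (\<Sum>r\<in>S. of_real (\<gamma> r * real r ^ e) * (?T (of_nat r * w) + of_real \<sigma> * ?T (- (of_nat r * w))))"
    by (subst sum.swap) (simp add: sum_distrib_left sum.distrib distrib_left)
  finally have "norm (H \<sigma> e w - (\<Sum>k<N. of_real ((1 + \<sigma> * (-1) ^ k) * moment (e + k)) * w ^ k / fact k))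
      = norm (\<Sum>r\<in>S. of_real (\<gamma> r * real r ^ e) * (?err (of_nat r * w) + of_real \<sigma> * ?err (- (of_nat r * w))))"
    by (simp add: H_def sum_subtractf[symmetric] algebra_simps)
  also have "\<dots> \<le> (\<Sum>r\<in>S. \<bar>\<gamma> r * real r ^ e\<bar> * (2 * ((exp (real r * B) + 1) * real r ^ N)) * norm w ^ N)"
  proof (intro order_trans[OF norm_sum] sum_mono)
    fix r
    have "norm (?err (of_nat r * w) + of_real \<sigma> * ?err (- (of_nat r * w)))
        \<le> norm (?err (of_nat r * w)) + norm (of_real \<sigma> * ?err (- (of_nat r * w)))"
      by (rule norm_triangle_ineq)
    also have "\<dots> = norm (?err (of_nat r * w)) + norm (?err (- (of_nat r * w)))"
      using assms by (simp add: norm_mult)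
    also have "\<dots> \<le> 2 * ((exp (real r * B) + 1) * real r ^ N) * norm w ^ N"
      using err[of r] by simp
    finally have "\<bar>\<gamma> r * real r ^ e\<bar> * norm (?err (of_nat r * w) + of_real \<sigma> * ?err (- (of_nat r * w)))
        \<le> \<bar>\<gamma> r * real r ^ e\<bar> * (2 * ((exp (real r * B) + 1) * real r ^ N) * norm w ^ N)"
      by (rule mult_left_mono) simp
    then show "norm (of_real (\<gamma> r * real r ^ e) * (?err (of_nat r * w) + of_real \<sigma> * ?err (- (of_nat r * w))))
        \<le> \<bar>\<gamma> r * real r ^ e\<bar> * (2 * ((exp (real r * B) + 1) * real r ^ N)) * norm w ^ N"
      by (simp only: norm_mult norm_of_real mult.assoc)
  qed
  also have "\<dots> = ?C * norm w ^ N"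
    by (simp add: sum_distrib_right)
  finally show "norm (H \<sigma> e w - (\<Sum>k<N. of_real ((1 + \<sigma> * (-1) ^ k) * moment (e + k)) * w ^ k / fact k)) \<le> ?C * norm w ^ N" .
qed

text \<open>Criticality removes the odd moments between 1 and \<open>2 * m + 1\<close>: after the
  linear term the first survivor has order \<open>2 * m + 1\<close>.\<close>

lemma H_phase:
  assumes "0 \<le> B"
  obtains C where "0 \<le> C" "\<And>w. norm w \<le> B \<Longrightarrow>
    norm (H (-1) 0 w - of_real b * w - of_real ((-1) ^ (m + 1) * d / real (2 * m + 1)) * w ^ (2 * m + 1)) \<le> C * norm w ^ (2 * m + 2)"
proof -
  obtain C where C: "0 \<le> C" "\<And>w. norm w \<le> B \<Longrightarrow>
    norm (H (-1) 0 w - (\<Sum>k<2 * m + 2. of_real ((1 + (-1) * (-1) ^ k) * moment (0 + k)) * w ^ k / fact k)) \<le> C * norm w ^ (2 * m + 2)"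
    using H_taylor[OF assms, of "-1" 0 "2 * m + 2"] by auto
  have eq: "(\<Sum>k<2 * m + 2. of_real ((1 + (-1) * (-1) ^ k) * moment (0 + k)) * w ^ k / fact k)
      = of_real b * w + of_real ((-1) ^ (m + 1) * d / real (2 * m + 1)) * w ^ (2 * m + 1)" for w :: complex
  proof -
    let ?g = "\<lambda>k. of_real ((1 + (-1) * (-1) ^ k) * moment (0 + k)) * w ^ k / fact k"
    have "(\<Sum>k<2 * m + 2. ?g k) = (\<Sum>k\<in>{1, 2 * m + 1}. ?g k)"
    proof (rule sum.mono_neutral_right)
      show "\<forall>k\<in>{..<2 * m + 2} - {1, 2 * m + 1}. ?g k = 0"
      proof
        fix k assume k: "k \<in> {..<2 * m + 2} - {1, 2 * m + 1}"
        show "?g k = 0"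
        proof (cases "even k")
          case False
          then obtain p where "k = 2 * p + 1"
            using oddE by blast
          then show ?thesis
            using k moment_zero[of p] by auto
        qed simp
      qed
    qed auto
    also have "\<dots> = ?g 1 + ?g (2 * m + 1)"
      using m_pos by simp
    also have "?g 1 = of_real b * w"
      by (simp add: b_eq)
    also have "?g (2 * m + 1) = of_real ((-1) ^ (m + 1) * d / real (2 * m + 1)) * w ^ (2 * m + 1)"
    proof -
      have "(-1) ^ (m + 1) * d / real (2 * m + 1) = 2 * moment (2 * m + 1) / (real (2 * m + 1) * fact (2 * m))"
        by (simp add: d_eq power_mult_distrib[symmetric] mult_ac)
      also have "real (2 * m + 1) * fact (2 * m) = fact (2 * m + 1)"
        by simp
      finally show ?thesis
        by (simp del: fact_Suc)
    qed
    finally show ?thesis .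
  qed
  show ?thesis
  proof (rule that[OF C(1)])
    fix w :: complex assume "norm w \<le> B"
    from C(2)[OF this]
    show "norm (H (-1) 0 w - of_real b * w - of_real ((-1) ^ (m + 1) * d / real (2 * m + 1)) * w ^ (2 * m + 1)) \<le> C * norm w ^ (2 * m + 2)"
      unfolding eq by (simp only: diff_diff_eq)
  qed
qed

text \<open>This is the second derivative of the phase, where two fewer orders are left of the same
  cancellation.\<close>

lemma H_second:
  assumes "0 \<le> B"
  obtains C where "0 \<le> C" "\<And>w. norm w \<le> B \<Longrightarrow> norm (H (-1) 2 w) \<le> C * norm w ^ (2 * m - 1)"
proof -
  obtain C where C: "0 \<le> C" "\<And>w. norm w \<le> B \<Longrightarrow>
    norm (H (-1) 2 w - (\<Sum>k<2 * m - 1. of_real ((1 + (-1) * (-1) ^ k) * moment (2 + k)) * w ^ k / fact k)) \<le> C * norm w ^ (2 * m - 1)"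
    using H_taylor[OF assms, of "-1" 2 "2 * m - 1"] by auto
  have "(\<Sum>k<2 * m - 1. of_real ((1 + (-1) * (-1) ^ k) * moment (2 + k)) * w ^ k / fact k) = 0" for w :: complex
  proof (rule sum.neutral, rule ballI)
    fix k assume k: "k \<in> {..<2 * m - 1}"
    show "of_real ((1 + (-1) * (-1) ^ k) * moment (2 + k)) * w ^ k / fact k = 0"
    proof (cases "even k")
      case False
      then obtain p where "k = 2 * p + 1"
        using oddE by blast
      then show ?thesis
        using k moment_zero[of "p + 1"] by (auto simp: algebra_simps)
    qed simp
  qed
  then show ?thesis
    using C by (intro that[of C]) simp_all
qed

section \<open>The real part of the phase near the imaginary axis\<close>

definition P :: "real \<Rightarrow> real" where
  "P \<phi> = 2 * (\<Sum>r\<in>S. \<gamma> r * real r * cos (real r * \<phi>)) - b"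

lemma Re_H:
  "Re (H \<sigma> e (Complex x \<phi>)) = (\<Sum>r\<in>S. \<gamma> r * real r ^ e * (exp (real r * x) + \<sigma> * exp (- (real r * x))) * cos (real r * \<phi>))"
  unfolding H_def Re_sum
  by (intro sum.cong refl) (simp add: Re_exp algebra_simps)

text \<open>\<open>H 1 1\<close> is the derivative of the phase, so \<open>P\<close> measures how
  fast the real part of the phase, less \<open>b\<close> times that of \<open>w\<close>, changes on
  leaving the imaginary axis.\<close>

lemma P_eq_H: "P \<phi> = Re (H 1 1 (Complex 0 \<phi>)) - b"
  unfolding P_def Re_H by (simp add: sum_distrib_left mult_ac)

lemma P_taylor:
  obtains C where "0 \<le> C" "\<And>\<phi>. \<bar>\<phi>\<bar> \<le> pi \<Longrightarrow> \<bar>P \<phi> + d * \<phi> ^ (2 * m)\<bar> \<le> C * \<bar>\<phi>\<bar> ^ (2 * m + 1)"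
proof -
  obtain C where C: "0 \<le> C" "\<And>w. norm w \<le> pi \<Longrightarrow>
    norm (H 1 1 w - (\<Sum>k<2 * m + 1. of_real ((1 + 1 * (-1) ^ k) * moment (1 + k)) * w ^ k / fact k)) \<le> C * norm w ^ (2 * m + 1)"
    using H_taylor[of pi 1 1 "2 * m + 1"] by auto
  have eq: "(\<Sum>k<2 * m + 1. of_real ((1 + 1 * (-1) ^ k) * moment (1 + k)) * w ^ k / fact k)
      = of_real b + of_real ((-1) ^ (m + 1) * d) * w ^ (2 * m)" for w :: complex
  proof -
    let ?g = "\<lambda>k. of_real ((1 + 1 * (-1) ^ k) * moment (1 + k)) * w ^ k / fact k"
    have "(\<Sum>k<2 * m + 1. ?g k) = (\<Sum>k\<in>{0, 2 * m}. ?g k)"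
    proof (rule sum.mono_neutral_right)
      show "\<forall>k\<in>{..<2 * m + 1} - {0, 2 * m}. ?g k = 0"
      proof
        fix k assume k: "k \<in> {..<2 * m + 1} - {0, 2 * m}"
        show "?g k = 0"
        proof (cases "even k")
          case True
          then obtain p where "k = 2 * p"
            by (rule evenE)
          then show ?thesis
            using k moment_zero[of p] by auto
        qed simp
      qed
    qed auto
    also have "\<dots> = ?g 0 + ?g (2 * m)"
      using m_pos by simp
    also have "?g 0 = of_real b"
      by (simp add: b_eq)
    also have "?g (2 * m) = of_real ((-1) ^ (m + 1) * d) * w ^ (2 * m)"
    proof -
      have "(-1) ^ (m + 1) * d = 2 * moment (2 * m + 1) / fact (2 * m)"
        by (simp add: d_eq power_mult_distrib[symmetric] mult_ac)
      then show ?thesis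
        by simp
    qed
    finally show ?thesis .
  qed
  show ?thesis
  proof (rule that[OF C(1)])
    fix \<phi> :: real assume \<phi>: "\<bar>\<phi>\<bar> \<le> pi"
    let ?w = "Complex 0 \<phi>"
    have w: "?w = \<i> * of_real \<phi>"
      by (simp add: complex_eq_iff)
    have "?w ^ (2 * m) = of_real ((-1) ^ m * \<phi> ^ (2 * m))"
      unfolding w power_mult_distrib by (simp add: power_mult)
    then have "Re (of_real b + of_real ((-1) ^ (m + 1) * d) * ?w ^ (2 * m)) = b + ((-1) ^ (m + 1) * d) * ((-1) ^ m * \<phi> ^ (2 * m))"
      by (simp only: of_real_mult[symmetric] of_real_add[symmetric] Re_complex_of_real)
    also have "((-1) ^ (m + 1) * d) * ((-1) ^ m * \<phi> ^ (2 * m)) = ((-1) ^ (m + 1) * (-1) ^ m) * (d * \<phi> ^ (2 * m))"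
      by (simp only: mult_ac)
    \<comment> \<open>The sign built into \<open>d\<close> meets the sign of the
      \<open>2 m\<close>-th power of the imaginary unit, leaving \<open>-1\<close> for every
      \<open>m\<close>.\<close>
    also have "(-1) ^ (m + 1) * (-1) ^ m = (-1 :: real)"
      by (simp add: power_mult_distrib[symmetric])
    finally have "Re (of_real b + of_real ((-1) ^ (m + 1) * d) * ?w ^ (2 * m)) = b - d * \<phi> ^ (2 * m)"
      by simp
    then have "P \<phi> + d * \<phi> ^ (2 * m) = Re (H 1 1 ?w - (of_real b + of_real ((-1) ^ (m + 1) * d) * ?w ^ (2 * m)))"
      by (simp only: P_eq_H minus_complex.simps)
    then have "\<bar>P \<phi> + d * \<phi> ^ (2 * m)\<bar> \<le> norm (H 1 1 ?w - (of_real b + of_real ((-1) ^ (m + 1) * d) * ?w ^ (2 * m)))"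
      by (simp only: abs_Re_le_cmod)
    also have "\<dots> \<le> C * norm ?w ^ (2 * m + 1)"
      using C(2)[of ?w] \<phi> unfolding eq by (simp add: w norm_mult)
    also have "norm ?w = \<bar>\<phi>\<bar>"
      by (simp add: w norm_mult)
    finally show "\<bar>P \<phi> + d * \<phi> ^ (2 * m)\<bar> \<le> C * \<bar>\<phi>\<bar> ^ (2 * m + 1)" .
  qed
qed

text \<open>The derivative of \<open>P\<close> is \<open>-2\<close> times the sine sum in the
  definition of the measure.\<close>

lemma P_antimono:
  assumes "0 \<le> x" "x \<le> y" "y \<le> pi"
  shows "P y \<le> P x"
proof (cases "x = y")
  case False
  have der: "(P has_real_derivative - 2 * (\<Sum>r\<in>S. real r ^ 2 * \<gamma> r * sin (real r * \<phi>))) (at \<phi>)" for \<phi>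
    unfolding P_def
    by (auto intro!: derivative_eq_intros simp: sum_distrib_left sum_negf[symmetric] power2_eq_square mult_ac intro!: sum.cong)
  have "\<exists>z>x. z < y \<and> P y - P x = (y - x) * (- 2 * (\<Sum>r\<in>S. real r ^ 2 * \<gamma> r * sin (real r * z)))"
    using assms False by (intro MVT2 der) auto
  then obtain z where z: "x < z" "z < y" "P y - P x = (y - x) * (- 2 * (\<Sum>r\<in>S. real r ^ 2 * \<gamma> r * sin (real r * z)))"
    by auto
  have "0 \<le> (y - x) * (2 * (\<Sum>r\<in>S. real r ^ 2 * \<gamma> r * sin (real r * z)))"
    using z(1,2) assms by (intro mult_nonneg_nonneg sine_nonneg) auto
  moreover have "(y - x) * (- 2 * (\<Sum>r\<in>S. real r ^ 2 * \<gamma> r * sin (real r * z)))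
      = - ((y - x) * (2 * (\<Sum>r\<in>S. real r ^ 2 * \<gamma> r * sin (real r * z))))"
    by simp
  ultimately show ?thesis
    using z(3) by linarith
qed simp

lemma P_zero: "P 0 = 0"
  by (simp add: P_def edge_coeff_def mult.commute)

lemma P_even: "P (- \<phi>) = P \<phi>"
  by (simp add: P_def)

text \<open>With \<open>d < 0\<close> the leading term \<open>- d * \<phi> ^ (2 * m)\<close> would
  make \<open>P\<close> positive near 0, although \<open>P\<close> starts at 0 and does not
  increase.\<close>

lemma d_pos: "0 < d"
proof (rule ccontr)
  assume "\<not> 0 < d"
  then have neg: "d < 0"
    using d_nonzero by simp
  obtain C where C: "0 \<le> C" "\<And>\<phi>. \<bar>\<phi>\<bar> \<le> pi \<Longrightarrow> \<bar>P \<phi> + d * \<phi> ^ (2 * m)\<bar> \<le> C * \<bar>\<phi>\<bar> ^ (2 * m + 1)"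
    using P_taylor by blast
  define x where "x = min pi (- d / (2 * (C + 1)))"
  have x: "0 < x" "x \<le> pi" "(C + 1) * x \<le> - d / 2"
  proof -
    have "x \<le> - d / (2 * (C + 1))"
      by (simp add: x_def)
    then show "(C + 1) * x \<le> - d / 2"
      using C(1) by (simp add: field_simps)
    show "0 < x"
      using neg C(1) by (simp add: x_def divide_neg_pos)
  qed (simp add: x_def)
  have "P x \<le> 0"
    using P_antimono[of 0 x] x P_zero by simp
  then have "- d * x ^ (2 * m) \<le> C * x ^ (2 * m + 1)"
    using C(2)[of x] x by (simp add: abs_le_iff)
  then have "- d * x ^ (2 * m) \<le> (C * x) * x ^ (2 * m)"
    by (simp add: mult_ac)
  then have "- d \<le> C * x"
    by (rule mult_right_le_imp_le) (use x in simp)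
  also have "\<dots> \<le> - d / 2"
    using x by (simp add: algebra_simps)
  finally show False
    using neg by simp
qed

lemma P_upper:
  obtains c where "0 < c" "\<And>\<phi>. \<bar>\<phi>\<bar> \<le> pi \<Longrightarrow> P \<phi> \<le> - c * \<phi> ^ (2 * m)"
proof -
  obtain C where C: "0 \<le> C" "\<And>\<phi>. \<bar>\<phi>\<bar> \<le> pi \<Longrightarrow> \<bar>P \<phi> + d * \<phi> ^ (2 * m)\<bar> \<le> C * \<bar>\<phi>\<bar> ^ (2 * m + 1)"
    using P_taylor by blast
  define x where "x = min pi (d / (2 * (C + 1)))"
  have x: "0 < x" "x \<le> pi" "(C + 1) * x \<le> d / 2"
  proof -
    have "x \<le> d / (2 * (C + 1))"
      by (simp add: x_def)
    then show "(C + 1) * x \<le> d / 2"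
      using C(1) by (simp add: field_simps)
  qed (use d_pos C(1) in \<open>auto simp: x_def\<close>)
  have near: "P \<phi> \<le> - (d / 2) * \<phi> ^ (2 * m)" if "0 \<le> \<phi>" "\<phi> \<le> x" for \<phi>
  proof -
    have "P \<phi> \<le> - d * \<phi> ^ (2 * m) + C * \<phi> ^ (2 * m + 1)"
      using C(2)[of \<phi>] that x by (simp add: abs_le_iff)
    also have "\<dots> = - d * \<phi> ^ (2 * m) + (C * \<phi>) * \<phi> ^ (2 * m)"
      by (simp add: mult_ac)
    also have "(C * \<phi>) * \<phi> ^ (2 * m) \<le> (d / 2) * \<phi> ^ (2 * m)"
    proof (rule mult_right_mono)
      have "C * \<phi> \<le> (C + 1) * x"
        using that C(1) by (intro mult_mono) auto
      then show "C * \<phi> \<le> d / 2"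
        using x by simp
    qed (use that in simp)
    finally show ?thesis
      by (simp add: field_simps)
  qed
  \<comment> \<open>Beyond \<open>x\<close> only \<open>P \<phi> \<le> P x\<close> is known. The
    factor spreads the bound at \<open>x\<close> over the interval up to \<open>pi\<close>, and
    being at most 1 it is harmless near 0.\<close>
  define c where "c = (d / 2) * (x / pi) ^ (2 * m)"
  have c: "0 < c" "c \<le> d / 2"
    using d_pos x power_le_one[of "x / pi" "2 * m"] by (auto simp: c_def mult_le_cancel_left2)
  have pos: "P \<phi> \<le> - c * \<phi> ^ (2 * m)" if "0 \<le> \<phi>" "\<phi> \<le> pi" for \<phi>
  proof (cases "\<phi> \<le> x")
    case True
    have "- (d / 2) * \<phi> ^ (2 * m) \<le> - c * \<phi> ^ (2 * m)"
      using c that by (intro mult_right_mono) auto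
    then show ?thesis
      using near[of \<phi>] that True by simp
  next
    case False
    have "P \<phi> \<le> P x"
      using P_antimono[of x \<phi>] False that x by simp
    also have "\<dots> \<le> - (d / 2) * x ^ (2 * m)"
      using near[of x] x by simp
    also have "\<dots> = - c * pi ^ (2 * m)"
      by (simp add: c_def power_divide)
    also have "\<dots> \<le> - c * \<phi> ^ (2 * m)"
      using c that by (simp add: power_mono)
    finally show ?thesis .
  qed
  show ?thesis
  proof (rule that[OF c(1)])
    fix \<phi> :: real assume "\<bar>\<phi>\<bar> \<le> pi"
    then show "P \<phi> \<le> - c * \<phi> ^ (2 * m)"
      using pos[of \<phi>] pos[of "- \<phi>"] by (cases "0 \<le> \<phi>") (auto simp: P_even)
  qed
qed

text \<open>A sine sum with derivative \<open>P + b\<close> vanishes at both 0 and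
  \<open>pi\<close>, so \<open>P = - b\<close> at some interior point, where \<open>P\<close> is
  negative.\<close>

lemma b_pos: "0 < b"
proof -
  obtain c where c: "0 < c" "\<And>\<phi>. \<bar>\<phi>\<bar> \<le> pi \<Longrightarrow> P \<phi> \<le> - c * \<phi> ^ (2 * m)"
    using P_upper by blast
  let ?f = "\<lambda>\<phi>. 2 * (\<Sum>r\<in>S. \<gamma> r * sin (real r * \<phi>))"
  have der: "(?f has_real_derivative P \<phi> + b) (at \<phi>)" for \<phi>
    unfolding P_def by (auto intro!: derivative_eq_intros sum.cong simp: mult_ac)
  have "\<exists>z>0. z < pi \<and> ?f pi - ?f 0 = (pi - 0) * (P z + b)"
    by (intro MVT2 der) simp
  moreover have "?f pi - ?f 0 = 0"
    by simp
  ultimately obtain z where z: "0 < z" "z < pi" "P z + b = 0"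
    by auto
  have "P z \<le> - c * z ^ (2 * m)"
    using c(2)[of z] z by simp
  also have "\<dots> < 0"
    using c z by simp
  finally show ?thesis
    using z by simp
qed

text \<open>On the imaginary axis the phase has real part 0. Two mean value steps along a horizontal
  segment give the decay from \<open>P\<close> and a second-order error from
  \<open>H_second\<close>.\<close>

lemma Re_H_upper:
  obtains c C where "0 < c" "0 \<le> C"
    "\<And>\<rho> \<phi>. 0 < \<rho> \<Longrightarrow> \<rho> \<le> 1 \<Longrightarrow> \<bar>\<phi>\<bar> \<le> pi \<Longrightarrow>
       Re (H (-1) 0 (Complex \<rho> \<phi>)) - b * \<rho> \<le> \<rho> * (C * \<rho> ^ (2 * m) - c * \<phi> ^ (2 * m))"
proof -
  obtain c where c: "0 < c" "\<And>\<phi>. \<bar>\<phi>\<bar> \<le> pi \<Longrightarrow> P \<phi> \<le> - c * \<phi> ^ (2 * m)"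
    using P_upper by blast
  obtain K where K: "0 \<le> K" "\<And>w. norm w \<le> pi + 1 \<Longrightarrow> norm (H (-1) 2 w) \<le> K * norm w ^ (2 * m - 1)"
    using H_second[of "pi + 1"] by auto
  have deriv: "((\<lambda>x. Re (H \<sigma> e (Complex x \<phi>))) has_real_derivative Re (H (- \<sigma>) (e + 1) (Complex x \<phi>))) (at x)" for \<sigma> e x \<phi>
    unfolding Re_H
    by (auto intro!: derivative_eq_intros sum.cong simp: algebra_simps)
  have zero: "Re (H (-1) e (Complex 0 \<phi>)) = 0" for e \<phi>
    unfolding Re_H by simp
  have first: "Re (H (-1) 0 (Complex \<rho> \<phi>)) - b * \<rho> \<le> \<rho> * (P \<phi> + \<rho> * (K * (\<rho> + \<bar>\<phi>\<bar>) ^ (2 * m - 1)))"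
    if \<rho>: "0 < \<rho>" "\<rho> \<le> 1" and \<phi>: "\<bar>\<phi>\<bar> \<le> pi" for \<rho> \<phi>
  proof -
    have "\<exists>x>0. x < \<rho> \<and> Re (H (-1) 0 (Complex \<rho> \<phi>)) - Re (H (-1) 0 (Complex 0 \<phi>)) = (\<rho> - 0) * Re (H (- (-1)) (0 + 1) (Complex x \<phi>))"
      by (intro MVT2 deriv \<rho>)
    then obtain x where x: "0 < x" "x < \<rho>" "Re (H (-1) 0 (Complex \<rho> \<phi>)) = \<rho> * Re (H 1 1 (Complex x \<phi>))"
      by (auto simp: zero)
    have "\<exists>y>0. y < x \<and> Re (H 1 1 (Complex x \<phi>)) - Re (H 1 1 (Complex 0 \<phi>)) = (x - 0) * Re (H (- 1) (1 + 1) (Complex y \<phi>))"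
      by (intro MVT2 deriv x)
    then obtain y where y: "0 < y" "y < x" "Re (H 1 1 (Complex x \<phi>)) = P \<phi> + b + x * Re (H (-1) 2 (Complex y \<phi>))"
      by (auto simp: P_eq_H numeral_2_eq_2 algebra_simps)
    have n: "norm (Complex y \<phi>) \<le> \<rho> + \<bar>\<phi>\<bar>"
      using cmod_le[of "Complex y \<phi>"] x y by simp
    have "Re (H (-1) 2 (Complex y \<phi>)) \<le> norm (H (-1) 2 (Complex y \<phi>))"
      by (rule complex_Re_le_cmod)
    also have "\<dots> \<le> K * norm (Complex y \<phi>) ^ (2 * m - 1)"
      using n \<rho> \<phi> by (intro K) simp
    also have "\<dots> \<le> K * (\<rho> + \<bar>\<phi>\<bar>) ^ (2 * m - 1)"
      using K n by (intro mult_left_mono power_mono) auto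
    finally have R: "Re (H (-1) 2 (Complex y \<phi>)) \<le> K * (\<rho> + \<bar>\<phi>\<bar>) ^ (2 * m - 1)" .
    have "x * Re (H (-1) 2 (Complex y \<phi>)) \<le> x * (K * (\<rho> + \<bar>\<phi>\<bar>) ^ (2 * m - 1))"
      using R x by (intro mult_left_mono) auto
    also have "\<dots> \<le> \<rho> * (K * (\<rho> + \<bar>\<phi>\<bar>) ^ (2 * m - 1))"
      using x K by (intro mult_right_mono) auto
    finally have "Re (H 1 1 (Complex x \<phi>)) \<le> b + (P \<phi> + \<rho> * (K * (\<rho> + \<bar>\<phi>\<bar>) ^ (2 * m - 1)))"
      using y by simp
    then have "\<rho> * Re (H 1 1 (Complex x \<phi>)) \<le> \<rho> * (b + (P \<phi> + \<rho> * (K * (\<rho> + \<bar>\<phi>\<bar>) ^ (2 * m - 1))))"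
      using \<rho> by (intro mult_left_mono) auto
    then show ?thesis
      using x by (simp add: algebra_simps)
  qed
  \<comment> \<open>Chosen so that for \<open>\<rho> \<le> \<kappa> * \<bar>\<phi>\<bar>\<close> the
    error takes at most half of the decay; \<open>K + 1\<close> avoids division by 0.\<close>
  define \<kappa> where "\<kappa> = min 1 (c / (2 * (K + 1) * 2 ^ (2 * m - 1)))"
  have \<kappa>: "0 < \<kappa>" "\<kappa> \<le> 1" "K * \<kappa> * 2 ^ (2 * m - 1) \<le> c / 2"
  proof -
    show "0 < \<kappa>"
      using c K by (simp add: \<kappa>_def)
    have "\<kappa> \<le> c / (2 * (K + 1) * 2 ^ (2 * m - 1))"
      by (simp add: \<kappa>_def)
    moreover have "0 < 2 * (K + 1) * 2 ^ (2 * m - 1)"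
      using K(1) by simp
    ultimately have "\<kappa> * (2 * (K + 1) * 2 ^ (2 * m - 1)) \<le> c"
      by (simp only: pos_le_divide_eq)
    moreover have "(K + 1) * \<kappa> * 2 ^ (2 * m - 1) = \<kappa> * (2 * (K + 1) * 2 ^ (2 * m - 1)) / 2"
      by simp
    ultimately have "(K + 1) * \<kappa> * 2 ^ (2 * m - 1) \<le> c / 2"
      by linarith
    moreover have "K * \<kappa> * 2 ^ (2 * m - 1) \<le> (K + 1) * \<kappa> * 2 ^ (2 * m - 1)"
      using \<open>0 < \<kappa>\<close> by (intro mult_right_mono) auto
    ultimately show "K * \<kappa> * 2 ^ (2 * m - 1) \<le> c / 2"
      by simp
  qed (simp add: \<kappa>_def)
  define C where "C = K * (1 + 1 / \<kappa>) ^ (2 * m - 1)"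
  have C: "0 \<le> C"
    using K \<kappa> by (simp add: C_def)
  \<comment> \<open>Either \<open>\<phi>\<close> dominates and half of the decay absorbs the error,
    or \<open>\<bar>\<phi>\<bar>\<close> is below \<open>\<rho> / \<kappa>\<close> and the error is
    a multiple of \<open>\<rho> ^ (2 * m)\<close>.\<close>
  have young: "\<rho> * (K * (\<rho> + \<bar>\<phi>\<bar>) ^ (2 * m - 1)) \<le> (c / 2) * \<phi> ^ (2 * m) + C * \<rho> ^ (2 * m)"
    if \<rho>: "0 < \<rho>" for \<rho> \<phi>
  proof (cases "\<rho> \<le> \<kappa> * \<bar>\<phi>\<bar>")
    case True
    have "\<rho> + \<bar>\<phi>\<bar> \<le> 2 * \<bar>\<phi>\<bar>"
      using True \<kappa> mult_right_mono[of \<kappa> 1 "\<bar>\<phi>\<bar>"] by simp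
    then have "\<rho> * (K * (\<rho> + \<bar>\<phi>\<bar>) ^ (2 * m - 1)) \<le> (\<kappa> * \<bar>\<phi>\<bar>) * (K * (2 * \<bar>\<phi>\<bar>) ^ (2 * m - 1))"
      using True \<rho> K \<kappa> by (intro mult_mono power_mono) auto
    also have "\<dots> = (K * \<kappa> * 2 ^ (2 * m - 1)) * (\<bar>\<phi>\<bar> * \<bar>\<phi>\<bar> ^ (2 * m - 1))"
      by (simp add: power_mult_distrib mult_ac)
    also have "\<bar>\<phi>\<bar> * \<bar>\<phi>\<bar> ^ (2 * m - 1) = \<phi> ^ (2 * m)"
      using m_pos power_eq_if[of "\<bar>\<phi>\<bar>" "2 * m"] by (simp add: power_even_abs)
    also have "(K * \<kappa> * 2 ^ (2 * m - 1)) * \<phi> ^ (2 * m) \<le> (c / 2) * \<phi> ^ (2 * m)"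
      using \<kappa> by (intro mult_right_mono) (auto simp: power_mult)
    finally show ?thesis
      using C \<rho> by (simp add: add_increasing2)
  next
    case False
    then have "\<rho> + \<bar>\<phi>\<bar> \<le> (1 + 1 / \<kappa>) * \<rho>"
      using \<kappa> by (simp add: field_simps)
    then have "\<rho> * (K * (\<rho> + \<bar>\<phi>\<bar>) ^ (2 * m - 1)) \<le> \<rho> * (K * ((1 + 1 / \<kappa>) * \<rho>) ^ (2 * m - 1))"
      using \<rho> K by (intro mult_left_mono power_mono) auto
    also have "\<dots> = C * (\<rho> * \<rho> ^ (2 * m - 1))"
      by (simp add: C_def power_mult_distrib mult_ac)
    also have "\<rho> * \<rho> ^ (2 * m - 1) = \<rho> ^ (2 * m)"
      using m_pos power_eq_if[of \<rho> "2 * m"] by simp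
    finally show ?thesis
      using c by (simp add: add_increasing power_mult)
  qed
  show ?thesis
  proof (rule that[of "c / 2" C])
    fix \<rho> \<phi> :: real assume a: "0 < \<rho>" "\<rho> \<le> 1" "\<bar>\<phi>\<bar> \<le> pi"
    have "P \<phi> + \<rho> * (K * (\<rho> + \<bar>\<phi>\<bar>) ^ (2 * m - 1)) \<le> C * \<rho> ^ (2 * m) - c / 2 * \<phi> ^ (2 * m)"
      using c(2)[OF a(3)] young[OF a(1), of \<phi>] by (simp add: field_simps)
    then have "\<rho> * (P \<phi> + \<rho> * (K * (\<rho> + \<bar>\<phi>\<bar>) ^ (2 * m - 1))) \<le> \<rho> * (C * \<rho> ^ (2 * m) - c / 2 * \<phi> ^ (2 * m))"
      using a by (intro mult_left_mono) auto
    then show "Re (H (-1) 0 (Complex \<rho> \<phi>)) - b * \<rho> \<le> \<rho> * (C * \<rho> ^ (2 * m) - c / 2 * \<phi> ^ (2 * m))"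
      using first[OF a] by simp
  qed (use c C in auto)
qed

end

section \<open>Fourier representation\<close>

lemma set_lebesgue_integral_sums:
  fixes g :: "real \<Rightarrow> complex" and e :: "nat \<Rightarrow> real \<Rightarrow> complex" and c :: "nat \<Rightarrow> complex"
  assumes g: "continuous_on {\<alpha>..\<beta>} g" and e: "\<And>k. continuous_on {\<alpha>..\<beta>} (e k)"
    and e_le: "\<And>k x. x \<in> {\<alpha>..\<beta>} \<Longrightarrow> norm (e k x) \<le> 1"
    and c: "summable (\<lambda>k. norm (c k))" and S: "\<And>x. x \<in> {\<alpha>..\<beta>} \<Longrightarrow> (\<lambda>k. c k * e k x) sums S x"
  shows "(\<lambda>k. c k * (LINT x:{\<alpha>..\<beta>}|lborel. g x * e k x)) sums (LINT x:{\<alpha>..\<beta>}|lborel. g x * S x)"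
proof -
  let ?A = "{\<alpha>..\<beta>}"
  obtain G where G: "\<And>x. x \<in> ?A \<Longrightarrow> norm (g x) \<le> G"
  proof -
    have "bounded (g ` ?A)"
      by (intro compact_imp_bounded compact_continuous_image g) simp
    then obtain B where "\<forall>y\<in>g ` ?A. norm y \<le> B"
      unfolding bounded_iff by blast
    then show ?thesis
      by (intro that[of B]) simp
  qed
  let ?f = "\<lambda>k x. indicator ?A x *\<^sub>R (c k * (g x * e k x))"
  have int: "set_integrable lborel ?A (\<lambda>x. c k * (g x * e k x))" for k
    by (intro borel_integrable_atLeastAtMost' continuous_intros g e)
  have le: "norm (?f k x) \<le> indicator ?A x *\<^sub>R (norm (c k) * \<bar>G\<bar>)" for k x
  proof (cases "x \<in> ?A")
    case True
    have "norm (g x * e k x) \<le> \<bar>G\<bar> * 1"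
      unfolding norm_mult using G[OF True] e_le[OF True] by (intro mult_mono) auto
    then show ?thesis
      using True by (simp add: norm_mult mult_left_mono)
  qed simp
  have "(\<lambda>k. integral\<^sup>L lborel (?f k)) sums (\<integral>x. (\<Sum>k. ?f k x) \<partial>lborel)"
  proof (rule sums_integral)
    show "integrable lborel (?f k)" for k
      using int[of k] by (simp add: set_integrable_def)
    show "AE x in lborel. summable (\<lambda>k. norm (?f k x))"
    proof (rule AE_I2)
      fix x
      show "summable (\<lambda>k. norm (?f k x))"
        by (rule summable_comparison_test'[where g = "\<lambda>k. norm (c k) * \<bar>G\<bar>" and N = 0])
          (use le[where x = x] c in \<open>auto intro: summable_mult2 order_trans simp: indicator_def split: if_splits\<close>)
    qed
    show "summable (\<lambda>k. \<integral>x. norm (?f k x) \<partial>lborel)"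
    proof (rule summable_comparison_test'[where N = 0])
      show "summable (\<lambda>k. norm (c k) * (\<bar>G\<bar> * measure lborel ?A))"
        using c by (rule summable_mult2)
      fix k
      have "(\<integral>x. norm (?f k x) \<partial>lborel) \<le> (\<integral>x. indicator ?A x *\<^sub>R (norm (c k) * \<bar>G\<bar>) \<partial>lborel)"
      proof (rule integral_mono)
        show "integrable lborel (\<lambda>x. norm (?f k x))"
          using int[of k] unfolding set_integrable_def by (rule integrable_norm)
        show "integrable lborel (\<lambda>x. indicator ?A x *\<^sub>R (norm (c k) * \<bar>G\<bar>))"
          using borel_integrable_atLeastAtMost'[of \<alpha> \<beta> "\<lambda>_. norm (c k) * \<bar>G\<bar>"] by (simp add: set_integrable_def)
      qed (rule le)
      also have "\<dots> = norm (c k) * (\<bar>G\<bar> * measure lborel ?A)"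
        by simp
      finally show "norm (\<integral>x. norm (?f k x) \<partial>lborel) \<le> norm (c k) * (\<bar>G\<bar> * measure lborel ?A)"
        by simp
    qed
  qed
  moreover have "(\<Sum>k. ?f k x) = indicator ?A x *\<^sub>R (g x * S x)" for x
  proof (cases "x \<in> ?A")
    case True
    then have "(\<lambda>k. ?f k x) sums (g x * S x)"
      using sums_mult[OF S[OF True], of "g x"] by (simp add: mult_ac)
    then show ?thesis
      using True by (simp add: sums_iff)
  qed simp
  moreover have "integral\<^sup>L lborel (?f k) = c k * (LINT x:?A|lborel. g x * e k x)" for k
    unfolding set_lebesgue_integral_def by (subst integral_mult_right_zero[symmetric]) (simp add: mult_ac scaleR_conv_of_real)
  ultimately show ?thesis
    by (simp add: set_lebesgue_integral_def)
qed

lemma integral_exp_int: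
  fixes j :: int
  shows "(LINT \<phi>:{-pi..pi}|lborel. exp (\<i> * of_int j * of_real \<phi>)) = (if j = 0 then of_real (2 * pi) else 0)"
proof (cases "j = 0")
  case True
  have "(LINT \<phi>:{-pi..pi}|lborel. (1 :: complex)) = of_real (2 * pi)"
    by (simp add: set_lebesgue_integral_def scaleR_conv_of_real flip: of_real_mult)
  then show ?thesis
    using True by simp
next
  case False
  let ?F = "\<lambda>\<phi>::real. exp (\<i> * of_int j * of_real \<phi>) / (\<i> * of_int j)"
  have "(LINT \<phi>:{-pi..pi}|lborel. exp (\<i> * of_int j * of_real \<phi>)) = ?F pi - ?F (-pi)"
    unfolding set_lebesgue_integral_def
  proof (rule integral_FTC_atLeastAtMost)
    fix x :: real
    have "((\<lambda>z. exp (\<i> * of_int j * z) / (\<i> * of_int j)) has_field_derivative exp (\<i> * of_int j * of_real x)) (at (of_real x))"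
      using False by (auto intro!: derivative_eq_intros)
    then show "(?F has_vector_derivative exp (\<i> * of_int j * of_real x)) (at x within {-pi..pi})"
      using has_vector_derivative_real_field has_vector_derivative_at_within by blast
  qed (auto intro!: continuous_intros)
  moreover have "exp (\<i> * of_int j * of_real pi) = exp (\<i> * of_int j * of_real (- pi))"
  proof -
    have "exp (\<i> * of_int j * of_real pi) = exp (\<i> * of_int j * of_real (- pi)) * exp (2 * of_int j * of_real pi * \<i>)"
      unfolding exp_add[symmetric] by (rule arg_cong[of _ _ exp]) (simp add: algebra_simps)
    also have "exp (2 * of_int j * of_real pi * \<i>) = 1"
      using exp_integer_2pi[of "of_int j"] by (simp add: mult_ac)
    finally show ?thesis by simp
  qed
  ultimately show ?thesis
    using False by simp
qed

context finite_times
begin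

text \<open>Logarithmic coordinate \<open>z = exp w\<close>: the circle of radius
  \<open>exp \<rho>\<close> becomes the segment \<open>Complex \<rho> \<phi>\<close> with
  \<open>\<bar>\<phi>\<bar> \<le> pi\<close>.\<close>

definition phase :: "complex \<Rightarrow> complex" where
  "phase w = (\<Sum>r\<in>supp t. of_real (t r) * exp (of_nat r * w))"

lemma exp_coeff_sums:
  "(\<lambda>k. of_real (exp_coeff t s k) * exp (of_nat k * w)) sums exp (of_real s * phase w)"
proof -
  define q where "q z = (\<Sum>r\<in>supp t. of_real (t r) * z ^ r)" for z :: complex
  define Q where "Q = (\<Sum>r\<in>supp t. fps_const (complex_of_real (t r)) * fps_X ^ r)"
  have Q_nth: "fps_nth Q k = of_real (fps_nth a k)" for k
  proof -
    have "fps_nth Q k = (\<Sum>r\<in>supp t. if r = k then of_real (t r) else 0)"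
      unfolding Q_def fps_sum_nth by (intro sum.cong refl) (auto simp: fps_X_power_nth)
    also have "\<dots> = (if k \<in> supp t then of_real (t k) else 0)"
      using finite_supp by simp
    finally show ?thesis
      by (simp add: a_nth)
  qed
  \<comment> \<open>The real coefficients are transferred to a complex power series, whose sum is
    entire, so the expansion converges at every \<open>exp w\<close>.\<close>
  have pow: "fps_nth (Q ^ i) k = of_real (fps_nth (a ^ i) k)" for i k
    by (induction i arbitrary: k) (simp_all add: fps_mult_nth Q_nth)
  have "q has_fps_expansion Q"
    unfolding q_def Q_def by (intro fps_expansion_intros)
  moreover have "fps_nth Q 0 = 0"
    by (simp add: Q_nth)
  ultimately have "((\<lambda>z. exp (of_real s * z)) \<circ> q) has_fps_expansion fps_compose (fps_exp (of_real s)) Q"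
    by (intro has_fps_expansion_compose has_fps_expansion_exp)
  then have "(\<lambda>k. fps_nth (fps_compose (fps_exp (of_real s)) Q) k * exp w ^ k) sums ((\<lambda>z. exp (of_real s * z)) \<circ> q) (exp w)"
    by (rule has_fps_expansion_imp_sums_complex[where r = "\<infinity>"])
       (auto simp: q_def o_def intro!: holomorphic_intros)
  moreover have "fps_nth (fps_compose (fps_exp (of_real s)) Q) k = of_real (exp_coeff t s k)" for k
    by (simp add: fps_compose_nth exp_coeff_eq_sum pow atMost_atLeast0)
  moreover have "q (exp w) = phase w"
    by (simp add: q_def phase_def exp_of_nat_mult)
  ultimately show ?thesis
    by (simp add: exp_of_nat_mult)
qed

lemma phase_continuous: "continuous_on X (\<lambda>\<phi>. phase (Complex \<rho> \<phi>))" "continuous_on X (\<lambda>\<phi>. phase (- Complex \<rho> \<phi>))"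
  unfolding phase_def Complex_eq by (intro continuous_intros)+

lemma summable_exp_coeff_exp: "summable (\<lambda>k. norm (of_real (exp_coeff t s k) * of_real (exp (real k * \<rho>)) :: complex))"
proof -
  \<comment> \<open>This makes \<open>q * exp \<rho>\<close> at most \<open>1 / 2\<close>, so the
    series converges on the circle whatever the sign of \<open>\<rho>\<close>.\<close>
  define q where "q = exp (- \<bar>\<rho>\<bar>) / 2"
  have q: "0 < q" "q < 1"
  proof -
    have "exp (- \<bar>\<rho>\<bar>) \<le> 1"
      by simp
    then show "q < 1"
      unfolding q_def by linarith
  qed (simp add: q_def)
  have qe: "\<bar>q * exp \<rho>\<bar> < 1"
  proof -
    have "exp (- \<bar>\<rho>\<bar>) * exp \<rho> \<le> 1"
      unfolding exp_add[symmetric] by simp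
    then show ?thesis
      by (simp add: q_def abs_mult)
  qed
  obtain C where C: "0 \<le> C" "\<And>n. \<bar>exp_coeff t s n\<bar> \<le> C * q ^ n"
    using fast_decayE[OF fast_decay_exp_coeff q] by blast
  show ?thesis
  proof (rule summable_comparison_test'[where N = 0])
    show "summable (\<lambda>k. C * (q * exp \<rho>) ^ k)"
      using qe by (intro summable_mult summable_geometric) simp
    fix k
    have "\<bar>exp_coeff t s k\<bar> * exp (real k * \<rho>) \<le> (C * q ^ k) * exp (real k * \<rho>)"
      using C by (intro mult_right_mono) auto
    then show "norm (norm (of_real (exp_coeff t s k) * of_real (exp (real k * \<rho>)) :: complex)) \<le> C * (q * exp \<rho>) ^ k"
      by (simp add: norm_mult norm_power exp_of_nat_mult power_mult_distrib)
  qed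
qed

lemma exp_Complex_split: "exp (of_nat k * Complex \<rho> \<phi>) = of_real (exp (real k * \<rho>)) * exp (\<i> * of_nat k * of_real \<phi>)"
  by (simp add: Complex_eq exp_add[symmetric] exp_of_real[symmetric] algebra_simps)

lemma v_fourier:
  "(LINT \<phi>:{-pi..pi}|lborel. exp (- (\<i> * of_nat j * of_real \<phi>)) * exp (phase (Complex \<rho> \<phi>)))
    = of_real (2 * pi * v j * exp (real j * \<rho>))"
proof -
  let ?g = "\<lambda>\<phi>::real. exp (- (\<i> * of_nat j * of_real \<phi>))"
  let ?c = "\<lambda>k. of_real (v k) * of_real (exp (real k * \<rho>)) :: complex"
  have "(\<lambda>k. ?c k * (LINT \<phi>:{-pi..pi}|lborel. ?g \<phi> * exp (\<i> * of_nat k * of_real \<phi>)))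
      sums (LINT \<phi>:{-pi..pi}|lborel. ?g \<phi> * exp (phase (Complex \<rho> \<phi>)))"
  proof (rule set_lebesgue_integral_sums)
    show "summable (\<lambda>k. norm (?c k))"
      by (rule summable_exp_coeff_exp)
    show "(\<lambda>k. ?c k * exp (\<i> * of_nat k * of_real \<phi>)) sums exp (phase (Complex \<rho> \<phi>))" for \<phi>
      using exp_coeff_sums[of 1 "Complex \<rho> \<phi>"] by (simp add: exp_Complex_split mult.assoc)
  qed (auto intro!: continuous_intros)
  moreover have "(LINT \<phi>:{-pi..pi}|lborel. ?g \<phi> * exp (\<i> * of_nat k * of_real \<phi>)) = (if k = j then of_real (2 * pi) else 0)" for k
  proof -
    have "?g \<phi> * exp (\<i> * of_nat k * of_real \<phi>) = exp (\<i> * of_int (int k - int j) * of_real \<phi>)" for \<phi>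
      unfolding exp_add[symmetric] by (rule arg_cong[of _ _ exp]) (simp add: algebra_simps)
    then show ?thesis
      by (simp add: integral_exp_int del: of_int_diff)
  qed
  ultimately have "(\<lambda>k. ?c k * (if k = j then of_real (2 * pi) else 0)) sums (LINT \<phi>:{-pi..pi}|lborel. ?g \<phi> * exp (phase (Complex \<rho> \<phi>)))"
    by simp
  moreover have "(\<lambda>k. ?c k * (if k = j then of_real (2 * pi) else 0)) sums (?c j * of_real (2 * pi))"
    using sums_single[of j "\<lambda>k. ?c k * of_real (2 * pi)"] by (simp add: if_distrib cong: if_cong)
  ultimately have "(LINT \<phi>:{-pi..pi}|lborel. ?g \<phi> * exp (phase (Complex \<rho> \<phi>))) = ?c j * of_real (2 * pi)"
    by (rule sums_unique2)
  then show ?thesis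
    by (simp add: mult_ac)
qed

lemma J_sums: "(\<lambda>p. u p * v (p + n)) sums J n"
proof -
  obtain c where c: "\<And>F. finite F \<Longrightarrow> (\<Sum>k\<in>F. \<bar>v k\<bar>) \<le> c"
    using fast_decay_sum_bound[OF fast_decay_exp_coeff] by blast
  have "(\<lambda>p. u p * v (p + n)) summable_on UNIV"
    using c[of "{_}"] by (intro abs_summable_mult_bounded(2)[OF fast_decay_summable[OF fast_decay_exp_coeff]]) auto
  then show ?thesis
    unfolding J_def correlation_def by (intro has_sum_imp_sums has_sum_infsum)
qed

text \<open>Only the factor with \<open>phase (- w)\<close> is expanded. \<open>v_fourier\<close>
  integrates the rest, which reproduces the series of \<open>J n\<close> without a double
  sum.\<close>

lemma J_fourier:
  "of_real (2 * pi * J n) = (LINT \<phi>:{-pi..pi}|lborel.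
     exp (phase (Complex \<rho> \<phi>) - phase (- Complex \<rho> \<phi>) - of_nat n * Complex \<rho> \<phi>))"
proof -
  let ?g = "\<lambda>\<phi>::real. exp (- (\<i> * of_nat n * of_real \<phi>)) * exp (phase (Complex \<rho> \<phi>))"
  let ?c = "\<lambda>p. of_real (u p) * of_real (exp (real p * (- \<rho>))) :: complex"
  have "(\<lambda>p. ?c p * (LINT \<phi>:{-pi..pi}|lborel. ?g \<phi> * exp (- (\<i> * of_nat p * of_real \<phi>))))
      sums (LINT \<phi>:{-pi..pi}|lborel. ?g \<phi> * exp (- phase (- Complex \<rho> \<phi>)))"
  proof (rule set_lebesgue_integral_sums)
    show "continuous_on {-pi..pi} ?g"
      by (intro continuous_intros phase_continuous)
    show "summable (\<lambda>p. norm (?c p))"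
      by (rule summable_exp_coeff_exp)
    fix \<phi>
    have "- Complex \<rho> \<phi> = Complex (- \<rho>) (- \<phi>)"
      by (simp add: complex_eq_iff)
    then show "(\<lambda>p. ?c p * exp (- (\<i> * of_nat p * of_real \<phi>))) sums exp (- phase (- Complex \<rho> \<phi>))"
      using exp_coeff_sums[of "-1" "- Complex \<rho> \<phi>"] by (simp add: exp_Complex_split mult.assoc)
  qed (auto intro!: continuous_intros)
  moreover have "?c p * (LINT \<phi>:{-pi..pi}|lborel. ?g \<phi> * exp (- (\<i> * of_nat p * of_real \<phi>)))
     = of_real (2 * pi * exp (real n * \<rho>) * (u p * v (p + n)))" for p
  proof -
    have "?g \<phi> * exp (- (\<i> * of_nat p * of_real \<phi>)) = exp (- (\<i> * of_nat (p + n) * of_real \<phi>)) * exp (phase (Complex \<rho> \<phi>))" for \<phi>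
      unfolding exp_add[symmetric] by (rule arg_cong[of _ _ exp]) (simp add: algebra_simps)
    then have "(LINT \<phi>:{-pi..pi}|lborel. ?g \<phi> * exp (- (\<i> * of_nat p * of_real \<phi>))) = of_real (2 * pi * v (p + n) * exp (real (p + n) * \<rho>))"
      by (simp only: v_fourier)
    moreover have "exp (real (p + n) * \<rho>) * exp (real p * (- \<rho>)) = exp (real n * \<rho>)"
      unfolding exp_add[symmetric] by (rule arg_cong[of _ _ exp]) (simp add: algebra_simps)
    ultimately show ?thesis
      by (simp only: of_real_mult[symmetric]) (simp only: mult_ac)
  qed
  ultimately have "(\<lambda>p. of_real (2 * pi * exp (real n * \<rho>) * (u p * v (p + n))))
      sums (LINT \<phi>:{-pi..pi}|lborel. ?g \<phi> * exp (- phase (- Complex \<rho> \<phi>)))"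
    by (simp only:)
  moreover have "(\<lambda>p. of_real (2 * pi * exp (real n * \<rho>) * (u p * v (p + n)))) sums complex_of_real (2 * pi * exp (real n * \<rho>) * J n)"
    by (intro sums_of_real sums_mult J_sums)
  ultimately have "complex_of_real (2 * pi * exp (real n * \<rho>) * J n) = (LINT \<phi>:{-pi..pi}|lborel. ?g \<phi> * exp (- phase (- Complex \<rho> \<phi>)))"
    using sums_unique2 by blast
  \<comment> \<open>The modulus of \<open>exp (- n w)\<close> on the contour is put back, so that
    the integrand becomes a single exponential.\<close>
  then have "complex_of_real (exp (- (real n * \<rho>))) * complex_of_real (2 * pi * exp (real n * \<rho>) * J n)
      = (LINT \<phi>:{-pi..pi}|lborel. complex_of_real (exp (- (real n * \<rho>))) * (?g \<phi> * exp (- phase (- Complex \<rho> \<phi>))))"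
    by (simp only: set_integral_mult_right)
  moreover have "complex_of_real (exp (- (real n * \<rho>))) * complex_of_real (2 * pi * exp (real n * \<rho>) * J n) = complex_of_real (2 * pi * J n)"
    unfolding of_real_mult[symmetric] by (rule arg_cong[of _ _ complex_of_real]) (simp add: exp_minus field_simps)
  moreover have "complex_of_real (exp (- (real n * \<rho>))) * (?g \<phi> * exp (- phase (- Complex \<rho> \<phi>)))
     = exp (phase (Complex \<rho> \<phi>) - phase (- Complex \<rho> \<phi>) - of_nat n * Complex \<rho> \<phi>)" for \<phi>
    unfolding exp_of_real[symmetric] exp_add[symmetric]
    by (rule arg_cong[of _ _ exp]) (simp add: Complex_eq algebra_simps)
  ultimately show ?thesis
    by simp
qed

end

lemma integrable_exp_neg_even_power:
  fixes c :: real
  assumes "0 < c" "1 \<le> m"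
  shows "integrable lborel (\<lambda>u. exp (- c * u ^ (2 * m)))"
proof (rule Bochner_Integration.integrable_bound)
  define \<sigma> where "\<sigma> = 1 / sqrt (2 * c)"
  have \<sigma>: "2 * \<sigma>\<^sup>2 = 1 / c"
    using assms by (simp add: \<sigma>_def power_divide)
  have \<sigma>_pos: "0 < \<sigma>"
    using assms by (simp add: \<sigma>_def)
  show "integrable lborel (\<lambda>u. exp c * sqrt (2 * pi * \<sigma>\<^sup>2) * normal_density 0 \<sigma> u)"
    using \<sigma>_pos by (intro integrable_mult_right) simp
  show "AE u in lborel. norm (exp (- c * u ^ (2 * m))) \<le> norm (exp c * sqrt (2 * pi * \<sigma>\<^sup>2) * normal_density 0 \<sigma> u)"
  proof (rule AE_I2)
    fix u :: real
    \<comment> \<open>This dominates the integrand by \<open>exp c\<close> times a Gaussian,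
      normalised through \<open>2 * \<sigma>\<^sup>2 = 1 / c\<close>.\<close>
    have "u\<^sup>2 - 1 \<le> u ^ (2 * m)"
    proof (cases "1 \<le> u\<^sup>2")
      case True
      then show ?thesis
        using power_increasing[of 1 m "u\<^sup>2"] assms by (simp add: power_mult)
    next
      case False
      then have "u\<^sup>2 - 1 \<le> 0" by simp
      also have "0 \<le> u ^ (2 * m)"
        by (simp add: power_mult)
      finally show ?thesis .
    qed
    then have "exp (- c * u ^ (2 * m)) \<le> exp (c + - c * u\<^sup>2)"
      using assms mult_left_mono[of "u\<^sup>2 - 1" "u ^ (2 * m)" c] by (simp add: algebra_simps)
    also have "\<dots> = exp c * exp (- u\<^sup>2 / (2 * \<sigma>\<^sup>2))"
    proof -
      have e: "- u\<^sup>2 / (2 * \<sigma>\<^sup>2) = - c * u\<^sup>2"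
        unfolding \<sigma> by simp
      show ?thesis
        unfolding e exp_add ..
    qed
    also have "\<dots> = exp c * sqrt (2 * pi * \<sigma>\<^sup>2) * normal_density 0 \<sigma> u"
      using assms by (simp add: normal_density_def \<sigma>_def)
    finally show "norm (exp (- c * u ^ (2 * m))) \<le> norm (exp c * sqrt (2 * pi * \<sigma>\<^sup>2) * normal_density 0 \<sigma> u)"
      by simp
  qed
qed simp

section \<open>Convergence to the higher-order Airy function\<close>

context multicritical_times
begin

definition rho :: "real \<Rightarrow> real" where
  "rho \<theta> = (d * \<theta>) powr (- 1 / real (2 * m + 1))"

definition Jn :: "real \<Rightarrow> nat \<Rightarrow> real" where
  "Jn \<theta> = correlation (exp_coeff (\<lambda>r. \<theta> * \<gamma> r) (-1)) (exp_coeff (\<lambda>r. \<theta> * \<gamma> r) 1)"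

lemma finite_times_scale: "0 < \<theta> \<Longrightarrow> finite_times (\<lambda>r. \<theta> * \<gamma> r)"
  by unfold_locales (simp add: supp_scale finite_S)

lemma rho_pos: "0 < \<theta> \<Longrightarrow> 0 < rho \<theta>"
  using d_pos by (simp add: rho_def)

lemma rho_power: "0 < \<theta> \<Longrightarrow> d * \<theta> * rho \<theta> ^ (2 * m + 1) = 1"
proof -
  assume "0 < \<theta>"
  then have pos: "0 < d * \<theta>"
    using d_pos by simp
  have "rho \<theta> ^ (2 * m + 1) = (d * \<theta>) powr (- 1 / real (2 * m + 1) * real (2 * m + 1))"
    unfolding rho_def by (subst powr_realpow[symmetric]) (use d_pos \<open>0 < \<theta>\<close> in \<open>simp_all add: powr_powr\<close>)
  also have "\<dots> = (d * \<theta>) powr (- 1)"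
    by simp
  also have "\<dots> = 1 / (d * \<theta>)"
    using pos by (simp add: powr_minus_divide)
  finally show ?thesis
    using d_pos \<open>0 < \<theta>\<close> by simp
qed

lemma rho_le_one: "1 \<le> d * \<theta> \<Longrightarrow> rho \<theta> \<le> 1"
proof -
  assume "1 \<le> d * \<theta>"
  then have "(d * \<theta>) powr (- 1 / real (2 * m + 1)) \<le> (d * \<theta>) powr 0"
    by (intro powr_mono) auto
  moreover have "d \<noteq> 0" "\<theta> \<noteq> 0"
    using \<open>1 \<le> d * \<theta>\<close> by auto
  ultimately show ?thesis
    by (simp add: rho_def)
qed

lemma rho_tendsto:
  assumes "filterlim \<theta> at_top F"
  shows "((\<lambda>k. rho (\<theta> k)) \<longlongrightarrow> 0) F"
proof -
  have "filterlim (\<lambda>k. d * \<theta> k) at_top F"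
    by (rule filterlim_tendsto_pos_mult_at_top[OF tendsto_const d_pos assms])
  then show ?thesis
    unfolding rho_def by (intro tendsto_neg_powr) auto
qed

definition zeta :: "real \<Rightarrow> complex" where
  "zeta u = 1 + \<i> * of_real u"

text \<open>Dividing by \<open>d * \<rho> ^ (2 * m + 1)\<close> is multiplying by
  \<open>\<theta>\<close> when \<open>\<rho> = rho \<theta>\<close>. In this form the function
  depends on \<open>\<rho>\<close> alone.\<close>

definition scaled_phase :: "real \<Rightarrow> real \<Rightarrow> complex" where
  "scaled_phase \<rho> u = (H (-1) 0 (of_real \<rho> * zeta u) - of_real (b * \<rho>) * zeta u) / of_real (d * \<rho> ^ (2 * m + 1))"

definition integrand :: "real \<Rightarrow> real \<Rightarrow> real \<Rightarrow> complex" where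
  "integrand \<rho> x u = indicator {-pi..pi} (\<rho> * u) *\<^sub>R exp (scaled_phase \<rho> u - of_real x * zeta u)"

lemma scale_zeta: "of_real \<rho> * zeta u = Complex \<rho> (\<rho> * u)"
  by (simp add: zeta_def complex_eq_iff)

text \<open>The substitution \<open>\<phi> = \<rho> u\<close> contributes the factor
  \<open>\<rho>\<close>, which explains why \<open>Jn\<close> is divided by
  \<open>rho\<close>.\<close>

lemma Jn_integral:
  assumes "0 < \<theta>"
  shows "of_real (2 * pi * (Jn \<theta> n / rho \<theta>)) = (\<integral>u. integrand (rho \<theta>) (rho \<theta> * (real n - b * \<theta>)) u \<partial>lborel)"
proof -
  interpret ft: finite_times "\<lambda>r. \<theta> * \<gamma> r"
    by (rule finite_times_scale[OF assms])
  let ?\<rho> = "rho \<theta>" and ?x = "rho \<theta> * (real n - b * \<theta>)"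
  have \<rho>: "0 < ?\<rho>"
    by (rule rho_pos[OF assms])
  have \<theta>: "complex_of_real (d * ?\<rho> ^ (2 * m + 1)) = 1 / of_real \<theta>"
  proof -
    have "d * ?\<rho> ^ (2 * m + 1) = 1 / \<theta>"
      using rho_power[OF assms] assms by (simp add: field_simps)
    then show ?thesis
      by simp
  qed
  have ph: "ft.phase w - ft.phase (- w) = of_real \<theta> * H (-1) 0 w" for w
    using assms by (simp add: ft.phase_def H_def supp_scale sum_distrib_left sum_subtractf[symmetric] algebra_simps)
  let ?f = "\<lambda>\<phi>. exp (of_real \<theta> * H (-1) 0 (Complex ?\<rho> \<phi>) - of_nat n * Complex ?\<rho> \<phi>)"
  have "of_real (2 * pi * Jn \<theta> n) = (LINT \<phi>:{-pi..pi}|lborel. ?f \<phi>)"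
    using ft.J_fourier[of n ?\<rho>] by (simp only: ph ft.J_def Jn_def)
  also have "\<dots> = \<bar>?\<rho>\<bar> *\<^sub>R (\<integral>u. indicator {-pi..pi} (0 + ?\<rho> * u) *\<^sub>R ?f (0 + ?\<rho> * u) \<partial>lborel)"
    unfolding set_lebesgue_integral_def using \<rho> by (intro lborel_integral_real_affine) simp
  also have "(\<lambda>u. indicator {-pi..pi} (0 + ?\<rho> * u) *\<^sub>R ?f (0 + ?\<rho> * u)) = integrand ?\<rho> ?x"
  proof
    fix u
    have "of_real \<theta> * H (-1) 0 (Complex ?\<rho> (?\<rho> * u)) - of_nat n * Complex ?\<rho> (?\<rho> * u) = scaled_phase ?\<rho> u - of_real ?x * zeta u"
      unfolding scaled_phase_def \<theta> scale_zeta[symmetric] using assms by (simp add: algebra_simps)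
    then show "indicator {-pi..pi} (0 + ?\<rho> * u) *\<^sub>R ?f (0 + ?\<rho> * u) = integrand ?\<rho> ?x u"
      by (simp add: integrand_def)
  qed
  finally have "of_real (2 * pi * Jn \<theta> n) = ?\<rho> *\<^sub>R (\<integral>u. integrand ?\<rho> ?x u \<partial>lborel)"
    using \<rho> by simp
  then have "(1 / ?\<rho>) *\<^sub>R of_real (2 * pi * Jn \<theta> n) = (\<integral>u. integrand ?\<rho> ?x u \<partial>lborel)"
    using \<rho> by simp
  then show ?thesis
    by (simp add: scaleR_conv_of_real flip: of_real_mult)
qed

text \<open>After division by \<open>d * \<rho> ^ (2 * m + 1)\<close> all powers of
  \<open>\<rho>\<close> in \<open>Re_H_upper\<close> cancel, so the bound is uniform in
  \<open>\<rho>\<close>; \<open>exp (- x)\<close> is due to \<open>Re (zeta u) = 1\<close>.\<close>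

lemma integrand_bound:
  obtains c K where "0 < c" "0 \<le> K"
    "\<And>\<rho> x u. 0 < \<rho> \<Longrightarrow> \<rho> \<le> 1 \<Longrightarrow> norm (integrand \<rho> x u) \<le> K * exp (- x) * exp (- c * u ^ (2 * m))"
proof -
  obtain c C where cC: "0 < c" "0 \<le> C"
    "\<And>\<rho> \<phi>. 0 < \<rho> \<Longrightarrow> \<rho> \<le> 1 \<Longrightarrow> \<bar>\<phi>\<bar> \<le> pi \<Longrightarrow>
       Re (H (-1) 0 (Complex \<rho> \<phi>)) - b * \<rho> \<le> \<rho> * (C * \<rho> ^ (2 * m) - c * \<phi> ^ (2 * m))"
    using Re_H_upper by blast
  show ?thesis
  proof (rule that[of "c / d" "exp (C / d)"])
    fix \<rho> x u :: real assume \<rho>: "0 < \<rho>" "\<rho> \<le> 1"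
    show "norm (integrand \<rho> x u) \<le> exp (C / d) * exp (- x) * exp (- (c / d) * u ^ (2 * m))"
    proof (cases "\<bar>\<rho> * u\<bar> \<le> pi")
      case True
      have D: "0 < d * \<rho> ^ (2 * m + 1)"
        using d_pos \<rho> by simp
      have "Re (scaled_phase \<rho> u) = (Re (H (-1) 0 (Complex \<rho> (\<rho> * u))) - b * \<rho>) / (d * \<rho> ^ (2 * m + 1))"
        unfolding scaled_phase_def scale_zeta by (simp add: Re_divide_of_real zeta_def del: power_Suc of_real_mult of_real_power)
      also have "\<dots> \<le> \<rho> * (C * \<rho> ^ (2 * m) - c * (\<rho> * u) ^ (2 * m)) / (d * \<rho> ^ (2 * m + 1))"
        using cC(3)[OF \<rho> True] D by (intro divide_right_mono) auto
      also have "\<dots> = C / d - c / d * u ^ (2 * m)"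
        using \<rho> d_pos by (simp add: power_mult_distrib field_simps)
      finally have "Re (scaled_phase \<rho> u - of_real x * zeta u) \<le> C / d + - x + - (c / d) * u ^ (2 * m)"
        by (simp add: zeta_def)
      then have "exp (Re (scaled_phase \<rho> u - of_real x * zeta u)) \<le> exp (C / d + - x + - (c / d) * u ^ (2 * m))"
        by (simp only: exp_le_cancel_iff)
      then have "norm (exp (scaled_phase \<rho> u - of_real x * zeta u)) \<le> exp (C / d) * exp (- x) * exp (- (c / d) * u ^ (2 * m))"
        by (simp only: norm_exp_eq_Re exp_add)
      then show ?thesis
        using True by (simp add: integrand_def indicator_def)
    next
      case False
      then show ?thesis
        by (auto simp: integrand_def indicator_def abs_le_iff)
    qed
  qed (use cC d_pos in auto)
qed

definition airy_integrand :: "real \<Rightarrow> real \<Rightarrow> complex" where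
  "airy_integrand x u = exp (of_real ((-1) ^ (m + 1) / real (2 * m + 1)) * zeta u ^ (2 * m + 1) - of_real x * zeta u)"

text \<open>The remainder of order \<open>2 * m + 2\<close> in \<open>H_phase\<close> leaves one
  power of \<open>\<rho>\<close> after scaling. The argument \<open>x\<close> varies with
  \<open>k\<close> because lattice points only approach \<open>y\<close>.\<close>

lemma integrand_tendsto:
  assumes pos: "\<And>k. 0 < \<rho> k" and \<rho>: "\<rho> \<longlonglongrightarrow> 0" and x: "x \<longlonglongrightarrow> y"
  shows "(\<lambda>k::nat. integrand (\<rho> k) (x k) u) \<longlonglongrightarrow> airy_integrand y u"
proof -
  let ?z = "zeta u" and ?\<sigma> = "complex_of_real ((-1) ^ (m + 1) / real (2 * m + 1))"
  obtain C where C: "0 \<le> C" "\<And>w. norm w \<le> norm ?z \<Longrightarrow>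
    norm (H (-1) 0 w - of_real b * w - of_real ((-1) ^ (m + 1) * d / real (2 * m + 1)) * w ^ (2 * m + 1)) \<le> C * norm w ^ (2 * m + 2)"
    using H_phase[of "norm ?z"] by auto
  have ev1: "\<forall>\<^sub>F k in sequentially. \<rho> k \<le> 1"
    using order_tendstoD(2)[OF \<rho>, of 1] by (auto elim: eventually_mono)
  have "(\<lambda>k. scaled_phase (\<rho> k) u) \<longlonglongrightarrow> ?\<sigma> * ?z ^ (2 * m + 1)"
  proof (rule LIM_zero_cancel, rule Lim_null_comparison)
    show "\<forall>\<^sub>F k in sequentially. norm (scaled_phase (\<rho> k) u - ?\<sigma> * ?z ^ (2 * m + 1)) \<le> C / d * norm ?z ^ (2 * m + 2) * \<rho> k"
      using ev1
    proof eventually_elim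
      case (elim k)
      let ?w = "of_real (\<rho> k) * ?z"
      let ?D = "d * \<rho> k ^ (2 * m + 1)"
      have D: "0 < ?D"
        using d_pos pos[of k] by simp
      have "scaled_phase (\<rho> k) u - ?\<sigma> * ?z ^ (2 * m + 1)
          = (H (-1) 0 ?w - of_real b * ?w - of_real ((-1) ^ (m + 1) * d / real (2 * m + 1)) * ?w ^ (2 * m + 1)) / of_real ?D"
      proof -
        have "?\<sigma> * ?z ^ (2 * m + 1) = of_real ((-1) ^ (m + 1) * d / real (2 * m + 1)) * ?w ^ (2 * m + 1) / of_real ?D"
          using d_pos pos[of k] by (simp add: power_mult_distrib)
        then show ?thesis
          unfolding scaled_phase_def diff_divide_distrib by (simp add: mult.assoc)
      qed
      then have "norm (scaled_phase (\<rho> k) u - ?\<sigma> * ?z ^ (2 * m + 1)) \<le> C * norm ?w ^ (2 * m + 2) / ?D"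
        using C(2)[of ?w] elim pos[of k] D
        by (simp add: norm_divide norm_mult mult_left_le_one_le divide_right_mono del: power_Suc of_real_mult of_real_power)
      also have "\<dots> = C / d * norm ?z ^ (2 * m + 2) * \<rho> k"
        using d_pos pos[of k] by (simp add: norm_mult power_mult_distrib field_simps)
      finally show ?case .
    qed
    show "(\<lambda>k. C / d * norm ?z ^ (2 * m + 2) * \<rho> k) \<longlonglongrightarrow> 0"
      by (rule tendsto_mult_right_zero[OF \<rho>])
  qed
  then have "(\<lambda>k. exp (scaled_phase (\<rho> k) u - of_real (x k) * ?z)) \<longlonglongrightarrow> airy_integrand y u"
    unfolding airy_integrand_def by (intro tendsto_intros x)
  moreover have "\<forall>\<^sub>F k in sequentially. exp (scaled_phase (\<rho> k) u - of_real (x k) * ?z) = integrand (\<rho> k) (x k) u"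
  proof -
    have "(\<lambda>k. \<rho> k * u) \<longlonglongrightarrow> 0"
      using tendsto_mult_left_zero[OF \<rho>] .
    then have "\<forall>\<^sub>F k in sequentially. - pi < \<rho> k * u" "\<forall>\<^sub>F k in sequentially. \<rho> k * u < pi"
      using order_tendstoD by fastforce+
    then show ?thesis
      by eventually_elim (simp add: integrand_def indicator_def)
  qed
  ultimately show ?thesis
    by (rule Lim_transform_eventually)
qed

lemma integral_airy_integrand: "(\<integral>u. airy_integrand x u \<partial>lborel) = of_real (2 * pi * higher_airy m x)"
proof -
  have sgn: "(-1 :: complex) ^ (m - 1) = (-1) ^ (m + 1)"
    using m_pos by (cases m) auto
  have "airy_contour_integral m x = 1 / (2 * of_real pi * \<i>) * (LINT u|lborel. airy_integrand x u * \<i>)"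
    unfolding airy_contour_integral_def airy_integrand_def zeta_def sgn by (simp del: power_Suc)
  also have "\<dots> = 1 / (2 * of_real pi) * (LINT u|lborel. airy_integrand x u)"
    by simp
  finally have "of_real (higher_airy m x) = 1 / (2 * of_real pi) * (LINT u|lborel. airy_integrand x u)"
    by (simp add: of_real_higher_airy)
  then show ?thesis
    by simp
qed

lemma integrand_measurable: "integrand \<rho> x \<in> borel_measurable lborel"
proof -
  have "continuous_on UNIV (\<lambda>u. exp ((H (-1) 0 (of_real \<rho> * zeta u) - of_real (b * \<rho>) * zeta u) * K - of_real x * zeta u))" for K
    unfolding zeta_def H_def by (intro continuous_intros)
  then have "continuous_on UNIV (\<lambda>u. exp (scaled_phase \<rho> u - of_real x * zeta u))"
    unfolding scaled_phase_def divide_inverse .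
  then have "(\<lambda>u. exp (scaled_phase \<rho> u - of_real x * zeta u)) \<in> borel_measurable borel"
    by (rule borel_measurable_continuous_onI)
  then show ?thesis
    unfolding integrand_def by measurable
qed

lemma airy_integrand_measurable: "airy_integrand x \<in> borel_measurable lborel"
proof -
  have "continuous_on UNIV (airy_integrand x)"
    unfolding airy_integrand_def zeta_def by (intro continuous_intros)
  then show ?thesis
    by (simp add: borel_measurable_continuous_onI)
qed

lemma Jn_bound:
  obtains K where "0 \<le> K"
    "\<And>\<theta> n. 0 < \<theta> \<Longrightarrow> 1 \<le> d * \<theta> \<Longrightarrow> \<bar>Jn \<theta> n / rho \<theta>\<bar> \<le> K * exp (- (rho \<theta> * (real n - b * \<theta>)))"
proof -
  obtain c K where cK: "0 < c" "0 \<le> K"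
    "\<And>\<rho> x u. 0 < \<rho> \<Longrightarrow> \<rho> \<le> 1 \<Longrightarrow> norm (integrand \<rho> x u) \<le> K * exp (- x) * exp (- c * u ^ (2 * m))"
    using integrand_bound by blast
  let ?I = "\<integral>u. exp (- c * u ^ (2 * m)) \<partial>lborel"
  have int: "integrable lborel (\<lambda>u. exp (- c * u ^ (2 * m)))"
    by (rule integrable_exp_neg_even_power[OF cK(1) m_pos])
  show ?thesis
  proof (rule that[of "K * ?I / (2 * pi)"])
    show "0 \<le> K * ?I / (2 * pi)"
      using cK by (intro divide_nonneg_nonneg mult_nonneg_nonneg Bochner_Integration.integral_nonneg) auto
    fix \<theta> n assume \<theta>: "0 < \<theta>" "1 \<le> d * \<theta>"
    let ?x = "rho \<theta> * (real n - b * \<theta>)"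
    have le: "norm (integrand (rho \<theta>) ?x u) \<le> K * exp (- ?x) * exp (- c * u ^ (2 * m))" for u
      by (rule cK(3)[OF rho_pos[OF \<theta>(1)] rho_le_one[OF \<theta>(2)]])
    have "norm (of_real (2 * pi * (Jn \<theta> n / rho \<theta>)) :: complex) \<le> (\<integral>u. K * exp (- ?x) * exp (- c * u ^ (2 * m)) \<partial>lborel)"
      unfolding Jn_integral[OF \<theta>(1)]
    proof (rule Bochner_Integration.integral_norm_bound_integral)
      show "integrable lborel (integrand (rho \<theta>) ?x)"
        by (rule Bochner_Integration.integrable_bound[OF integrable_mult_right[OF int] integrand_measurable])
           (use le order_trans[OF le abs_ge_self] in auto)
    qed (use int le in auto)
    then have "2 * pi * \<bar>Jn \<theta> n / rho \<theta>\<bar> \<le> K * exp (- ?x) * ?I"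
      by (simp only: norm_of_real Bochner_Integration.integral_mult_right_zero abs_mult abs_of_nonneg[OF pi_ge_zero] abs_numeral)
    then show "\<bar>Jn \<theta> n / rho \<theta>\<bar> \<le> K * ?I / (2 * pi) * exp (- ?x)"
      by (simp add: field_simps)
  qed
qed

lemma Jn_tendsto_airy:
  assumes \<theta>: "filterlim \<theta> at_top sequentially" and pos: "\<And>k. 0 < \<theta> k"
    and x: "(\<lambda>k. rho (\<theta> k) * (real (n k) - b * \<theta> k)) \<longlonglongrightarrow> x"
  shows "(\<lambda>k. Jn (\<theta> k) (n k) / rho (\<theta> k)) \<longlonglongrightarrow> higher_airy m x"
proof -
  obtain c K where cK: "0 < c" "0 \<le> K"
    "\<And>\<rho> x u. 0 < \<rho> \<Longrightarrow> \<rho> \<le> 1 \<Longrightarrow> norm (integrand \<rho> x u) \<le> K * exp (- x) * exp (- c * u ^ (2 * m))"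
    using integrand_bound by blast
  let ?x = "\<lambda>k. rho (\<theta> k) * (real (n k) - b * \<theta> k)"
  have \<rho>0: "(\<lambda>k. rho (\<theta> k)) \<longlonglongrightarrow> 0"
    by (rule rho_tendsto[OF \<theta>])
  have "\<forall>\<^sub>F k in sequentially. rho (\<theta> k) < 1"
    using \<rho>0 by (rule order_tendstoD) simp
  \<comment> \<open>The uniform bound requires \<open>rho \<le> 1\<close>; dropping the first
    \<open>k1\<close> indices makes it hold throughout.\<close>
  then obtain k1 where k1: "\<And>k. k1 \<le> k \<Longrightarrow> rho (\<theta> k) \<le> 1"
    unfolding eventually_sequentially by (meson less_imp_le)
  obtain B where B: "\<And>k. \<bar>?x k\<bar> \<le> B"
    using convergent_imp_Bseq[OF convergentI[OF x]] unfolding Bseq_def by auto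
  have "(\<lambda>k. \<integral>u. integrand (rho (\<theta> (k + k1))) (?x (k + k1)) u \<partial>lborel) \<longlonglongrightarrow> (\<integral>u. airy_integrand x u \<partial>lborel)"
  proof (rule integral_dominated_convergence)
    show "integrable lborel (\<lambda>u. K * exp B * exp (- c * u ^ (2 * m)))"
      using integrable_exp_neg_even_power[OF cK(1) m_pos] by (intro integrable_mult_right) auto
    show "AE u in lborel. (\<lambda>k. integrand (rho (\<theta> (k + k1))) (?x (k + k1)) u) \<longlonglongrightarrow> airy_integrand x u"
    proof (rule AE_I2)
      fix u
      have "(\<lambda>k. integrand (rho (\<theta> k)) (?x k) u) \<longlonglongrightarrow> airy_integrand x u"
        by (rule integrand_tendsto[OF rho_pos[OF pos] \<rho>0 x])
      then show "(\<lambda>k. integrand (rho (\<theta> (k + k1))) (?x (k + k1)) u) \<longlonglongrightarrow> airy_integrand x u"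
        by (rule LIMSEQ_ignore_initial_segment)
    qed
    show "AE u in lborel. norm (integrand (rho (\<theta> (k + k1))) (?x (k + k1)) u) \<le> K * exp B * exp (- c * u ^ (2 * m))" for k
    proof (rule AE_I2)
      fix u
      have "norm (integrand (rho (\<theta> (k + k1))) (?x (k + k1)) u) \<le> K * exp (- ?x (k + k1)) * exp (- c * u ^ (2 * m))"
        by (rule cK(3)[OF rho_pos[OF pos] k1]) simp
      also have "\<dots> \<le> K * exp B * exp (- c * u ^ (2 * m))"
        using cK B[of "k + k1"] by (intro mult_right_mono mult_left_mono) (auto simp: abs_le_iff)
      finally show "norm (integrand (rho (\<theta> (k + k1))) (?x (k + k1)) u) \<le> K * exp B * exp (- c * u ^ (2 * m))" .
    qed
  qed (rule airy_integrand_measurable integrand_measurable)+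
  then have "(\<lambda>k. complex_of_real (2 * pi * (Jn (\<theta> (k + k1)) (n (k + k1)) / rho (\<theta> (k + k1))))) \<longlonglongrightarrow> of_real (2 * pi * higher_airy m x)"
    by (simp only: Jn_integral[OF pos] integral_airy_integrand)
  then have "(\<lambda>k. 2 * pi * (Jn (\<theta> (k + k1)) (n (k + k1)) / rho (\<theta> (k + k1)))) \<longlonglongrightarrow> 2 * pi * higher_airy m x"
    by (simp only: tendsto_of_real_iff)
  then have lim: "(\<lambda>k. 1 / (2 * pi) * (2 * pi * (Jn (\<theta> (k + k1)) (n (k + k1)) / rho (\<theta> (k + k1))))) \<longlonglongrightarrow> 1 / (2 * pi) * (2 * pi * higher_airy m x)"
    by (rule tendsto_mult[OF tendsto_const])
  then have "(\<lambda>k. Jn (\<theta> (k + k1)) (n (k + k1)) / rho (\<theta> (k + k1))) \<longlonglongrightarrow> higher_airy m x"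
  proof -
    have e: "1 / (2 * pi) * (2 * pi * z) = z" for z
      by simp
    show ?thesis
      using lim unfolding e .
  qed
  then show ?thesis
    by (rule LIMSEQ_offset)
qed

end

section \<open>Fredholm determinants\<close>

interpretation lborel_prod: product_sigma_finite "\<lambda>_::nat. lborel :: real measure"
  by unfold_locales

lemma fredholm_det_eq_fdet:
  "fredholm_det K S = (\<Sum>n. (-1) ^ n / fact n *
     (\<integral>x. indicator (PiE {..<n} (\<lambda>_. S)) x * fdet n (\<lambda>i j. K (x i) (x j)) \<partial>(Pi\<^sub>M {..<n} (\<lambda>_. lborel))))"
  by (simp add: fredholm_det_def set_lebesgue_integral_def fdet_def)

lemma indicator_PiE_eq_prod:
  assumes "x \<in> space (Pi\<^sub>M {..<n} (\<lambda>_::nat. lborel))"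
  shows "(indicator (PiE {..<n} (\<lambda>_. S)) x :: real) = (\<Prod>i<n. indicator S (x i))"
proof (cases "\<forall>i<n. x i \<in> S")
  case True
  then have "x \<in> PiE {..<n} (\<lambda>_. S)"
    using assms by (auto simp: space_PiM PiE_iff)
  then show ?thesis
    using True by simp
next
  case False
  then obtain i where i: "i < n" "x i \<notin> S"
    by blast
  then have "(\<Prod>i<n. indicator S (x i)) = (0 :: real)"
    by (intro prod_zero bexI[of _ i]) auto
  moreover have "x \<notin> PiE {..<n} (\<lambda>_. S)"
    using i by auto
  ultimately show ?thesis
    by simp
qed

lemma fdet_kernel_measurable:
  assumes "case_prod K \<in> borel_measurable (borel \<Otimes>\<^sub>M borel)"
  shows "(\<lambda>x. fdet n (\<lambda>i j. K (x i) (x j))) \<in> borel_measurable (Pi\<^sub>M {..<n} (\<lambda>_. lborel))"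
  unfolding fdet_leibniz
proof (intro borel_measurable_sum borel_measurable_times borel_measurable_const borel_measurable_prod)
  fix p i assume p: "p \<in> {p. p permutes {0..<n}}" and i: "i \<in> {0..<n}"
  then have "i \<in> {..<n}" "p i \<in> {..<n}"
    using permutes_in_image[of p "{0..<n}" i] by auto
  then have "(\<lambda>x. (x i, x (p i))) \<in> measurable (Pi\<^sub>M {..<n} (\<lambda>_. lborel)) (borel \<Otimes>\<^sub>M borel)"
    by (intro measurable_Pair) (auto intro!: measurable_component_singleton simp: measurable_lborel1[symmetric] simp del: measurable_lborel1)
  from measurable_compose[OF this assms]
  show "(\<lambda>x. K (x i) (x (p i))) \<in> borel_measurable (Pi\<^sub>M {..<n} (\<lambda>_. lborel))"
    by simp
qed

lemma indicator_PiE_measurable: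
  assumes "S \<in> sets borel"
  shows "(indicator (PiE {..<n} (\<lambda>_. S)) :: _ \<Rightarrow> real) \<in> borel_measurable (Pi\<^sub>M {..<n} (\<lambda>_::nat. lborel))"
  using assms by (intro borel_measurable_indicator sets_PiM_I_finite) auto

text \<open>Dominated convergence inside each term and Tannery's theorem across the terms. The
  domination is asked of the determinants, not of kernel entries, because Hadamard's inequality
  provides exactly this product form.\<close>

lemma fredholm_det_tendsto:
  fixes K :: "nat \<Rightarrow> real \<Rightarrow> real \<Rightarrow> real"
  assumes S: "S \<in> sets borel"
    and meas: "\<And>k. case_prod (K k) \<in> borel_measurable (borel \<Otimes>\<^sub>M borel)"
    and lim: "\<And>x y. x \<in> S \<Longrightarrow> y \<in> S \<Longrightarrow> (\<lambda>k. K k x y) \<longlonglongrightarrow> L x y"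
    and w: "\<And>x. x \<in> S \<Longrightarrow> 0 \<le> w x" "integrable lborel (\<lambda>x. indicator S x * w x)"
    and bound: "\<And>k n x. (\<And>i. i < n \<Longrightarrow> x i \<in> S) \<Longrightarrow> \<bar>fdet n (\<lambda>i j. K k (x i) (x j))\<bar> \<le> (\<Prod>i<n. w (x i))"
  shows "(\<lambda>k. fredholm_det (K k) S) \<longlonglongrightarrow> fredholm_det L S"
proof -
  define M where "M n = Pi\<^sub>M {..<n} (\<lambda>_::nat. lborel :: real measure)" for n
  define I where "I K n = (\<integral>x. indicator (PiE {..<n} (\<lambda>_. S)) x * fdet n (\<lambda>i j. K (x i) (x j)) \<partial>M n)" for K n
  define W where "W = (\<integral>x. indicator S x * w x \<partial>lborel)"
  let ?g = "\<lambda>n x. \<Prod>i<n. indicator S (x i) * w (x i)"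
  have g_int: "integrable (M n) (?g n)" for n
    unfolding M_def by (rule lborel_prod.product_integrable_prod) (use w in auto)
  have g_integral: "(\<integral>x. ?g n x \<partial>M n) = W ^ n" for n
    unfolding M_def W_def by (subst lborel_prod.product_integral_prod) (use w in auto)
  have le: "\<bar>indicator (PiE {..<n} (\<lambda>_. S)) x * fdet n (\<lambda>i j. K k (x i) (x j))\<bar> \<le> ?g n x"
    if x: "x \<in> space (M n)" for n k x
  proof (cases "\<forall>i<n. x i \<in> S")
    case True
    then have "(\<Prod>i<n. indicator S (x i)) = (1::real)"
      by (intro prod.neutral) auto
    then show ?thesis
      using True bound[of n x k] x by (simp add: prod.distrib indicator_PiE_eq_prod[of x n] M_def abs_mult)
  next
    case False
    then obtain i where "i < n" "x i \<notin> S"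
      by blast
    then have z: "(\<Prod>i<n. indicator S (x i)) = (0::real)"
      by (intro prod_zero bexI[of _ i]) auto
    show ?thesis
      unfolding prod.distrib indicator_PiE_eq_prod[OF x[unfolded M_def]] z by simp
  qed
  have mK: "(\<lambda>x. indicator (PiE {..<n} (\<lambda>_. S)) x * fdet n (\<lambda>i j. K k (x i) (x j))) \<in> borel_measurable (M n)" for n k
    unfolding M_def by (intro borel_measurable_times indicator_PiE_measurable fdet_kernel_measurable S meas)
  have pt: "(\<lambda>k. indicator (PiE {..<n} (\<lambda>_. S)) x * fdet n (\<lambda>i j. K k (x i) (x j)))
      \<longlonglongrightarrow> indicator (PiE {..<n} (\<lambda>_. S)) x * fdet n (\<lambda>i j. L (x i) (x j))" for n x
  proof (cases "x \<in> PiE {..<n} (\<lambda>_. S)")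
    case True
    then have "\<And>i. i < n \<Longrightarrow> x i \<in> S"
      by auto
    then show ?thesis
      by (intro tendsto_mult tendsto_const fdet_tendsto lim) auto
  qed simp
  \<comment> \<open>Measurability of the limiting integrand is inherited from the approximating
    ones.\<close>
  have mL: "(\<lambda>x. indicator (PiE {..<n} (\<lambda>_. S)) x * fdet n (\<lambda>i j. L (x i) (x j))) \<in> borel_measurable (M n)" for n
    by (rule borel_measurable_LIMSEQ_real[OF pt mK])
  have tlim: "(\<lambda>k. (-1) ^ n / fact n * I (K k) n) \<longlonglongrightarrow> (-1) ^ n / fact n * I L n" for n
    unfolding I_def
  proof (intro tendsto_mult tendsto_const)
    show "(\<lambda>k. \<integral>x. indicator (PiE {..<n} (\<lambda>_. S)) x * fdet n (\<lambda>i j. K k (x i) (x j)) \<partial>M n)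
      \<longlonglongrightarrow> (\<integral>x. indicator (PiE {..<n} (\<lambda>_. S)) x * fdet n (\<lambda>i j. L (x i) (x j)) \<partial>M n)"
      by (rule integral_dominated_convergence[where w = "?g n"])
         (use mK mL g_int pt le in auto)
  qed
  have W0: "0 \<le> W"
    unfolding W_def using w(1) by (intro Bochner_Integration.integral_nonneg) (auto simp: indicator_def)
  have bd: "norm ((-1) ^ n / fact n * I (K k) n) \<le> W ^ n / fact n" for n k
  proof -
    let ?h = "\<lambda>x. indicator (PiE {..<n} (\<lambda>_. S)) x * fdet n (\<lambda>i j. K k (x i) (x j))"
    have int: "integrable (M n) ?h"
      by (rule Bochner_Integration.integrable_bound[OF g_int mK])
         (use le order_trans[OF le abs_ge_self] in auto)
    have "\<bar>I (K k) n\<bar> \<le> (\<integral>x. \<bar>?h x\<bar> \<partial>M n)"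
      unfolding I_def by (rule integral_abs_bound)
    also have "\<dots> \<le> (\<integral>x. ?g n x \<partial>M n)"
      using int g_int le by (intro Bochner_Integration.integral_mono) auto
    finally have "\<bar>I (K k) n\<bar> \<le> (\<integral>x. ?g n x \<partial>M n)" .
    then show ?thesis
      by (simp add: g_integral abs_mult divide_right_mono)
  qed
  have "summable (\<lambda>n. W ^ n / fact n)"
    using summable_exp_generic[of W] by (simp add: divide_inverse mult.commute)
  then have "(\<lambda>k. \<Sum>n. (-1) ^ n / fact n * I (K k) n) \<longlonglongrightarrow> (\<Sum>n. (-1) ^ n / fact n * I L n)"
    using tannerys_theorem[of "\<lambda>n k. (-1) ^ n / fact n * I (K k) n" "\<lambda>n. (-1) ^ n / fact n * I L n" sequentially "\<lambda>n. W ^ n / fact n"]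
      tlim bd by (auto simp: case_prod_unfold)
  then show ?thesis
    by (simp add: fredholm_det_eq_fdet I_def M_def)
qed

section \<open>Step kernels on a half line\<close>

definition step_kernel :: "real \<Rightarrow> real \<Rightarrow> (nat \<Rightarrow> nat \<Rightarrow> real) \<Rightarrow> real \<Rightarrow> real \<Rightarrow> real" where
  "step_kernel s \<rho> \<kappa> x y = \<kappa> (nat \<lfloor>(x - s) / \<rho>\<rfloor>) (nat \<lfloor>(y - s) / \<rho>\<rfloor>) / \<rho>"

lemma step_kernel_measurable: "case_prod (step_kernel s \<rho> \<kappa>) \<in> borel_measurable (borel \<Otimes>\<^sub>M borel)"
proof -
  have idx: "(\<lambda>x. nat \<lfloor>(x - s) / \<rho>\<rfloor>) \<in> measurable borel (count_space UNIV)"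
    by measurable
  have i1: "(\<lambda>p. nat \<lfloor>(fst p - s) / \<rho>\<rfloor>) \<in> measurable (borel \<Otimes>\<^sub>M borel) (count_space UNIV)"
    and i2: "(\<lambda>p. nat \<lfloor>(snd p - s) / \<rho>\<rfloor>) \<in> measurable (borel \<Otimes>\<^sub>M borel) (count_space UNIV)"
    using measurable_compose[OF measurable_fst idx] measurable_compose[OF measurable_snd idx] by auto
  have "(\<lambda>p. \<kappa> (nat \<lfloor>(fst p - s) / \<rho>\<rfloor>) (nat \<lfloor>(snd p - s) / \<rho>\<rfloor>)) \<in> borel_measurable (borel \<Otimes>\<^sub>M borel)"
    by (rule measurable_compose_countable[OF _ i1], rule measurable_compose_countable[OF _ i2]) simp
  then show ?thesis
    unfolding step_kernel_def case_prod_unfold by (intro borel_measurable_divide borel_measurable_const)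
qed

lemma nat_floor_eq_iff:
  fixes \<rho> :: real
  assumes "0 < \<rho>" "s \<le> x"
  shows "nat \<lfloor>(x - s) / \<rho>\<rfloor> = k \<longleftrightarrow> x \<in> {s + real k * \<rho>..<s + (real k + 1) * \<rho>}"
proof -
  have "0 \<le> (x - s) / \<rho>"
    using assms by simp
  then have "nat \<lfloor>(x - s) / \<rho>\<rfloor> = k \<longleftrightarrow> \<lfloor>(x - s) / \<rho>\<rfloor> = int k"
    by auto
  also have "\<dots> \<longleftrightarrow> real k \<le> (x - s) / \<rho> \<and> (x - s) / \<rho> < real k + 1"
    by (simp add: floor_eq_iff)
  also have "\<dots> \<longleftrightarrow> x \<in> {s + real k * \<rho>..<s + (real k + 1) * \<rho>}"
    using assms by (auto simp: pos_le_divide_eq pos_divide_less_eq algebra_simps)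
  finally show ?thesis .
qed

text \<open>\<open>nat\<close> sends a negative floor to 0, so points left of \<open>s\<close> would
  fall into cell 0; the indicator of the half line removes them.\<close>

lemma indicator_cell:
  fixes \<rho> :: real
  assumes "0 < \<rho>"
  shows "indicator {s..} x * (if nat \<lfloor>(x - s) / \<rho>\<rfloor> = k then 1 else 0) = (indicator {s + real k * \<rho>..<s + (real k + 1) * \<rho>} x :: real)"
proof (cases "s \<le> x")
  case True
  then show ?thesis
    using nat_floor_eq_iff[OF assms True, of k] by (simp add: indicator_def)
next
  case False
  then have "x \<notin> {s + real k * \<rho>..<s + (real k + 1) * \<rho>}"
    using assms by (auto intro: order_trans[of s "s + real k * \<rho>"])
  then show ?thesis
    using False by simp
qed

lemma fdet_scale: "fdet n (\<lambda>i j. A i j / c) = fdet n A / c ^ n"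
  by (simp add: fdet_leibniz prod_dividef sum_divide_distrib)

text \<open>Each cell has length \<open>\<rho>\<close>, which cancels the division by
  \<open>\<rho>\<close> in the kernel. The integrals become sums over index maps, and the series is
  the one in \<open>fdet_one_minus_expansion\<close>.\<close>

lemma fredholm_det_step_kernel:
  assumes \<rho>: "0 < \<rho>"
  shows "fredholm_det (step_kernel s \<rho> (\<lambda>i j. if i < N \<and> j < N then \<kappa> i j else 0)) {s..}
    = fdet N (\<lambda>i j. (if i = j then 1 else 0) - \<kappa> i j)"
proof -
  let ?\<kappa> = "\<lambda>i j. if i < N \<and> j < N then \<kappa> i j else 0"
  let ?K = "step_kernel s \<rho> ?\<kappa>" and ?\<iota> = "\<lambda>x. nat \<lfloor>(x - s) / \<rho>\<rfloor>"
  let ?cell = "\<lambda>k. {s + real k * \<rho>..<s + (real k + 1) * \<rho>}"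
  have cell_int: "integrable lborel (indicator (?cell k) :: real \<Rightarrow> real)" "(\<integral>x. indicator (?cell k) x \<partial>lborel) = \<rho>" for k
    using \<rho> by (simp_all add: algebra_simps)
  have I: "(\<integral>x. indicator (PiE {..<n} (\<lambda>_. {s..})) x * fdet n (\<lambda>i j. ?K (x i) (x j)) \<partial>(Pi\<^sub>M {..<n} (\<lambda>_. lborel)))
      = (\<Sum>f\<in>PiE {..<n} (\<lambda>_. {..<N}). fdet n (\<lambda>i j. \<kappa> (f i) (f j)))" for n
  proof -
    let ?F = "PiE {..<n} (\<lambda>_. {..<N})"
    have finF: "finite ?F"
      by (simp add: finite_PiE)
    have "(\<integral>x. indicator (PiE {..<n} (\<lambda>_. {s..})) x * fdet n (\<lambda>i j. ?K (x i) (x j)) \<partial>(Pi\<^sub>M {..<n} (\<lambda>_. lborel)))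
       = (\<integral>x. (\<Sum>f\<in>?F. fdet n (\<lambda>i j. \<kappa> (f i) (f j)) / \<rho> ^ n * (\<Prod>i<n. indicator (?cell (f i)) (x i))) \<partial>(Pi\<^sub>M {..<n} (\<lambda>_. lborel)))"
    proof (rule Bochner_Integration.integral_cong[OF refl])
      fix x assume x: "x \<in> space (Pi\<^sub>M {..<n} (\<lambda>_::nat. lborel :: real measure))"
      have "(\<Sum>f\<in>?F. fdet n (\<lambda>i j. \<kappa> (f i) (f j)) / \<rho> ^ n * (\<Prod>i<n. indicator (?cell (f i)) (x i)))
          = (\<Prod>i<n. indicator {s..} (x i)) * (\<Sum>f\<in>?F. fdet n (\<lambda>i j. \<kappa> (f i) (f j)) / \<rho> ^ n * (\<Prod>i<n. if ?\<iota> (x i) = f i then 1 else 0))"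
        unfolding indicator_cell[OF \<rho>, symmetric] prod.distrib by (simp add: sum_distrib_left mult_ac)
      also have "(\<Sum>f\<in>?F. fdet n (\<lambda>i j. \<kappa> (f i) (f j)) / \<rho> ^ n * (\<Prod>i<n. if ?\<iota> (x i) = f i then 1 else 0)) = fdet n (\<lambda>i j. ?K (x i) (x j))"
      proof (cases "\<forall>i<n. ?\<iota> (x i) < N")
        case True
        \<comment> \<open>Only the map from coordinates to the indices of their cells contributes;
          it is restricted because the maps in \<open>?F\<close> are extensional.\<close>
        let ?f = "restrict (\<lambda>i. ?\<iota> (x i)) {..<n}"
        have f: "?f \<in> ?F"
          using True by auto
        have "(\<Sum>f\<in>?F. fdet n (\<lambda>i j. \<kappa> (f i) (f j)) / \<rho> ^ n * (\<Prod>i<n. if ?\<iota> (x i) = f i then 1 else 0))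
            = (\<Sum>f\<in>?F. if f = ?f then fdet n (\<lambda>i j. \<kappa> (?f i) (?f j)) / \<rho> ^ n else 0)"
        proof (rule sum.cong[OF refl])
          fix f assume fF: "f \<in> ?F"
          show "fdet n (\<lambda>i j. \<kappa> (f i) (f j)) / \<rho> ^ n * (\<Prod>i<n. if ?\<iota> (x i) = f i then 1 else 0)
            = (if f = ?f then fdet n (\<lambda>i j. \<kappa> (?f i) (?f j)) / \<rho> ^ n else 0)"
          proof (cases "f = ?f")
            case True
            have "(\<Prod>i<n. if ?\<iota> (x i) = f i then 1 else 0) = (1::real)"
              by (rule prod.neutral) (simp add: True)
            then show ?thesis
              using True by simp
          next
            case False
            then obtain i where "i < n" "f i \<noteq> ?f i"
              using PiE_ext[OF fF f] by auto
            then have "(\<Prod>i<n. if ?\<iota> (x i) = f i then 1 else 0) = (0::real)"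
              by (intro prod_zero bexI[of _ i]) auto
            then show ?thesis
              using False by simp
          qed
        qed
        also have "\<dots> = fdet n (\<lambda>i j. \<kappa> (?f i) (?f j)) / \<rho> ^ n"
          using finF f by simp
        also have "\<dots> = fdet n (\<lambda>i j. ?K (x i) (x j))"
          unfolding fdet_scale[symmetric] by (rule fdet_cong) (use True in \<open>simp add: step_kernel_def\<close>)
        finally show ?thesis .
      next
        case False
        then obtain i where i: "i < n" "\<not> ?\<iota> (x i) < N"
          by blast
        \<comment> \<open>A coordinate in a cell from \<open>N\<close> on is matched by no map in
          \<open>?F\<close>, and its row of the cut-off kernel is zero.\<close>
        have z: "(\<Prod>i<n. if ?\<iota> (x i) = f i then 1 else 0) = (0::real)" if "f \<in> ?F" for f
        proof (rule prod_zero)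
          have "f i < N"
            using PiE_mem[OF that, of i] i by simp
          then show "\<exists>i\<in>{..<n}. (if ?\<iota> (x i) = f i then 1 else 0) = (0::real)"
            using i by (intro bexI[of _ i]) auto
        qed simp
        have "(\<Sum>f\<in>?F. fdet n (\<lambda>i j. \<kappa> (f i) (f j)) / \<rho> ^ n * (\<Prod>i<n. if ?\<iota> (x i) = f i then 1 else 0)) = 0"
          by (intro sum.neutral ballI) (simp only: z mult_zero_right)
        moreover have "fdet n (\<lambda>i j. ?K (x i) (x j)) = 0"
          using i by (intro fdet_zero_row[of i]) (simp_all add: step_kernel_def)
        ultimately show ?thesis
          by (simp only:)
      qed
      finally show "indicator (PiE {..<n} (\<lambda>_. {s..})) x * fdet n (\<lambda>i j. ?K (x i) (x j))
         = (\<Sum>f\<in>?F. fdet n (\<lambda>i j. \<kappa> (f i) (f j)) / \<rho> ^ n * (\<Prod>i<n. indicator (?cell (f i)) (x i)))"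
        by (simp add: indicator_PiE_eq_prod[OF x])
    qed
    also have "\<dots> = (\<Sum>f\<in>?F. fdet n (\<lambda>i j. \<kappa> (f i) (f j)) / \<rho> ^ n *
        (\<integral>x. (\<Prod>i<n. indicator (?cell (f i)) (x i)) \<partial>(Pi\<^sub>M {..<n} (\<lambda>_. lborel))))"
    proof -
      have int: "integrable (Pi\<^sub>M {..<n} (\<lambda>_. lborel)) (\<lambda>x. c * (\<Prod>i<n. indicator (?cell (f i)) (x i)) :: real)" for f and c :: real
        by (rule integrable_mult_right[OF lborel_prod.product_integrable_prod[where f = "\<lambda>i. indicator (?cell (f i))"]])
           (simp_all only: finite_lessThan cell_int)
      show ?thesis
        unfolding Bochner_Integration.integral_sum[OF int]
        by (intro sum.cong refl Bochner_Integration.integral_mult_right_zero)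
    qed
    also have "\<dots> = (\<Sum>f\<in>?F. fdet n (\<lambda>i j. \<kappa> (f i) (f j)) / \<rho> ^ n * \<rho> ^ n)"
    proof (intro sum.cong refl arg_cong2[of _ _ _ _ "(*)"])
      fix f
      show "(\<integral>x. (\<Prod>i<n. indicator (?cell (f i)) (x i)) \<partial>(Pi\<^sub>M {..<n} (\<lambda>_. lborel))) = \<rho> ^ n"
        by (subst lborel_prod.product_integral_prod[where f = "\<lambda>i. indicator (?cell (f i))"]) (simp_all only: cell_int finite_lessThan prod_constant card_lessThan)
    qed
    finally show ?thesis
      using \<rho> by simp
  qed
  define T where "T n = (-1) ^ n / fact n * (\<Sum>f\<in>PiE {..<n} (\<lambda>_. {..<N}). fdet n (\<lambda>i j. \<kappa> (f i) (f j)))" for n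
  have "(\<lambda>k. \<Sum>n<k. T n) \<longlonglongrightarrow> fdet N (\<lambda>i j. (if i = j then 1 else 0) - \<kappa> i j)"
  proof (rule tendsto_eventually)
    show "\<forall>\<^sub>F k in sequentially. (\<Sum>n<k. T n) = fdet N (\<lambda>i j. (if i = j then 1 else 0) - \<kappa> i j)"
      using eventually_ge_at_top[of "Suc N"]
    proof eventually_elim
      case (elim k)
      then obtain k' where "k = Suc k'" "N \<le> k'"
        by (cases k) auto
      then show ?case
        using fdet_one_minus_expansion[of N k' \<kappa>] by (simp only: T_def lessThan_Suc_atMost)
    qed
  qed
  then have "T sums fdet N (\<lambda>i j. (if i = j then 1 else 0) - \<kappa> i j)"
    by (simp add: sums_def)
  then show ?thesis
    by (simp add: fredholm_det_eq_fdet I T_def[abs_def] sums_iff)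
qed

text \<open>Converts the sum over the inner Hankel index into an integral over \<open>v\<close>, the
  shape of the Airy kernel.\<close>

lemma integral_nat_floor:
  fixes f :: "nat \<Rightarrow> real"
  assumes \<rho>: "0 < \<rho>" and f: "summable (\<lambda>p. \<bar>f p\<bar>)"
  shows "(LINT x:{0..}|lborel. f (nat \<lfloor>x / \<rho>\<rfloor>)) = \<rho> * (\<Sum>p. f p)"
proof -
  let ?cell = "\<lambda>k. {0 + real k * \<rho>..<0 + (real k + 1) * \<rho>}"
  let ?F = "\<lambda>p x. indicator (?cell p) x * f p"
  have int: "integrable lborel (?F p)" "(\<integral>x. ?F p x \<partial>lborel) = \<rho> * f p" "(\<integral>x. norm (?F p x) \<partial>lborel) = \<rho> * \<bar>f p\<bar>" for p
    using \<rho> by (simp_all add: algebra_simps abs_mult)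
  have F: "?F p x = (if p = nat \<lfloor>x / \<rho>\<rfloor> then indicator {0..} x * f (nat \<lfloor>x / \<rho>\<rfloor>) else 0)" for p x
    unfolding indicator_cell[OF \<rho>, symmetric] by auto
  have single: "(\<lambda>p. ?F p x) sums (indicator {0..} x * f (nat \<lfloor>x / \<rho>\<rfloor>))" for x
    unfolding F by (rule sums_single)
  have "(\<lambda>p. \<integral>x. ?F p x \<partial>lborel) sums (\<integral>x. (\<Sum>p. ?F p x) \<partial>lborel)"
  proof (rule sums_integral)
    show "AE x in lborel. summable (\<lambda>p. norm (?F p x))"
    proof (rule AE_I2)
      fix x
      have "(\<lambda>p. norm (?F p x)) = (\<lambda>p. if p = nat \<lfloor>x / \<rho>\<rfloor> then norm (indicator {0..} x * f (nat \<lfloor>x / \<rho>\<rfloor>)) else 0)"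
        unfolding F by auto
      then show "summable (\<lambda>p. norm (?F p x))"
        using sums_single[of "nat \<lfloor>x / \<rho>\<rfloor>" "\<lambda>_. norm (indicator {0..} x * f (nat \<lfloor>x / \<rho>\<rfloor>))"]
        by (simp only: sums_iff)
    qed
    show "summable (\<lambda>p. \<integral>x. norm (?F p x) \<partial>lborel)"
      unfolding int by (rule summable_mult[OF f])
  qed (rule int)
  moreover have "(\<Sum>p. ?F p x) = indicator {0..} x * f (nat \<lfloor>x / \<rho>\<rfloor>)" for x
    using single[of x] by (simp only: sums_iff)
  ultimately have "(\<lambda>p. \<rho> * f p) sums (LINT x:{0..}|lborel. f (nat \<lfloor>x / \<rho>\<rfloor>))"
    by (simp only: int set_lebesgue_integral_def real_scaleR_def)
  moreover have "(\<lambda>p. \<rho> * f p) sums (\<rho> * (\<Sum>p. f p))"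
    by (rule sums_mult[OF summable_sums[OF summable_rabs_cancel[OF f]]])
  ultimately show ?thesis
    by (rule sums_unique2)
qed

lemma integrable_exp_neg_atLeast:
  fixes a s :: real
  assumes "0 < a"
  shows "integrable lborel (\<lambda>x. indicator {s..} x * exp (- a * x))"
proof -
  have "(\<lambda>x. exp (- a * x)) absolutely_integrable_on {s..}"
    using has_integral_exp_minus_to_infinity[OF assms, of s]
    by (intro nonnegative_absolutely_integrable_1) (auto simp: has_integral_iff)
  then have "integrable lebesgue (\<lambda>x. indicator {s..} x * exp (- a * x))"
    by (simp add: set_integrable_def)
  then show ?thesis
    by (subst (asm) integrable_completion) auto
qed

section \<open>The edge limit\<close>

lemma floor_scaled_bounds:
  fixes \<rho> y :: real
  assumes "0 < \<rho>" "0 \<le> y"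
  shows "y - \<rho> \<le> \<rho> * real (nat \<lfloor>y / \<rho>\<rfloor>)" "\<rho> * real (nat \<lfloor>y / \<rho>\<rfloor>) \<le> y"
proof -
  have "0 \<le> \<lfloor>y / \<rho>\<rfloor>"
    using assms by simp
  then have e: "real (nat \<lfloor>y / \<rho>\<rfloor>) = of_int \<lfloor>y / \<rho>\<rfloor>"
    by simp
  have "y / \<rho> - 1 \<le> real (nat \<lfloor>y / \<rho>\<rfloor>)" "real (nat \<lfloor>y / \<rho>\<rfloor>) \<le> y / \<rho>"
    unfolding e by linarith+
  then have "\<rho> * (y / \<rho> - 1) \<le> \<rho> * real (nat \<lfloor>y / \<rho>\<rfloor>)" "\<rho> * real (nat \<lfloor>y / \<rho>\<rfloor>) \<le> \<rho> * (y / \<rho>)"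
    using assms(1) by (simp_all only: mult_le_cancel_left_pos)
  moreover have "\<rho> * (y / \<rho> - 1) = y - \<rho>" "\<rho> * (y / \<rho>) = y"
    using assms(1) by (simp_all add: right_diff_distrib)
  ultimately show "y - \<rho> \<le> \<rho> * real (nat \<lfloor>y / \<rho>\<rfloor>)" "\<rho> * real (nat \<lfloor>y / \<rho>\<rfloor>) \<le> y"
    by simp_all
qed

context multicritical_times
begin

definition Kd :: "real \<Rightarrow> nat \<Rightarrow> nat \<Rightarrow> real" where
  "Kd \<theta> = mmul (hankel (Jn \<theta>)) (hankel (Jn \<theta>))"

lemma Jn_fast_decay: "0 < \<theta> \<Longrightarrow> fast_decay (Jn \<theta>)"
proof -
  assume "0 < \<theta>"
  then interpret ft: finite_times "\<lambda>r. \<theta> * \<gamma> r"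
    by (rule finite_times_scale)
  show ?thesis
    using ft.fast_decay_J by (simp add: ft.J_def Jn_def)
qed

lemma Jn_product_summable:
  assumes "0 < \<theta>"
  shows "summable (\<lambda>p. \<bar>Jn \<theta> (i + p + 1) * Jn \<theta> (j + p + 1)\<bar>)"
    and "(\<lambda>p. Jn \<theta> (i + p + 1) * Jn \<theta> (j + p + 1)) sums Kd \<theta> i j"
proof -
  obtain c where c: "row_bdd c (hankel (Jn \<theta>))"
    using row_bounded_toep(3)[OF Jn_fast_decay[OF assms]] unfolding row_bounded_def by blast
  show "(\<lambda>p. Jn \<theta> (i + p + 1) * Jn \<theta> (j + p + 1)) sums Kd \<theta> i j"
    using infsum_mult_row_bdd_eq_suminf[OF c c, of i j] by (simp add: hankel_def Kd_def add_ac)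
  have "(\<lambda>p. \<bar>hankel (Jn \<theta>) i p * hankel (Jn \<theta>) p j\<bar>) summable_on UNIV"
    by (rule row_bdd_mult_summable[OF c c])
  then show "summable (\<lambda>p. \<bar>Jn \<theta> (i + p + 1) * Jn \<theta> (j + p + 1)\<bar>)"
    by (intro summable_on_imp_summable) (simp add: hankel_def add_ac)
qed

text \<open>\<open>Kd\<close> is a Gram matrix, so the form is a series of squares. The map
  \<open>f\<close> may repeat sites, since several points can lie in one cell.\<close>

lemma Kd_psd:
  assumes "0 < \<theta>"
  shows "0 \<le> (\<Sum>i<n. \<Sum>j<n. c i * c j * Kd \<theta> (f i) (f j))"
proof -
  have "(\<lambda>p. \<Sum>i<n. \<Sum>j<n. c i * c j * (Jn \<theta> (f i + p + 1) * Jn \<theta> (f j + p + 1)))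
      sums (\<Sum>i<n. \<Sum>j<n. c i * c j * Kd \<theta> (f i) (f j))"
    by (intro sums_sum sums_mult Jn_product_summable(2)[OF assms])
  moreover have "0 \<le> (\<Sum>i<n. \<Sum>j<n. c i * c j * (Jn \<theta> (f i + p + 1) * Jn \<theta> (f j + p + 1)))" for p
  proof -
    have "(\<Sum>i<n. \<Sum>j<n. c i * c j * (Jn \<theta> (f i + p + 1) * Jn \<theta> (f j + p + 1)))
        = (\<Sum>i<n. c i * Jn \<theta> (f i + p + 1)) * (\<Sum>j<n. c j * Jn \<theta> (f j + p + 1))"
      unfolding sum_product by (simp add: mult_ac)
    then show ?thesis
      by simp
  qed
  ultimately show ?thesis
    by (rule sums_le[OF _ sums_zero, rotated])
qed

lemma Kd_sym: "Kd \<theta> i j = Kd \<theta> j i"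
  unfolding Kd_def mmul_def by (rule infsum_cong) (simp add: hankel_def add_ac)

text \<open>\<open>X = {..<k}\<close> gives the cut-off kernels and \<open>X = UNIV\<close> the full
  one. A single bound serves all, as cutting off only drops nonnegative diagonal entries.\<close>

lemma fdet_step_kernel_bounds:
  assumes \<theta>: "0 < \<theta>" and \<rho>: "0 < \<rho>"
  shows "\<bar>fdet n (\<lambda>i j. step_kernel s \<rho> (\<lambda>i j. if i \<in> X \<and> j \<in> X then Kd \<theta> (i + L) (j + L) else 0) (x i) (x j))\<bar>
    \<le> (\<Prod>i<n. step_kernel s \<rho> (\<lambda>i j. Kd \<theta> (i + L) (j + L)) (x i) (x i))"
proof -
  let ?\<iota> = "\<lambda>i. nat \<lfloor>(x i - s) / \<rho>\<rfloor>"
  let ?K = "\<lambda>i j. step_kernel s \<rho> (\<lambda>i j. if i \<in> X \<and> j \<in> X then Kd \<theta> (i + L) (j + L) else 0) (x i) (x j)"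
  let ?K' = "\<lambda>i. step_kernel s \<rho> (\<lambda>i j. Kd \<theta> (i + L) (j + L)) (x i) (x i)"
  have sym: "?K i j = ?K j i" for i j
    by (auto simp: step_kernel_def Kd_sym)
  have psd: "0 \<le> (\<Sum>i<n. \<Sum>j<n. c i * c j * ?K i j)" for c
  proof -
    \<comment> \<open>Cutting the kernel off amounts to cutting off the test vector, so positivity
      is preserved.\<close>
    let ?c = "\<lambda>i. if ?\<iota> i \<in> X then c i else 0"
    have "(\<Sum>i<n. \<Sum>j<n. c i * c j * ?K i j) = (\<Sum>i<n. \<Sum>j<n. ?c i * ?c j * Kd \<theta> (?\<iota> i + L) (?\<iota> j + L)) / \<rho>"
      unfolding sum_divide_distrib by (intro sum.cong refl) (simp add: step_kernel_def)
    then show ?thesis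
      using Kd_psd[OF \<theta>, where c = ?c and f = "\<lambda>i. ?\<iota> i + L"] \<rho> by simp
  qed
  have d0: "0 \<le> Kd \<theta> i i" for i
    using Kd_psd[OF \<theta>, where n = "Suc 0" and c = "\<lambda>_. 1" and f = "\<lambda>_. i"] by simp
  have "\<bar>fdet n ?K\<bar> \<le> (\<Prod>i<n. ?K i i)"
    using fdet_psd_bounds[of n ?K, OF sym psd] by simp
  also have "\<dots> \<le> (\<Prod>i<n. ?K' i)"
    using \<rho> d0 by (intro prod_mono) (auto simp: step_kernel_def)
  finally show ?thesis .
qed

lemma fdet_step_kernel_bounds':
  assumes "0 < \<theta>" "0 < \<rho>"
  shows "\<bar>fdet n (\<lambda>i j. step_kernel s \<rho> (\<lambda>i j. Kd \<theta> (i + L) (j + L)) (x i) (x j))\<bar>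
    \<le> (\<Prod>i<n. step_kernel s \<rho> (\<lambda>i j. Kd \<theta> (i + L) (j + L)) (x i) (x i))"
  using fdet_step_kernel_bounds[OF assms, where X = UNIV] by simp

lemma measure_tendsto_fdet:
  assumes \<theta>: "0 < \<theta>"
  shows "(\<lambda>N. fdet N (\<lambda>i j. (if i = j then 1 else 0) - Kd \<theta> (i + L) (j + L)))
    \<longlonglongrightarrow> measure (schur_measure \<theta> \<gamma>) {\<mu> \<in> space (schur_measure \<theta> \<gamma>). part \<mu> 1 \<le> L}"
proof -
  interpret ft: finite_times "\<lambda>r. \<theta> * \<gamma> r"
    by (rule finite_times_scale[OF \<theta>])
  have K: "ft.K = Kd \<theta>"
    by (simp add: ft.K_def ft.J_def Kd_def Jn_def)
  have \<kappa>: "ft.\<kappa> = \<theta>\<^sup>2 * (\<Sum>r\<in>S. real r * (\<gamma> r)\<^sup>2)"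
    using \<theta> by (simp add: ft.\<kappa>_def supp_scale sum_distrib_left power_mult_distrib mult_ac)
  let ?D = "\<lambda>N. fdet N (\<lambda>i j. (if i = j then 1 else 0) - Kd \<theta> (i + L) (j + L))"
  have "(\<lambda>N. fdet (N + L) ft.gram * ?D N) \<longlonglongrightarrow> fdet L ft.gram"
    using LIMSEQ_ignore_initial_segment[OF ft.fdet_gram_limit[of L], of L] by (simp add: K)
  moreover have g: "(\<lambda>N. fdet (N + L) ft.gram) \<longlonglongrightarrow> exp ft.\<kappa>"
    by (rule LIMSEQ_ignore_initial_segment[OF ft.fdet_gram_tendsto_exp])
  ultimately have "(\<lambda>N. fdet (N + L) ft.gram * ?D N / fdet (N + L) ft.gram) \<longlonglongrightarrow> fdet L ft.gram / exp ft.\<kappa>"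
    by (intro tendsto_divide) auto
  \<comment> \<open>The limit \<open>exp ft.\<kappa>\<close> is positive, so the Gram determinants
    can eventually be cancelled.\<close>
  moreover have "\<forall>\<^sub>F N in sequentially. 0 < fdet (N + L) ft.gram"
    using g by (rule order_tendstoD) simp
  then have "\<forall>\<^sub>F N in sequentially. fdet (N + L) ft.gram * ?D N / fdet (N + L) ft.gram = ?D N"
    by eventually_elim simp
  ultimately have "?D \<longlonglongrightarrow> fdet L ft.gram / exp ft.\<kappa>"
    by (rule Lim_transform_eventually)
  also have "fdet L ft.gram / exp ft.\<kappa> = exp (- ft.\<kappa>) * fdet L ft.gram"
    by (simp add: exp_minus field_simps)
  also have "\<dots> = measure (schur_measure \<theta> \<gamma>) {\<mu> \<in> space (schur_measure \<theta> \<gamma>). part \<mu> 1 \<le> L}"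
    unfolding \<kappa> ft.gram_def using \<theta> by (intro measure_schur_measure_le[symmetric] finite_S) auto
  finally show ?thesis .
qed

text \<open>The second condition gives \<open>rho \<theta> \<le> 1\<close>, and the third keeps
  \<open>nat\<close> from clipping the threshold in \<open>Lcut\<close>.\<close>

definition good :: "real \<Rightarrow> real \<Rightarrow> bool" where
  "good s \<theta> \<longleftrightarrow> 0 < \<theta> \<and> 1 \<le> d * \<theta> \<and> 0 \<le> b * \<theta> + s / rho \<theta>"

definition Lcut :: "real \<Rightarrow> real \<Rightarrow> nat" where
  "Lcut s \<theta> = nat \<lfloor>b * \<theta> + s / rho \<theta>\<rfloor>"

abbreviation stepK :: "real \<Rightarrow> real \<Rightarrow> real \<Rightarrow> real \<Rightarrow> real" where
  "stepK s \<theta> \<equiv> step_kernel s (rho \<theta>) (\<lambda>i j. Kd \<theta> (i + Lcut s \<theta>) (j + Lcut s \<theta>))"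

text \<open>
  The cells of the step kernel are aligned at \<open>s\<close>, so that \<open>x \<ge> s\<close> corresponds exactly to the
  lattice sites from \<open>Lcut\<close> on.
\<close>
definition site :: "real \<Rightarrow> real \<Rightarrow> real \<Rightarrow> real \<Rightarrow> nat" where
  "site s \<theta> x v = nat \<lfloor>(x - s) / rho \<theta>\<rfloor> + Lcut s \<theta> + nat \<lfloor>v / rho \<theta>\<rfloor> + 1"

lemma eventually_good: "\<forall>\<^sub>F \<theta> in at_top. good s \<theta>"
proof -
  \<comment> \<open>\<open>1 / rho \<theta>\<close> equals
    \<open>d * \<theta> * rho \<theta> ^ (2 * m)\<close>, so the shift by \<open>s\<close> is of
    smaller order than \<open>b * \<theta>\<close>, also for negative \<open>s\<close>.\<close>
  have "((\<lambda>\<theta>. b + s * d * rho \<theta> ^ (2 * m)) \<longlongrightarrow> b + s * d * 0 ^ (2 * m)) at_top"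
    by (intro tendsto_intros rho_tendsto filterlim_ident)
  then have "((\<lambda>\<theta>. b + s * d * rho \<theta> ^ (2 * m)) \<longlongrightarrow> b) at_top"
    using m_pos zero_power[of "2 * m", where ?'a = real] by simp
  then have "\<forall>\<^sub>F \<theta> in at_top. 0 < b + s * d * rho \<theta> ^ (2 * m)"
    using b_pos by (rule order_tendstoD)
  then show ?thesis
    using eventually_gt_at_top[of 0] eventually_ge_at_top[of "1 / d"]
  proof eventually_elim
    case (elim \<theta>)
    have \<rho>: "0 < rho \<theta>"
      using elim by (intro rho_pos) simp
    have "1 / rho \<theta> = d * \<theta> * rho \<theta> ^ (2 * m)"
      using rho_power[of \<theta>] elim \<rho> by (simp add: field_simps)
    then have "s / rho \<theta> = s * (d * \<theta> * rho \<theta> ^ (2 * m))"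
      by (metis mult.right_neutral times_divide_eq_right)
    then have "b * \<theta> + s / rho \<theta> = \<theta> * (b + s * d * rho \<theta> ^ (2 * m))"
      by (simp add: algebra_simps)
    moreover have "1 \<le> d * \<theta>"
      using elim d_pos by (simp add: field_simps)
    ultimately show ?case
      using elim by (simp add: good_def)
  qed
qed

text \<open>Each of the three roundings loses at most \<open>rho \<theta>\<close>, and the offset 1
  of the Hankel index gives one \<open>rho \<theta>\<close> back.\<close>

lemma site_bounds:
  assumes "good s \<theta>" "s \<le> x" "0 \<le> v"
  shows "x + v - 2 * rho \<theta> \<le> rho \<theta> * (real (site s \<theta> x v) - b * \<theta>)"
    and "rho \<theta> * (real (site s \<theta> x v) - b * \<theta>) \<le> x + v + rho \<theta>"
proof -
  have \<theta>: "0 < \<theta>" "0 \<le> b * \<theta> + s / rho \<theta>"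
    using assms(1) by (auto simp: good_def)
  have \<rho>: "0 < rho \<theta>"
    by (rule rho_pos[OF \<theta>(1)])
  have L: "b * \<theta> + s / rho \<theta> - 1 \<le> real (Lcut s \<theta>)" "real (Lcut s \<theta>) \<le> b * \<theta> + s / rho \<theta>"
  proof -
    have "real (Lcut s \<theta>) = of_int \<lfloor>b * \<theta> + s / rho \<theta>\<rfloor>"
      using \<theta> by (simp add: Lcut_def)
    then show "b * \<theta> + s / rho \<theta> - 1 \<le> real (Lcut s \<theta>)" "real (Lcut s \<theta>) \<le> b * \<theta> + s / rho \<theta>"
      by linarith+
  qed
  have L': "s - rho \<theta> \<le> rho \<theta> * (real (Lcut s \<theta>) - b * \<theta>)" "rho \<theta> * (real (Lcut s \<theta>) - b * \<theta>) \<le> s"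
    using mult_left_mono[OF L(1), of "rho \<theta>"] mult_left_mono[OF L(2), of "rho \<theta>"] \<rho> by (simp_all add: algebra_simps)
  have e: "rho \<theta> * (real (site s \<theta> x v) - b * \<theta>) = rho \<theta> * real (nat \<lfloor>(x - s) / rho \<theta>\<rfloor>)
      + rho \<theta> * (real (Lcut s \<theta>) - b * \<theta>) + rho \<theta> * real (nat \<lfloor>v / rho \<theta>\<rfloor>) + rho \<theta>"
    by (simp add: site_def algebra_simps)
  show "x + v - 2 * rho \<theta> \<le> rho \<theta> * (real (site s \<theta> x v) - b * \<theta>)"
    "rho \<theta> * (real (site s \<theta> x v) - b * \<theta>) \<le> x + v + rho \<theta>"
    using floor_scaled_bounds[OF \<rho>, of "x - s"] floor_scaled_bounds[OF \<rho>, of v] L' assms unfolding e by linarith+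
qed

lemma stepK_integral:
  assumes "good s \<theta>"
  shows "stepK s \<theta> x y = (LINT v:{0..}|lborel. Jn \<theta> (site s \<theta> x v) / rho \<theta> * (Jn \<theta> (site s \<theta> y v) / rho \<theta>))"
proof -
  have \<theta>: "0 < \<theta>"
    using assms by (simp add: good_def)
  have \<rho>: "0 < rho \<theta>"
    by (rule rho_pos[OF \<theta>])
  let ?i = "nat \<lfloor>(x - s) / rho \<theta>\<rfloor> + Lcut s \<theta>" and ?j = "nat \<lfloor>(y - s) / rho \<theta>\<rfloor> + Lcut s \<theta>"
  let ?f = "\<lambda>p. Jn \<theta> (?i + p + 1) * Jn \<theta> (?j + p + 1) / (rho \<theta>)\<^sup>2"
  have "(LINT v:{0..}|lborel. ?f (nat \<lfloor>v / rho \<theta>\<rfloor>)) = rho \<theta> * (\<Sum>p. ?f p)"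
  proof (rule integral_nat_floor[OF \<rho>])
    show "summable (\<lambda>p. \<bar>?f p\<bar>)"
      using summable_divide[OF Jn_product_summable(1)[OF \<theta>, of ?i ?j], of "(rho \<theta>)\<^sup>2"] by (simp add: abs_divide)
  qed
  also have "(\<Sum>p. ?f p) = Kd \<theta> ?i ?j / (rho \<theta>)\<^sup>2"
    using sums_divide[OF Jn_product_summable(2)[OF \<theta>, of ?i ?j], of "(rho \<theta>)\<^sup>2"] by (simp only: sums_iff)
  also have "rho \<theta> * (Kd \<theta> ?i ?j / (rho \<theta>)\<^sup>2) = stepK s \<theta> x y"
    using \<rho> by (simp add: step_kernel_def power2_eq_square)
  finally show ?thesis
    by (simp add: site_def power2_eq_square)
qed

lemma stepK_diag_bound:
  obtains w where "0 \<le> w" "\<And>\<theta> x. good s \<theta> \<Longrightarrow> s \<le> x \<Longrightarrow> stepK s \<theta> x x \<le> w * exp (- 2 * x)"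
proof -
  obtain K where K: "0 \<le> K"
    "\<And>\<theta> n. 0 < \<theta> \<Longrightarrow> 1 \<le> d * \<theta> \<Longrightarrow> \<bar>Jn \<theta> n / rho \<theta>\<bar> \<le> K * exp (- (rho \<theta> * (real n - b * \<theta>)))"
    using Jn_bound by blast
  let ?V = "\<integral>v. indicator {0..} v * exp (- 2 * v :: real) \<partial>lborel"
  show ?thesis
  \<comment> \<open>Each of the two factors loses at most \<open>exp 2\<close> to rounding, because
    \<open>2 * rho \<theta> \<le> 2\<close>; together they give \<open>exp 4\<close>.\<close>
  proof (rule that[of "K\<^sup>2 * exp 4 * ?V"])
    show "0 \<le> K\<^sup>2 * exp 4 * ?V"
      by (intro mult_nonneg_nonneg Bochner_Integration.integral_nonneg) auto
    fix \<theta> x assume g: "good s \<theta>" and x: "s \<le> x"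
    have \<theta>: "0 < \<theta>" "1 \<le> d * \<theta>"
      using g by (auto simp: good_def)
    let ?a = "\<lambda>v. Jn \<theta> (site s \<theta> x v) / rho \<theta>"
    have le: "?a v * ?a v \<le> K\<^sup>2 * exp 4 * exp (- 2 * x) * exp (- 2 * v)" if v: "0 \<le> v" for v
    proof -
      have "\<bar>?a v\<bar> \<le> K * exp (- (rho \<theta> * (real (site s \<theta> x v) - b * \<theta>)))"
        by (rule K(2)[OF \<theta>])
      also have "\<dots> \<le> K * exp (2 - x - v)"
        using site_bounds(1)[OF g x v] rho_le_one[OF \<theta>(2)] K(1) by (intro mult_left_mono) auto
      finally have "\<bar>?a v\<bar> * \<bar>?a v\<bar> \<le> (K * exp (2 - x - v)) * (K * exp (2 - x - v))"
        using K(1) by (intro mult_mono) auto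
      also have "\<dots> = K\<^sup>2 * (exp (2 - x - v) * exp (2 - x - v))"
        by (simp add: power2_eq_square)
      also have "exp (2 - x - v) * exp (2 - x - v) = exp 4 * exp (- 2 * x) * exp (- 2 * v)"
        unfolding exp_add[symmetric] by (rule arg_cong[of _ _ exp]) simp
      finally show ?thesis
        by (simp add: mult.assoc)
    qed
    have int: "integrable lborel (\<lambda>v. indicator {0..} v * exp (- 2 * v :: real))"
      using integrable_exp_neg_atLeast[of 2 0] by simp
    have "stepK s \<theta> x x = (\<integral>v. indicator {0..} v * (?a v * ?a v) \<partial>lborel)"
      unfolding stepK_integral[OF g] by (simp add: set_lebesgue_integral_def)
    also have "\<dots> \<le> (\<integral>v. K\<^sup>2 * exp 4 * exp (- 2 * x) * (indicator {0..} v * exp (- 2 * v)) \<partial>lborel)"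
    proof (rule integral_mono_AE')
      show "integrable lborel (\<lambda>v. K\<^sup>2 * exp 4 * exp (- 2 * x) * (indicator {0..} v * exp (- 2 * v)))"
        by (rule integrable_mult_right[OF int])
    qed (use le in \<open>auto simp: indicator_def\<close>)
    also have "\<dots> = K\<^sup>2 * exp 4 * exp (- 2 * x) * (\<integral>v. indicator {0..} v * exp (- 2 * v) \<partial>lborel)"
      by (rule Bochner_Integration.integral_mult_right_zero)
    finally show "stepK s \<theta> x x \<le> K\<^sup>2 * exp 4 * ?V * exp (- 2 * x)"
      by (simp only: mult_ac)
  qed
qed

text \<open>For fixed \<open>\<theta>\<close> both sides are the limit of the same determinants:
  those on \<open>N\<close> lattice sites are the Fredholm determinants of the kernels cut off at
  \<open>N\<close>.\<close>

lemma measure_eq_fredholm_det: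
  assumes g: "good s \<theta>"
  shows "measure (schur_measure \<theta> \<gamma>) {\<mu> \<in> space (schur_measure \<theta> \<gamma>). part \<mu> 1 \<le> Lcut s \<theta>} = fredholm_det (stepK s \<theta>) {s..}"
proof -
  have \<theta>: "0 < \<theta>"
    using g by (simp add: good_def)
  have \<rho>: "0 < rho \<theta>"
    by (rule rho_pos[OF \<theta>])
  obtain w where w: "0 \<le> w" "\<And>\<theta> x. good s \<theta> \<Longrightarrow> s \<le> x \<Longrightarrow> stepK s \<theta> x x \<le> w * exp (- 2 * x)"
    using stepK_diag_bound by blast
  let ?KN = "\<lambda>N. step_kernel s (rho \<theta>) (\<lambda>i j. if i < N \<and> j < N then Kd \<theta> (i + Lcut s \<theta>) (j + Lcut s \<theta>) else 0)"
  have d0: "0 \<le> Kd \<theta> i i" for i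
    using Kd_psd[OF \<theta>, where n = "Suc 0" and c = "\<lambda>_. 1" and f = "\<lambda>_. i"] by simp
  have "(\<lambda>N. fredholm_det (?KN N) {s..}) \<longlonglongrightarrow> fredholm_det (stepK s \<theta>) {s..}"
  proof (rule fredholm_det_tendsto[where w = "\<lambda>x. w * exp (- 2 * x)"])
    show "(\<lambda>N. ?KN N x y) \<longlonglongrightarrow> stepK s \<theta> x y" for x y
    proof (rule tendsto_eventually)
      show "\<forall>\<^sub>F N in sequentially. ?KN N x y = stepK s \<theta> x y"
        using eventually_gt_at_top[of "nat \<lfloor>(x - s) / rho \<theta>\<rfloor>"] eventually_gt_at_top[of "nat \<lfloor>(y - s) / rho \<theta>\<rfloor>"]
        by eventually_elim (simp add: step_kernel_def)
    qed
    show "integrable lborel (\<lambda>x. indicator {s..} x * (w * exp (- 2 * x)))"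
      using integrable_mult_right[OF integrable_exp_neg_atLeast[of 2 s], of w] by (simp add: mult_ac)
    fix k n :: nat and x :: "nat \<Rightarrow> real" assume x: "\<And>i. i < n \<Longrightarrow> x i \<in> {s..}"
    have "\<bar>fdet n (\<lambda>i j. ?KN k (x i) (x j))\<bar> \<le> (\<Prod>i<n. stepK s \<theta> (x i) (x i))"
      using fdet_step_kernel_bounds[OF \<theta> \<rho>, where X = "{..<k}"] by simp
    also have "\<dots> \<le> (\<Prod>i<n. w * exp (- 2 * x i))"
      using x w(2)[OF g] d0 \<rho> by (intro prod_mono) (auto simp: step_kernel_def)
    finally show "\<bar>fdet n (\<lambda>i j. ?KN k (x i) (x j))\<bar> \<le> (\<Prod>i<n. w * exp (- 2 * x i))" .
  qed (use w step_kernel_measurable in auto)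
  then show ?thesis
    unfolding fredholm_det_step_kernel[OF \<rho>] using measure_tendsto_fdet[OF \<theta>] by (rule LIMSEQ_unique[symmetric])
qed

lemma stepK_tendsto:
  assumes g: "\<And>k. good s (\<theta> k)" and lim: "filterlim \<theta> at_top sequentially" and x: "s \<le> x" and y: "s \<le> y"
  shows "(\<lambda>k. stepK s (\<theta> k) x y) \<longlonglongrightarrow> higher_airy_kernel m x y"
proof -
  obtain K where K: "0 \<le> K"
    "\<And>\<theta> n. 0 < \<theta> \<Longrightarrow> 1 \<le> d * \<theta> \<Longrightarrow> \<bar>Jn \<theta> n / rho \<theta>\<bar> \<le> K * exp (- (rho \<theta> * (real n - b * \<theta>)))"
    using Jn_bound by blast
  have \<theta>: "0 < \<theta> k" "1 \<le> d * \<theta> k" for k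
    using g[of k] by (auto simp: good_def)
  let ?a = "\<lambda>k x v. Jn (\<theta> k) (site s (\<theta> k) x v) / rho (\<theta> k)"
  have pt: "(\<lambda>k. ?a k x v) \<longlonglongrightarrow> higher_airy m (x + v)" if x: "s \<le> x" and v: "0 \<le> v" for x v
  proof (rule Jn_tendsto_airy[OF lim \<theta>(1)])
    have \<rho>0: "(\<lambda>k. rho (\<theta> k)) \<longlonglongrightarrow> 0"
      by (rule rho_tendsto[OF lim])
    show "(\<lambda>k. rho (\<theta> k) * (real (site s (\<theta> k) x v) - b * \<theta> k)) \<longlonglongrightarrow> x + v"
    proof (rule tendsto_sandwich)
      show "(\<lambda>k. x + v - 2 * rho (\<theta> k)) \<longlonglongrightarrow> x + v"
        using tendsto_diff[OF tendsto_const[of "x + v"] tendsto_mult_right_zero[OF \<rho>0, of 2]] by simp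
      show "(\<lambda>k. x + v + rho (\<theta> k)) \<longlonglongrightarrow> x + v"
        using tendsto_add[OF tendsto_const[of "x + v"] \<rho>0] by simp
    qed (use site_bounds[OF g x v] in auto)
  qed
  have bd: "\<bar>?a k x v\<bar> \<le> K * exp (2 - x - v)" if x: "s \<le> x" and v: "0 \<le> v" for k x v
  proof -
    have "\<bar>?a k x v\<bar> \<le> K * exp (- (rho (\<theta> k) * (real (site s (\<theta> k) x v) - b * \<theta> k)))"
      by (rule K(2)[OF \<theta>])
    also have "\<dots> \<le> K * exp (2 - x - v)"
    proof (rule mult_left_mono[OF _ K(1)])
      have "- (rho (\<theta> k) * (real (site s (\<theta> k) x v) - b * \<theta> k)) \<le> 2 - x - v"
        using site_bounds(1)[OF g x v, of k] rho_le_one[OF \<theta>(2), of k] by linarith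
      then show "exp (- (rho (\<theta> k) * (real (site s (\<theta> k) x v) - b * \<theta> k))) \<le> exp (2 - x - v)"
        by (simp only: exp_le_cancel_iff)
    qed
    finally show ?thesis .
  qed
  let ?F = "\<lambda>k v. indicator {0..} v * (?a k x v * ?a k y v)"
  have meas: "?F k \<in> borel_measurable lborel" for k
  proof -
    have idx: "(\<lambda>v. nat \<lfloor>v / rho (\<theta> k)\<rfloor>) \<in> measurable borel (count_space UNIV)"
      by measurable
    have "(\<lambda>v. ?a k z v) \<in> borel_measurable borel" for z
      unfolding site_def
      by (rule measurable_compose[OF idx, where g = "\<lambda>p. Jn (\<theta> k) (nat \<lfloor>(z - s) / rho (\<theta> k)\<rfloor> + Lcut s (\<theta> k) + p + 1) / rho (\<theta> k)"]) simp
    then have "?F k \<in> borel_measurable borel"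
      by (intro borel_measurable_times borel_measurable_indicator) auto
    then show ?thesis
      by (simp only: measurable_lborel2)
  qed
  have ptF: "(\<lambda>k. ?F k v) \<longlonglongrightarrow> indicator {0..} v * (higher_airy m (x + v) * higher_airy m (y + v))" for v
  proof (cases "0 \<le> v")
    case True
    then have i: "indicator {0..} v = (1 :: real)"
      by simp
    show ?thesis
      unfolding i by (intro tendsto_mult tendsto_const pt x y True)
  qed simp
  have "(\<lambda>k. \<integral>v. ?F k v \<partial>lborel) \<longlonglongrightarrow> (\<integral>v. indicator {0..} v * (higher_airy m (x + v) * higher_airy m (y + v)) \<partial>lborel)"
  proof (rule integral_dominated_convergence[where w = "\<lambda>v. K\<^sup>2 * exp (4 - x - y) * (indicator {0..} v * exp (- 2 * v))"])
    show "(\<lambda>v. indicator {0..} v * (higher_airy m (x + v) * higher_airy m (y + v))) \<in> borel_measurable lborel"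
      by (rule borel_measurable_LIMSEQ_real[OF ptF meas])
    show "integrable lborel (\<lambda>v. K\<^sup>2 * exp (4 - x - y) * (indicator {0..} v * exp (- 2 * v)))"
      using integrable_exp_neg_atLeast[of 2 0] by (intro integrable_mult_right) simp
    show "AE v in lborel. norm (?F k v) \<le> K\<^sup>2 * exp (4 - x - y) * (indicator {0..} v * exp (- 2 * v))" for k
    proof (rule AE_I2)
      fix v :: real
      show "norm (?F k v) \<le> K\<^sup>2 * exp (4 - x - y) * (indicator {0..} v * exp (- 2 * v))"
      proof (cases "0 \<le> v")
        case True
        have "\<bar>?a k x v\<bar> * \<bar>?a k y v\<bar> \<le> (K * exp (2 - x - v)) * (K * exp (2 - y - v))"
          using K(1) by (intro mult_mono bd x y True) auto
        also have "\<dots> = K\<^sup>2 * (exp (2 - x - v) * exp (2 - y - v))"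
          by (simp add: power2_eq_square)
        also have "exp (2 - x - v) * exp (2 - y - v) = exp (4 - x - y) * exp (- 2 * v)"
          unfolding exp_add[symmetric] by (rule arg_cong[of _ _ exp]) simp
        finally show ?thesis
          using True by (simp add: abs_mult mult.assoc)
      qed simp
    qed
  qed (use meas ptF in auto)
  then show ?thesis
    by (simp add: stepK_integral[OF g] higher_airy_kernel_def set_lebesgue_integral_def)
qed

text \<open>The majorant \<open>w * exp (- 2 * x)\<close> is the same for all good
  \<open>\<theta>\<close>, so it dominates the whole sequence.\<close>

lemma fredholm_det_stepK_tendsto:
  assumes g: "\<And>k. good s (\<theta> k)" and lim: "filterlim \<theta> at_top sequentially"
  shows "(\<lambda>k. fredholm_det (stepK s (\<theta> k)) {s..}) \<longlonglongrightarrow> F_higher m s"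
  unfolding F_higher_def
proof -
  obtain w where w: "0 \<le> w" "\<And>\<theta> x. good s \<theta> \<Longrightarrow> s \<le> x \<Longrightarrow> stepK s \<theta> x x \<le> w * exp (- 2 * x)"
    using stepK_diag_bound by blast
  have \<theta>: "0 < \<theta> k" for k
    using g[of k] by (simp add: good_def)
  show "(\<lambda>k. fredholm_det (stepK s (\<theta> k)) {s..}) \<longlonglongrightarrow> fredholm_det (higher_airy_kernel m) {s..}"
  proof (rule fredholm_det_tendsto[where w = "\<lambda>x. w * exp (- 2 * x)"])
    show "integrable lborel (\<lambda>x. indicator {s..} x * (w * exp (- 2 * x)))"
      using integrable_mult_right[OF integrable_exp_neg_atLeast[of 2 s], of w] by (simp add: mult_ac)
    fix k n :: nat and x :: "nat \<Rightarrow> real" assume x: "\<And>i. i < n \<Longrightarrow> x i \<in> {s..}"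
    have d0: "0 \<le> Kd (\<theta> k) i i" for i
      using Kd_psd[OF \<theta>, where n = "Suc 0" and c = "\<lambda>_. 1" and f = "\<lambda>_. i"] by simp
    have "\<bar>fdet n (\<lambda>i j. stepK s (\<theta> k) (x i) (x j))\<bar> \<le> (\<Prod>i<n. stepK s (\<theta> k) (x i) (x i))"
      by (rule fdet_step_kernel_bounds'[OF \<theta> rho_pos[OF \<theta>]])
    also have "\<dots> \<le> (\<Prod>i<n. w * exp (- 2 * x i))"
      using x w(2)[OF g] d0 rho_pos[OF \<theta>, of k] by (intro prod_mono) (auto simp: step_kernel_def)
    finally show "\<bar>fdet n (\<lambda>i j. stepK s (\<theta> k) (x i) (x j))\<bar> \<le> (\<Prod>i<n. w * exp (- 2 * x i))" .
  qed (use w step_kernel_measurable stepK_tendsto[OF g lim] in auto)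
qed

text \<open>The first part is an integer, so the real threshold may be replaced by its floor; a
  negative threshold would break this, as \<open>nat\<close> would raise it to 0.\<close>

lemma event_eq:
  assumes "good s \<theta>"
  shows "{\<mu> \<in> space (schur_measure \<theta> \<gamma>). (real (part \<mu> 1) - b * \<theta>) / (d * \<theta>) powr (1 / real (2 * m + 1)) \<le> s}
    = {\<mu> \<in> space (schur_measure \<theta> \<gamma>). part \<mu> 1 \<le> Lcut s \<theta>}"
proof -
  have \<theta>: "0 < \<theta>" "0 \<le> b * \<theta> + s / rho \<theta>"
    using assms by (auto simp: good_def)
  have \<rho>: "0 < rho \<theta>"
    by (rule rho_pos[OF \<theta>(1)])
  have pw: "(d * \<theta>) powr (1 / real (2 * m + 1)) = 1 / rho \<theta>"
    by (simp add: rho_def powr_minus_divide)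
  have "(real n - b * \<theta>) / (d * \<theta>) powr (1 / real (2 * m + 1)) \<le> s \<longleftrightarrow> n \<le> Lcut s \<theta>" for n
  proof -
    have "(real n - b * \<theta>) / (d * \<theta>) powr (1 / real (2 * m + 1)) \<le> s \<longleftrightarrow> real n \<le> b * \<theta> + s / rho \<theta>"
      unfolding pw using \<rho> by (simp add: field_simps)
    also have "\<dots> \<longleftrightarrow> int n \<le> \<lfloor>b * \<theta> + s / rho \<theta>\<rfloor>"
      by (simp add: le_floor_iff)
    also have "\<dots> \<longleftrightarrow> n \<le> Lcut s \<theta>"
      using \<theta> unfolding Lcut_def by (simp add: le_nat_iff)
    finally show ?thesis .
  qed
  then show ?thesis
    by simp
qed

end

theorem theorem2:
  fixes m :: nat and \<gamma> :: "nat \<Rightarrow> real" and s :: real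
  assumes "1 \<le> m"
    and "multicritical m \<gamma>"
  shows "((\<lambda>\<theta>. measure (schur_measure \<theta> \<gamma>)
            {\<mu> \<in> space (schur_measure \<theta> \<gamma>).
               (real (part \<mu> 1) - edge_coeff \<gamma> * \<theta>)
                 / (fluct_coeff m \<gamma> * \<theta>) powr (1 / real (2 * m + 1)) \<le> s})
          \<longlongrightarrow> F_higher m s) at_top"
proof (rule tendsto_at_topI_sequentially)
  interpret multicritical_times m \<gamma>
    using assms by unfold_locales
  \<comment> \<open>Sequences are used because dominated convergence works along them; dropping an
    initial segment makes \<open>good\<close> hold at every index.\<close>
  fix X :: "nat \<Rightarrow> real" assume X: "filterlim X at_top sequentially"
  have "\<forall>\<^sub>F k in sequentially. good s (X k)"
    using eventually_good X unfolding filterlim_iff by blast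
  then obtain k0 where k0: "\<And>k. k0 \<le> k \<Longrightarrow> good s (X k)"
    unfolding eventually_sequentially by blast
  let ?P = "\<lambda>\<theta>. measure (schur_measure \<theta> \<gamma>)
            {\<mu> \<in> space (schur_measure \<theta> \<gamma>).
               (real (part \<mu> 1) - edge_coeff \<gamma> * \<theta>)
                 / (fluct_coeff m \<gamma> * \<theta>) powr (1 / real (2 * m + 1)) \<le> s}"
  have "filterlim (\<lambda>k. X (k + k0)) at_top sequentially"
    using X by (rule filterlim_compose) (rule filterlim_add_const_nat_at_top)
  then have "(\<lambda>k. fredholm_det (stepK s (X (k + k0))) {s..}) \<longlonglongrightarrow> F_higher m s"
    by (intro fredholm_det_stepK_tendsto k0) auto
  moreover have "?P (X (k + k0)) = fredholm_det (stepK s (X (k + k0))) {s..}" for k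
    using k0[of "k + k0"] by (simp only: event_eq measure_eq_fredholm_det le_add2)
  ultimately have "(\<lambda>k. ?P (X (k + k0))) \<longlonglongrightarrow> F_higher m s"
    by (simp only:)
  then show "(\<lambda>k. ?P (X k)) \<longlonglongrightarrow> F_higher m s"
    by (rule LIMSEQ_offset)
qed

end
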